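(* Let $S$ be a closed orientable hyperbolic surface and $f\in\mathrm{Homeo}_0(S)$. For each $\mu\in\mathcal{M}^{\mathrm{erg}}_{\vartheta>0}(f)$ there exists a probability measure $\nu_\mu$ on the unit tangent bundle $\mathrm{T}^1S$ such that, for $\mu$-a.e. $x\in S$, the tracking geodesic $\gamma_x$ equidistributes to $\nu_\mu$. Furthermore, $\nu_\mu$ is invariant and ergodic with respect to the geodesic flow on $\mathrm{T}^1S$, and its support satisfies $$\mathrm{supp}(\nu_\mu)=\overline{\dot\gamma_x(\mathbb{R})}\quad\text{for }\mu\text{-a.e. }x\in S.$$
   Context: $S$ is a closed orientable surface of genus $\ge 2$ with a hyperbolic metric; $\widetilde S\simeq\mathbb{H}^2$ is its universal cover with lifted distance $\widetilde{\mathrm{dist}}$ and $\Gamma$ the group of deck transformations. $\mathrm{Homeo}_0(S)$ is the set of homeomorphisms of $S$ isotopic to the identity; each $f\in\mathrm{Homeo}_0(S)$ has a unique lift $\widetilde f$ to $\widetilde S$ commuting with all elements of $\Gamma$. Rotation speed: $L_n(x)=\widetilde{\mathrm{dist}}(\widetilde x,\widetilde f^n(\widetilde x))$ for any lift $\widetilde x$ of $x$; $\vartheta(x)$ is the common value of $\lim_{n\to+\infty}\frac1nL_n(x)$ and $\lim_{n\to+\infty}\frac1nL_n(f^{-n}(x))$ if both exist and coincide. For every ergodic $f$-invariant Borel probability $\mu$, $\vartheta$ is $\mu$-a.e. equal to a constant $\vartheta_\mu$; $\mathcal{M}^{\mathrm{erg}}_{\vartheta>0}(f)$ is the set of those with $\vartheta_\mu>0$.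 A geodesic is a local isometry $\gamma:\mathbb{R}\to S$, with lift $\dot\gamma:\mathbb{R}\to\mathrm{T}^1S$. A point $x$ admits a tracking geodesic $\gamma$ if $\vartheta(x)>0$ and for each lift $\widetilde x$ of $x$ there is a lift $\widetilde\gamma$ of $\gamma$ with $\frac1n\widetilde{\mathrm{dist}}(\widetilde f^{n}(\widetilde x),\widetilde\gamma(n\vartheta(x)))\to0$ and $\frac1n\widetilde{\mathrm{dist}}(\widetilde f^{-n}(\widetilde x),\widetilde\gamma(-n\vartheta(x)))\to0$ as $n\to+\infty$. For $\mu\in\mathcal{M}^{\mathrm{erg}}_{\vartheta>0}(f)$, $\mu$-a.e. $x$ admits a tracking geodesic, unique up to translation of the parameter; $\gamma_x$ denotes the one normalized by $\widetilde{\mathrm{dist}}(\widetilde x,\widetilde\gamma(0))=\widetilde{\mathrm{dist}}(\widetilde x,\widetilde\gamma(\mathbb{R}))$. A geodesic $\gamma$ equidistributes to a probability measure $\nu$ on $\mathrm{T}^1S$ if for every continuous $\varphi:\mathrm{T}^1S\to\mathbb{R}$, $\lim_{T\to+\infty}\frac1T\int_0^T\varphi(\dot\gamma(t))\,dt=\lim_{T\to+\infty}\frac1T\int_{-T}^0\varphi(\dot\gamma(t))\,dt=\int\varphi\,d\nu$. *)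

theory Defs
  imports "HOL-Probability.Probability"
begin

text \<open>Upper half-plane model; tangent vectors at a point are complex numbers.\<close>

definition hplane :: "complex set" where
  "hplane = {z. Im z > 0}"

definition hdist :: "complex \<Rightarrow> complex \<Rightarrow> real" where
  "hdist z w = arcosh (1 + (cmod (z - w))\<^sup>2 / (2 * Im z * Im w))"

text \<open>An isometry of the hyperbolic plane preserves orientation iff it is holomorphic (the
  orientation-reversing ones are antiholomorphic).\<close>

definition oriented_hisometry :: "(complex \<Rightarrow> complex) \<Rightarrow> bool" where
  "oriented_hisometry g \<longleftrightarrow>
     bij_betw g hplane hplane \<and> g holomorphic_on hplane \<and>
     (\<forall>z\<in>hplane. \<forall>w\<in>hplane. hdist (g z) (g w) = hdist z w)"

text \<open>Maps between \<open>hplane\<close> and itself are total functions on \<open>complex\<close> whose values off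
  \<open>hplane\<close> are irrelevant; similarly for maps of a surface \<open>S\<close>.\<close>

definition deck :: "(complex \<Rightarrow> 'a) \<Rightarrow> (complex \<Rightarrow> complex) set" where
  "deck p = {g. (\<exists>h. homeomorphism hplane hplane g h) \<and> (\<forall>z\<in>hplane. p (g z) = p z)}"

text \<open>A closed orientable hyperbolic surface \<open>S\<close> together with its universal covering
  \<open>p\<close>. The last two conditions say that \<open>S\<close> carries the metric and the
  orientation of the quotient of the hyperbolic plane by the deck group; in particular \<open>p\<close>
  is a local isometry. Connectedness follows from \<open>p\<close> being onto, and genus at least 2 from
  Gauss-Bonnet.\<close>

definition closed_hyperbolic_surface :: "'a::metric_space set \<Rightarrow> (complex \<Rightarrow> 'a) \<Rightarrow> bool" where
  "closed_hyperbolic_surface S p \<longleftrightarrow>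
     compact S \<and> covering_space hplane p S \<and>
     (\<forall>g\<in>deck p. oriented_hisometry g) \<and>
     (\<forall>z\<in>hplane. \<forall>w\<in>hplane. dist (p z) (p w) = (INF u\<in>{u\<in>hplane. p u = p w}. hdist z u))"

definition Homeo0 :: "'a::topological_space set \<Rightarrow> ('a \<Rightarrow> 'a) set" where
  "Homeo0 S = {f. homotopic_with_canon (\<lambda>g. \<exists>h. homeomorphism S S g h) S S id f}"

definition is_commuting_lift ::
    "(complex \<Rightarrow> 'a) \<Rightarrow> ('a \<Rightarrow> 'a) \<Rightarrow> (complex \<Rightarrow> complex) \<Rightarrow> bool" where
  "is_commuting_lift p f F \<longleftrightarrow>
     continuous_on hplane F \<and> F ` hplane \<subseteq> hplane \<and>
     (\<forall>z\<in>hplane. p (F z) = f (p z)) \<and>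
     (\<forall>g\<in>deck p. \<forall>z\<in>hplane. F (g z) = g (F z))"

text \<open>On \<open>hplane\<close> the canonical lift of \<open>f\<close> in \<open>Homeo0 S\<close> is uniquely determined.\<close>

definition can_lift :: "(complex \<Rightarrow> 'a) \<Rightarrow> ('a \<Rightarrow> 'a) \<Rightarrow> complex \<Rightarrow> complex" where
  "can_lift p f = (SOME F. is_commuting_lift p f F)"

text \<open>The choice of the lift of \<open>x\<close> is immaterial, since \<open>can_lift p f\<close> commutes with the
  isometric deck group.\<close>

definition displacement ::
    "(complex \<Rightarrow> 'a) \<Rightarrow> ('a \<Rightarrow> 'a) \<Rightarrow> nat \<Rightarrow> 'a \<Rightarrow> real" where
  "displacement p f n x =
     (let z = (SOME z. z \<in> hplane \<and> p z = x) in hdist z ((can_lift p f ^^ n) z))"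

definition has_rotation_speed ::
    "'a set \<Rightarrow> (complex \<Rightarrow> 'a) \<Rightarrow> ('a \<Rightarrow> 'a) \<Rightarrow> 'a \<Rightarrow> real \<Rightarrow> bool" where
  "has_rotation_speed S p f x v \<longleftrightarrow>
     (\<lambda>n. displacement p f n x / real n) \<longlonglongrightarrow> v \<and>
     (\<lambda>n. displacement p f n ((inv_into S f ^^ n) x) / real n) \<longlonglongrightarrow> v"

text \<open>Stated for a set of maps, to cover both the iterates of one map and a flow.\<close>

definition invariant_under :: "'b measure \<Rightarrow> ('b \<Rightarrow> 'b) set \<Rightarrow> bool" where
  "invariant_under M \<T> \<longleftrightarrow> (\<forall>T\<in>\<T>. T \<in> measurable M M \<and> distr M M T = M)"

definition ergodic_under :: "'b measure \<Rightarrow> ('b \<Rightarrow> 'b) set \<Rightarrow> bool" where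
  "ergodic_under M \<T> \<longleftrightarrow>
     (\<forall>A\<in>sets M. (\<forall>T\<in>\<T>. T -` A \<inter> space M = A) \<longrightarrow> emeasure M A = 0 \<or> emeasure M A = 1)"

definition erg_pos_speed ::
    "'a::metric_space set \<Rightarrow> (complex \<Rightarrow> 'a) \<Rightarrow> ('a \<Rightarrow> 'a) \<Rightarrow> 'a measure set" where
  "erg_pos_speed S p f =
     {\<mu>. prob_space \<mu> \<and> sets \<mu> = sets (restrict_space borel S) \<and>
         invariant_under \<mu> {f} \<and> ergodic_under \<mu> {f} \<and>
         (\<exists>v>0. AE x in \<mu>. has_rotation_speed S p f x v)}"

definition is_geodesic :: "'a::metric_space set \<Rightarrow> (real \<Rightarrow> 'a) \<Rightarrow> bool" where
  "is_geodesic S \<gamma> \<longleftrightarrow>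
     range \<gamma> \<subseteq> S \<and>
     (\<forall>t. \<exists>e>0. \<forall>r\<in>ball t e. \<forall>s\<in>ball t e. dist (\<gamma> r) (\<gamma> s) = dist r s)"

definition is_curve_lift ::
    "(complex \<Rightarrow> 'a) \<Rightarrow> (real \<Rightarrow> 'a) \<Rightarrow> (real \<Rightarrow> complex) \<Rightarrow> bool" where
  "is_curve_lift p \<gamma> c \<longleftrightarrow>
     continuous_on UNIV c \<and> range c \<subseteq> hplane \<and> (\<forall>t. p (c t) = \<gamma> t)"

definition tracks ::
    "(complex \<Rightarrow> complex) \<Rightarrow> complex \<Rightarrow> real \<Rightarrow> (real \<Rightarrow> complex) \<Rightarrow> bool" where
  "tracks F z v c \<longleftrightarrow>
     (\<lambda>n. hdist ((F ^^ n) z) (c (real n * v)) / real n) \<longlonglongrightarrow> 0 \<and>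
     (\<lambda>n. hdist ((inv_into hplane F ^^ n) z) (c (- real n * v)) / real n) \<longlonglongrightarrow> 0"

text \<open>Tracking geodesic of \<open>x\<close>, with the parameter normalized so that the time 0 point of
  the tracking lift realizes the distance from the lift of \<open>x\<close> to it.\<close>

definition is_tracking_geodesic ::
    "'a::metric_space set \<Rightarrow> (complex \<Rightarrow> 'a) \<Rightarrow> ('a \<Rightarrow> 'a) \<Rightarrow> 'a \<Rightarrow> (real \<Rightarrow> 'a) \<Rightarrow> bool" where
  "is_tracking_geodesic S p f x \<gamma> \<longleftrightarrow>
     is_geodesic S \<gamma> \<and>
     (\<exists>v>0. has_rotation_speed S p f x v \<and>
       (\<forall>z\<in>hplane. p z = x \<longrightarrow>
         (\<exists>c. is_curve_lift p \<gamma> c \<and> tracks (can_lift p f) z v c \<and>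
              hdist z (c 0) = (INF t. hdist z (c t)))))"

definition tracking_geodesic ::
    "'a::metric_space set \<Rightarrow> (complex \<Rightarrow> 'a) \<Rightarrow> ('a \<Rightarrow> 'a) \<Rightarrow> 'a \<Rightarrow> real \<Rightarrow> 'a" where
  "tracking_geodesic S p f x = (THE \<gamma>. is_tracking_geodesic S p f x \<gamma>)"

text \<open>The hyperbolic norm of a tangent vector \<open>v\<close> at \<open>z\<close> is \<open>cmod v / Im z\<close>.\<close>

definition T1_hplane :: "(complex \<times> complex) set" where
  "T1_hplane = {(z, v). z \<in> hplane \<and> cmod v = Im z}"

text \<open>The unit tangent bundle of the surface is the quotient of that of the hyperbolic plane
  by the differentials of the deck transformations; its points are orbits.\<close>

definition T1_proj :: "(complex \<Rightarrow> 'a) \<Rightarrow> complex \<times> complex \<Rightarrow> (complex \<times> complex) set" where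
  "T1_proj p = (\<lambda>(z, v). {(g z, deriv g z * v) | g. g \<in> deck p})"

definition T1 :: "(complex \<Rightarrow> 'a) \<Rightarrow> (complex \<times> complex) set topology" where
  "T1 p = topology (\<lambda>U. U \<subseteq> T1_proj p ` T1_hplane \<and>
                        openin (top_of_set T1_hplane) {\<xi> \<in> T1_hplane. T1_proj p \<xi> \<in> U})"

lemma openin_T1:
  "openin (T1 p) U \<longleftrightarrow>
     U \<subseteq> T1_proj p ` T1_hplane \<and>
     openin (top_of_set T1_hplane) {\<xi> \<in> T1_hplane. T1_proj p \<xi> \<in> U}"
proof -
  let ?Q = "\<lambda>U. {\<xi> \<in> T1_hplane. T1_proj p \<xi> \<in> U}"
  have "istopology (\<lambda>U. U \<subseteq> T1_proj p ` T1_hplane \<and> openin (top_of_set T1_hplane) (?Q U))"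
    unfolding istopology_def
  proof (intro conjI allI impI)
    fix U V
    assume "U \<subseteq> T1_proj p ` T1_hplane \<and> openin (top_of_set T1_hplane) (?Q U)"
      and "V \<subseteq> T1_proj p ` T1_hplane \<and> openin (top_of_set T1_hplane) (?Q V)"
    moreover have "?Q (U \<inter> V) = ?Q U \<inter> ?Q V" by auto
    ultimately show "U \<inter> V \<subseteq> T1_proj p ` T1_hplane"
      and "openin (top_of_set T1_hplane) (?Q (U \<inter> V))" by (auto intro: openin_Int)
  next
    fix K
    assume K: "\<forall>U\<in>K. U \<subseteq> T1_proj p ` T1_hplane \<and> openin (top_of_set T1_hplane) (?Q U)"
    then show "\<Union>K \<subseteq> T1_proj p ` T1_hplane" by blast
    have "?Q (\<Union>K) = \<Union>(?Q ` K)" by auto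
    moreover have "openin (top_of_set T1_hplane) (\<Union>(?Q ` K))"
      using K by (intro openin_Union) auto
    ultimately show "openin (top_of_set T1_hplane) (?Q (\<Union>K))" by simp
  qed
  then show ?thesis by (simp add: T1_def)
qed

text \<open>The velocity of a geodesic as a point of the unit tangent bundle; it does not depend on
  the chosen lift.\<close>

definition velocity ::
    "(complex \<Rightarrow> 'a) \<Rightarrow> (real \<Rightarrow> 'a) \<Rightarrow> real \<Rightarrow> (complex \<times> complex) set" where
  "velocity p \<gamma> t =
     (let c = (SOME c. is_curve_lift p \<gamma> c) in T1_proj p (c t, vector_derivative c (at t)))"

definition geodesic_flow ::
    "'a::metric_space set \<Rightarrow> (complex \<Rightarrow> 'a) \<Rightarrow> real \<Rightarrow>
     (complex \<times> complex) set \<Rightarrow> (complex \<times> complex) set" where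
  "geodesic_flow S p t \<xi> =
     (THE \<eta>. \<exists>\<gamma>. is_geodesic S \<gamma> \<and> velocity p \<gamma> 0 = \<xi> \<and> velocity p \<gamma> t = \<eta>)"

definition borel_prob_on :: "'b topology \<Rightarrow> 'b measure \<Rightarrow> bool" where
  "borel_prob_on X \<nu> \<longleftrightarrow>
     prob_space \<nu> \<and> sets \<nu> = sets (sigma (topspace X) {U. openin X U})"

definition msupport :: "'b topology \<Rightarrow> 'b measure \<Rightarrow> 'b set" where
  "msupport X \<nu> = {\<xi> \<in> topspace X. \<forall>U. openin X U \<and> \<xi> \<in> U \<longrightarrow> emeasure \<nu> U > 0}"

definition equidistributes_to ::
    "(complex \<Rightarrow> 'a) \<Rightarrow> (real \<Rightarrow> 'a) \<Rightarrow> (complex \<times> complex) set measure \<Rightarrow> bool" where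
  "equidistributes_to p \<gamma> \<nu> \<longleftrightarrow>
     (\<forall>\<phi>. continuous_map (T1 p) euclideanreal \<phi> \<longrightarrow>
       ((\<lambda>T. 1 / T * integral {0..T} (\<lambda>t. \<phi> (velocity p \<gamma> t)))
          \<longlongrightarrow> (\<integral>\<xi>. \<phi> \<xi> \<partial>\<nu>)) at_top \<and>
       ((\<lambda>T. 1 / T * integral {-T..0} (\<lambda>t. \<phi> (velocity p \<gamma> t)))
          \<longlongrightarrow> (\<integral>\<xi>. \<phi> \<xi> \<partial>\<nu>)) at_top)"

end

theory Submission
  imports Defs "HOL-Complex_Analysis.Complex_Analysis" "HOL-Real_Asymp.Real_Asymp"
begin

text \<open>
  The tracking geodesic \<open>\<gamma>\<^sub>x\<close> is the line joining the two limits at infinity of the orbit of a lift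
  of \<open>x\<close>; it exists because in the disc model consecutive orbit points are exponentially close,
  and the two limits differ almost surely since otherwise the distance from \<open>f\<^sup>-\<^sup>n x\<close> to
  \<open>f\<^sup>n x\<close> would be too small in mean. Passing from \<open>x\<close> to \<open>f x\<close> shifts the parameter
  of \<open>\<gamma>\<^sub>x\<close> by a bounded amount \<open>\<tau>(x)\<close>. Hence, for every Borel set \<open>A\<close> of unit tangent vectors, the
  signed time that \<open>\<gamma>\<^sub>x\<close> spends in \<open>A\<close> during \<open>[0, \<tau>(x)]\<close> is a bounded function whose Birkhoff
  sums measure the time spent in \<open>A\<close> along the geodesic. Its mean, divided by the speed, defines
  \<open>\<nu>(A)\<close>, and Birkhoff's theorem says that \<open>\<nu>(A)\<close> is the frequency of visits of almost every
  \<open>\<gamma>\<^sub>x\<close> to \<open>A\<close>. As a frequency, \<open>\<nu>\<close> is nonnegative and invariant under the flow; on a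
  flow-invariant set it is 0 or 1; and frequencies on a countable base of open sets give
  equidistribution and the support.
\<close>

subsection \<open>The hyperbolic plane\<close>

text \<open>The obstacle is that \<tau> may vanish or be negative: the lines do not form a
  suspension flow over \<open>f\<close> with roof \<tau>, and positivity of the limit is not visible
  from its construction. What saves the argument is that signed times along one line add up exactly.
  The Birkhoff sums are therefore values of a single primitive at the feet of the orbit points;
  since the feet advance at speed \<open>v\<close> and the primitive is 1-Lipschitz, frequencies
  along the orbit become frequencies at all real times. Countable additivity needs no representation
  theorem: \<open>v\<close> times \<nu> is the image of a finite signed measure on the product of
  \<mu> with Lebesgue measure. This and Fubini require the line to depend measurably on the point,
  which is why isometries are carried as four real coefficients and the coefficients of a line are
  written with square roots of its endpoints. All estimates at infinity come from one identity for
  the Cayley transform, \<open>cay_diff\<close>, read in both directions: close orbits have close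
  images in the disc, and a common limit forces sublinear distance.\<close>

lemma open_hplane: "open hplane"
  unfolding hplane_def by (rule open_halfspace_Im_gt)

lemma convex_hplane: "convex hplane"
  unfolding hplane_def by (rule convex_halfspace_Im_gt)

lemma i_in_hplane [simp]: "\<i> \<in> hplane"
  by (simp add: hplane_def)

lemma cosh_hdist:
  assumes "z \<in> hplane" "w \<in> hplane"
  shows "cosh (hdist z w) = 1 + (cmod (z - w))\<^sup>2 / (2 * Im z * Im w)"
  using assms by (simp add: hdist_def hplane_def)

lemma hdist_nonneg: "z \<in> hplane \<Longrightarrow> w \<in> hplane \<Longrightarrow> 0 \<le> hdist z w"
  by (simp add: hdist_def hplane_def)

lemma hdist_commute: "hdist z w = hdist w z"
  by (simp add: hdist_def norm_minus_commute mult_ac)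

lemma hdist_self [simp]: "hdist z z = 0"
  by (simp add: hdist_def)

lemma continuous_on_hdist [continuous_intros]:
  assumes "continuous_on A f" "continuous_on A g" "f ` A \<subseteq> hplane" "g ` A \<subseteq> hplane"
  shows "continuous_on A (\<lambda>x. hdist (f x) (g x))"
proof -
  have *: "Im (f x) > 0" "Im (g x) > 0" if "x \<in> A" for x
    using assms(3,4) that by (auto simp: hplane_def)
  \<comment> \<open>Coinciding points have distance arcosh 1, so continuity is needed up to the
    endpoint 1; the logarithmic formula gives it.\<close>
  have "continuous_on {1..} (arcosh :: real \<Rightarrow> real)"
  proof -
    have "continuous_on {1..} (\<lambda>x::real. ln (x + sqrt (x\<^sup>2 - 1)))"
    proof (intro continuous_intros ballI)
      fix x :: real assume "x \<in> {1..}"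
      then have "x \<ge> 1" by simp
      moreover from this have "sqrt (x\<^sup>2 - 1) \<ge> 0" using one_le_power[of x 2] by simp
      ultimately have "x + sqrt (x\<^sup>2 - 1) > 0" by linarith
      then show "x + sqrt (x\<^sup>2 - 1) \<noteq> 0" by linarith
    qed
    then show ?thesis by (rule continuous_on_eq) (simp add: arcosh_real_def)
  qed
  moreover have "continuous_on A (\<lambda>x. 1 + (cmod (f x - g x))\<^sup>2 / (2 * Im (f x) * Im (g x)))"
  proof -
    have "2 * Im (f x) * Im (g x) \<noteq> 0" if "x \<in> A" for x using *[OF that] by simp
    then show ?thesis
      by (intro continuous_on_add continuous_on_divide continuous_on_const continuous_on_power
          continuous_on_norm continuous_on_diff continuous_on_mult continuous_on_Im assms ballI)
  qed
  moreover have "(\<lambda>x. 1 + (cmod (f x - g x))\<^sup>2 / (2 * Im (f x) * Im (g x))) ` A \<subseteq> {1..}"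
  proof (rule image_subsetI)
    fix x assume "x \<in> A"
    then have "0 \<le> (cmod (f x - g x))\<^sup>2 / (2 * Im (f x) * Im (g x))"
      using *[of x] by (intro divide_nonneg_nonneg) auto
    then show "1 + (cmod (f x - g x))\<^sup>2 / (2 * Im (f x) * Im (g x)) \<in> {1..}" by simp
  qed
  ultimately show ?thesis
    unfolding hdist_def by (rule continuous_on_compose2)
qed

section \<open>Moebius maps with real coefficients\<close>

definition mob :: "real \<Rightarrow> real \<Rightarrow> real \<Rightarrow> real \<Rightarrow> complex \<Rightarrow> complex" where
  "mob a b c d z = (of_real a * z + of_real b) / (of_real c * z + of_real d)"

lemma mob_denom:
  assumes "a * d - b * c = 1" "z \<in> hplane"
  shows "of_real c * z + of_real d \<noteq> 0"
proof
  assume *: "of_real c * z + of_real d = 0"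
  have "c * Im z = Im (of_real c * z + of_real d)" by simp
  also have "\<dots> = 0" using * by (metis zero_complex.sel(2))
  finally have "c * Im z = 0" .
  then have "c = 0" using assms(2) by (simp add: hplane_def)
  with * have "d = 0" by simp
  with \<open>c = 0\<close> assms(1) show False by simp
qed

lemma mob_diff:
  assumes det: "a * d - b * c = 1" and "z \<in> hplane" "w \<in> hplane"
  shows "mob a b c d z - mob a b c d w =
    (z - w) / ((of_real c * z + of_real d) * (of_real c * w + of_real d))"
proof -
  have d: "complex_of_real a * of_real d - of_real b * of_real c = 1"
    by (metis det of_real_1 of_real_diff of_real_mult)
  have "(of_real a * z + of_real b) * (of_real c * w + of_real d)
      - (of_real a * w + of_real b) * (of_real c * z + of_real d) = z - w"
    using d by algebra
  then show ?thesis
    using mob_denom[OF det assms(2)] mob_denom[OF det assms(3)]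
    by (simp add: mob_def diff_frac_eq)
qed

lemma Im_mob:
  assumes "a * d - b * c = 1"
  shows "Im (mob a b c d z) = Im z / (cmod (of_real c * z + of_real d))\<^sup>2"
proof -
  have "(a * Im z) * (c * Re z + d) - (a * Re z + b) * (c * Im z) = Im z"
    using assms by algebra
  then show ?thesis
    by (simp add: mob_def Im_divide cmod_power2)
qed

lemma mob_in_hplane: "a * d - b * c = 1 \<Longrightarrow> z \<in> hplane \<Longrightarrow> mob a b c d z \<in> hplane"
  using mob_denom[of a d b c z] by (simp add: hplane_def Im_mob)

text \<open>The denominators in \<open>mob_diff\<close> and \<open>Im_mob\<close> cancel in |z -
  w|^2 / (Im z Im w).\<close>

lemma hdist_mob:
  assumes "a * d - b * c = 1" "z \<in> hplane" "w \<in> hplane"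
  shows "hdist (mob a b c d z) (mob a b c d w) = hdist z w"
  using mob_denom[OF assms(1,2)] mob_denom[OF assms(1,3)] assms
  by (simp add: hdist_def mob_diff Im_mob norm_divide norm_mult power_mult_distrib power_divide)

lemma mob_comp:
  assumes "a * d - b * c = 1" "a' * d' - b' * c' = 1" "z \<in> hplane"
  shows "mob a b c d (mob a' b' c' d' z) =
    mob (a * a' + b * c') (a * b' + b * d') (c * a' + d * c') (c * b' + d * d') z"
proof -
  let ?w = "of_real c' * z + complex_of_real d'"
  have w: "?w \<noteq> 0" using assms mob_denom by blast
  have "mob a b c d (mob a' b' c' d' z) =
    ((of_real a * (of_real a' * z + of_real b') + of_real b * ?w) / ?w) /
    ((of_real c * (of_real a' * z + of_real b') + of_real d * ?w) / ?w)"
    using w unfolding mob_def by (simp add: add_divide_eq_iff divide_add_eq_iff)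
  also have "\<dots> = (of_real a * (of_real a' * z + of_real b') + of_real b * ?w) /
     (of_real c * (of_real a' * z + of_real b') + of_real d * ?w)"
    using w by simp
  finally show ?thesis by (simp add: mob_def algebra_simps)
qed

lemma mob_comp_det:
  fixes a :: real
  assumes "a * d - b * c = 1" "a' * d' - b' * c' = 1"
  shows "(a * a' + b * c') * (c * b' + d * d') - (a * b' + b * d') * (c * a' + d * c') = 1"
  using assms by algebra

lemma mob_id [simp]: "mob 1 0 0 1 z = z"
  by (simp add: mob_def)

lemma mob_inv:
  assumes "a * d - b * c = 1" "z \<in> hplane"
  shows "mob d (-b) (-c) a (mob a b c d z) = z" "mob a b c d (mob d (-b) (-c) a z) = z"
  using assms by (simp_all add: mob_comp algebra_simps)

text \<open>The imaginary axis parametrized by arc length, the model of all lines.\<close>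

definition vert :: "real \<Rightarrow> complex" where
  "vert t = \<i> * of_real (exp t)"

lemma vert_simps [simp]: "Re (vert t) = 0" "Im (vert t) = exp t" "cmod (vert t) = exp t"
  by (simp_all add: vert_def norm_mult)

lemma vert_in_hplane [simp]: "vert t \<in> hplane"
  by (simp add: hplane_def)

lemma vert_0: "vert 0 = \<i>"
  by (simp add: vert_def)

text \<open>Hyperbolic Pythagoras: \<open>cmod z / Im z\<close> is the cosh of the distance from
  \<open>z\<close> to the axis, and \<open>ln (cmod z)\<close> is the parameter of the foot of
  \<open>z\<close>.\<close>

lemma cosh_hdist_vert:
  assumes "z \<in> hplane"
  shows "cosh (hdist z (vert t)) = cmod z / Im z * cosh (t - ln (cmod z))"
proof -
  have y: "Im z > 0" and r: "cmod z > 0" using assms by (auto simp: hplane_def)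
  have 1: "(cmod (z - vert t))\<^sup>2 = (cmod z)\<^sup>2 - 2 * Im z * exp t + exp t * exp t"
    unfolding cmod_power2 by (simp add: power2_eq_square algebra_simps)
  have "cosh (t - ln (cmod z)) = (exp t / cmod z + cmod z / exp t) / 2"
    using r by (simp add: cosh_field_def exp_diff)
  moreover have "1 + (cmod (z - vert t))\<^sup>2 / (2 * Im z * exp t)
      = ((cmod z)\<^sup>2 + exp t * exp t) / (2 * Im z * exp t)"
    unfolding 1 using y by (simp add: field_simps)
  ultimately show ?thesis
    using y r by (simp add: cosh_hdist[OF assms]) (simp add: field_simps power2_eq_square)
qed

lemma hdist_vert [simp]: "hdist (vert s) (vert t) = \<bar>s - t\<bar>"
proof -
  have "cosh (hdist (vert s) (vert t)) = cosh \<bar>s - t\<bar>"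
    by (subst cosh_hdist_vert) (auto simp: abs_if cosh_diff)
  then show ?thesis
    by (metis abs_ge_zero arcosh_cosh_real hdist_nonneg vert_in_hplane)
qed

lemma cosh_le_cosh_imp_abs_le: "cosh (x::real) \<le> cosh y \<Longrightarrow> 0 \<le> y \<Longrightarrow> \<bar>x\<bar> \<le> y"
  by (metis abs_ge_zero cosh_real_nonneg_le_iff cosh_real_abs)

text \<open>Projection to the axis does not increase distance: passing to moduli shrinks |z - w| and
  enlarges the denominators.\<close>

lemma ln_cmod_le_hdist:
  assumes "z \<in> hplane" "w \<in> hplane"
  shows "\<bar>ln (cmod z) - ln (cmod w)\<bar> \<le> hdist z w"
proof (rule cosh_le_cosh_imp_abs_le)
  have y: "Im z > 0" "cmod z > 0" "Im w > 0" "cmod w > 0" using assms by (auto simp: hplane_def)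
  have "cosh (ln (cmod z) - ln (cmod w)) = (cmod z / cmod w + cmod w / cmod z) / 2"
    using y by (simp add: cosh_field_def exp_diff)
  also have "\<dots> = 1 + (cmod z - cmod w)\<^sup>2 / (2 * cmod z * cmod w)"
    using y by (simp add: field_simps power2_eq_square)
  also have "\<dots> \<le> 1 + (cmod (z - w))\<^sup>2 / (2 * Im z * Im w)"
  proof -
    have "\<bar>cmod z - cmod w\<bar> \<le> cmod (z - w)" by (rule norm_triangle_ineq3)
    then have "(cmod z - cmod w)\<^sup>2 \<le> (cmod (z - w))\<^sup>2"
      by (metis abs_ge_zero power2_abs power_mono)
    moreover have "2 * Im z * Im w \<le> 2 * cmod z * cmod w"
      using y abs_Im_le_cmod[of z] abs_Im_le_cmod[of w] by (auto intro!: mult_mono)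
    ultimately show ?thesis using y by (auto intro!: frac_le)
  qed
  finally show "cosh (ln (cmod z) - ln (cmod w)) \<le> cosh (hdist z w)"
    by (simp add: cosh_hdist[OF assms])
qed (use assms in \<open>rule hdist_nonneg\<close>)

lemma rotate_to_vert:
  assumes "u \<in> hplane"
  shows "\<exists>a b c d s. a * d - b * c = 1 \<and> mob a b c d \<i> = \<i> \<and> mob a b c d u = vert s \<and> 0 \<le> s"
proof -
  \<comment> \<open>For the rotation about \<open>\<i>\<close> with a = cos \<theta>, b = sin
    \<theta>, the image of \<open>u\<close> lies on the axis iff sin(2\<theta>) (1 - |u|^2)/2 +
    cos(2\<theta>) Re u = 0. The argument of \<open>w\<close> is a solution 2\<theta>.\<close>
  define w where "w = Complex ((1 - (cmod u)\<^sup>2) / 2) (- Re u)"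
  define \<phi> where "\<phi> = Arg w"
  define a b where "a = cos (\<phi> / 2)" and "b = sin (\<phi> / 2)"
  have ab: "a * a - b * (- b) = 1" "a\<^sup>2 + b\<^sup>2 = 1"
    using sin_cos_squared_add2[of "\<phi>/2"] by (simp_all add: a_def b_def power2_eq_square)
  have w: "Re w = cmod w * cos \<phi>" "Im w = cmod w * sin \<phi>"
    using rcis_cmod_Arg[of w] unfolding \<phi>_def by (metis Re_rcis, metis Im_rcis)
  have s2: "sin \<phi> = 2 * b * a" and c2: "cos \<phi> = a\<^sup>2 - b\<^sup>2"
    using sin_double[of "\<phi>/2"] cos_double[of "\<phi>/2"] by (simp_all add: a_def b_def)
  have "2 * b * a * Re w = (a\<^sup>2 - b\<^sup>2) * Im w"
    using w s2 c2 by (metis mult.left_commute mult.commute)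
  then have "b * a * (1 - (cmod u)\<^sup>2) = - ((a\<^sup>2 - b\<^sup>2) * Re u)"
    by (simp add: w_def)
  then have key: "a * b * (1 - (cmod u)\<^sup>2) + (a\<^sup>2 - b\<^sup>2) * Re u = 0"
    unfolding mult.commute[of a b] by simp
  have i: "mob a b (-b) a \<i> = \<i>"
  proof -
    have "complex_of_real (-b) * \<i> + of_real a \<noteq> 0"
      using ab mob_denom i_in_hplane by blast
    then show ?thesis by (simp add: mob_def field_simps)
  qed
  have re: "Re (mob a b (-b) a u) = 0"
  proof -
    have "(a * Re u + b) * (a - b * Re u) - a * Im u * (b * Im u) = 0"
      using key unfolding cmod_power2 by algebra
    then show ?thesis by (simp add: mob_def Re_divide)
  qed
  define m where "m = mob a b (-b) a u"
  have m: "m \<in> hplane" unfolding m_def using ab(1) assms by (rule mob_in_hplane)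
  have mv: "m = vert (ln (Im m))"
    using m re by (auto simp: complex_eq_iff hplane_def m_def)
  show ?thesis
  proof (cases "0 \<le> ln (Im m)")
    case True
    then show ?thesis using ab i mv m_def by blast
  next
    case False
    \<comment> \<open>The half-turn z -> -1/z about \<open>\<i>\<close> reverses the axis and so
      repairs a negative parameter.\<close>
    have "mob 0 (-1) 1 0 m = vert (- ln (Im m))"
      by (subst mv) (simp add: mob_def vert_def exp_minus field_simps)
    moreover have "mob 0 (-1) 1 0 \<i> = \<i>"
      by (simp add: mob_def field_simps)
    moreover have c: "mob 0 (-1) 1 0 (mob a b (-b) a z) = mob b (-a) a b z" if "z \<in> hplane" for z
      using that ab by (simp add: mob_comp)
    ultimately have "mob b (-a) a b u = vert (- ln (Im m))" "mob b (-a) a b \<i> = \<i>"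
      using assms i m_def by (metis, metis i_in_hplane)
    moreover have "b * b - (-a) * a = 1" using ab by simp
    ultimately show ?thesis using False by (metis linear neg_0_le_iff_le)
  qed
qed

text \<open>Send \<open>z\<close> to \<open>\<i>\<close> by u -> (u - x)/y, whose matrix of
  determinant 1 involves q = sqrt y, turn \<open>w\<close> onto the axis by
  \<open>rotate_to_vert\<close>, and take the inverse.\<close>

lemma exists_mob_vert:
  assumes "z \<in> hplane" "w \<in> hplane"
  shows "\<exists>a b c d. a * d - b * c = 1 \<and> mob a b c d (vert 0) = z \<and> mob a b c d (vert (hdist z w)) = w"
proof -
  define x y where "x = Re z" and "y = Im z"
  have y: "y > 0" using assms by (simp add: y_def hplane_def)
  define q where "q = sqrt y"
  have q: "q > 0" "q * q = y" using y by (auto simp: q_def)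
  have det: "(1/q) * q - (- x / q) * 0 = 1" using q by simp
  have zi: "mob (1/q) (-x/q) 0 q z = \<i>"
  proof -
    have "mob (1/q) (-x/q) 0 q z = (z - x) / (complex_of_real q * complex_of_real q)"
      using q by (simp add: mob_def field_simps)
    also have "complex_of_real q * complex_of_real q = y" using q(2) by (metis of_real_mult)
    also have "z - x = \<i> * y" by (auto simp: complex_eq_iff x_def y_def)
    also have "\<i> * y / y = \<i>" using y by simp
    finally show ?thesis .
  qed
  obtain a b c d s where m: "a * d - b * c = 1" "mob a b c d \<i> = \<i>"
    "mob a b c d (mob (1/q) (-x/q) 0 q w) = vert s" "0 \<le> s"
    using rotate_to_vert[OF mob_in_hplane[OF det assms(2)]] by blast
  obtain a' b' c' d' where m': "a' * d' - b' * c' = 1"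
    "\<And>u. u \<in> hplane \<Longrightarrow> mob a b c d (mob (1/q) (-x/q) 0 q u) = mob a' b' c' d' u"
    using mob_comp[OF m(1) det] mob_comp_det[OF m(1) det] by blast
  have z': "mob a' b' c' d' z = vert 0" and w': "mob a' b' c' d' w = vert s"
    using m(2,3) m'(2)[OF assms(1)] m'(2)[OF assms(2)] zi vert_0 by simp_all
  have "hdist z w = s"
    using hdist_mob[OF m'(1) assms] z' w' m(4) by simp
  moreover have "d' * a' - (-b') * (-c') = 1" using m' by (simp add: algebra_simps)
  moreover have "mob d' (-b') (-c') a' (vert 0) = z" "mob d' (-b') (-c') a' (vert s) = w"
    using mob_inv(1)[OF m'(1)] assms z' w' by metis+
  ultimately show ?thesis by metis
qed

text \<open>With \<open>z\<close> and \<open>w\<close> moved to the axis, the foot of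
  \<open>u\<close> splits the segment between them, and projection does not increase the two
  distances to \<open>u\<close>.\<close>

lemma hdist_triangle:
  assumes "z \<in> hplane" "u \<in> hplane" "w \<in> hplane"
  shows "hdist z w \<le> hdist z u + hdist u w"
proof -
  obtain a b c d where m: "a * d - b * c = 1" "mob a b c d (vert 0) = z"
      "mob a b c d (vert (hdist z w)) = w"
    using exists_mob_vert assms by blast
  define u' where "u' = mob d (-b) (-c) a u"
  have u: "u = mob a b c d u'" "u' \<in> hplane"
    using mob_inv(2)[OF m(1) assms(2)] mob_in_hplane[of d a "-b" "-c" u] m(1) assms(2)
    by (simp_all add: u'_def algebra_simps)
  have "hdist z u = hdist (vert 0) u'" "hdist u w = hdist u' (vert (hdist z w))"
    using hdist_mob[OF m(1)] u m by (metis vert_in_hplane)+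
  moreover have "\<bar>0 - ln (cmod u')\<bar> \<le> hdist (vert 0) u'"
    using ln_cmod_le_hdist[of "vert 0" u'] u by simp
  moreover have "\<bar>ln (cmod u') - hdist z w\<bar> \<le> hdist u' (vert (hdist z w))"
    using ln_cmod_le_hdist[of u' "vert (hdist z w)"] u by simp
  ultimately show ?thesis by linarith
qed

lemma hdist_triangle':
  assumes "z \<in> hplane" "u \<in> hplane" "w \<in> hplane"
  shows "\<bar>hdist z w - hdist u w\<bar> \<le> hdist z u"
  using hdist_triangle[of z u w] hdist_triangle[of u z w] assms by (simp add: hdist_commute abs_le_iff)

subsection \<open>Geodesic lines\<close>

text \<open>A line carries a matrix, so that feet, endpoints and velocities become formulas in
  coefficients. By \<open>local_isometry_is_line\<close> these are all the unit-speed local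
  geodesics.\<close>

definition is_line :: "(real \<Rightarrow> complex) \<Rightarrow> bool" where
  "is_line \<gamma> \<longleftrightarrow> (\<exists>a b c d. a * d - b * c = 1 \<and> (\<forall>t. \<gamma> t = mob a b c d (vert t)))"

text \<open>Eliminating the distance to the axis from the two Pythagoras relations leaves sinh (s -
  L) sinh (b - a) = 0, so the foot of \<open>u\<close> is at \<open>s\<close>; then K = 1 puts
  \<open>u\<close> on the axis.\<close>

lemma vert_eqI:
  assumes u: "u \<in> hplane" and "a \<noteq> b"
    and A: "hdist (vert a) u = \<bar>s - a\<bar>" and B: "hdist (vert b) u = \<bar>s - b\<bar>"
  shows "u = vert s"
proof -
  define L K where "L = ln (cmod u)" and "K = cmod u / Im u"
  have y: "Im u > 0" "cmod u > 0" using u by (auto simp: hplane_def)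
  then have K: "K > 0" by (simp add: K_def)
  have KA: "K * cosh (a - L) = cosh (s - a)" and KB: "K * cosh (b - L) = cosh (s - b)"
    using cosh_hdist_vert[OF u, of a] cosh_hdist_vert[OF u, of b] A B
    by (simp_all add: L_def K_def hdist_commute)
  then have "cosh (s - a) * cosh (b - L) = cosh (s - b) * cosh (a - L)"
    by (metis mult.assoc mult.commute)
  then have "sinh (s - L) * sinh (b - a) = 0"
  proof -
    define p q r where "p = s - L" and "q = a - L" and "r = b - L"
    have e: "s - a = p - q" "s - b = p - r" "b - a = r - q" by (auto simp: p_def q_def r_def)
    have "cosh (p - q) * cosh r = cosh (p - r) * cosh q"
      using \<open>cosh (s - a) * cosh (b - L) = cosh (s - b) * cosh (a - L)\<close> e q_def r_def by metis
    then have "sinh p * sinh (r - q) = 0"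
      by (simp add: cosh_diff sinh_diff algebra_simps)
    then show ?thesis using e p_def by simp
  qed
  then have "L = s" using \<open>a \<noteq> b\<close> by auto
  then have "K = 1"
    using KA cosh_real_pos[of "s - a"] by (metis cosh_minus minus_diff_eq mult_cancel_right1 less_irrefl)
  then have "cmod u = Im u" using y by (simp add: K_def)
  then have "(Re u)\<^sup>2 = 0" by (metis cmod_power2 add_cancel_left_left)
  then show ?thesis
    using \<open>cmod u = Im u\<close> \<open>L = s\<close> y by (auto simp: complex_eq_iff L_def)
qed

text \<open>Two distinct times of agreement determine \<open>c\<close> on every interval where it is
  isometric, by \<open>vert_eqI\<close>. So the set \<open>A\<close> of times near which
  \<open>c\<close> agrees with the axis is open and closed.\<close>

lemma local_isometry_vert:
  fixes c :: "real \<Rightarrow> complex"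
  assumes c: "\<And>t. c t \<in> hplane"
    and iso: "\<And>t. \<exists>e>0. \<forall>r\<in>ball t e. \<forall>s\<in>ball t e. hdist (c r) (c s) = dist r s"
    and ab: "c a = vert a" "c b = vert b" "a \<noteq> b"
      "\<exists>t e. a \<in> ball t e \<and> b \<in> ball t e \<and> (\<forall>r\<in>ball t e. \<forall>s\<in>ball t e. hdist (c r) (c s) = dist r s)"
  shows "c t = vert t"
proof -
  define A where "A = {t. \<exists>e>0. \<forall>s\<in>ball t e. c s = vert s}"
  have ext: "c s = vert s"
    if "\<forall>r\<in>ball t e. \<forall>s\<in>ball t e. hdist (c r) (c s) = dist r s"
      "x \<in> ball t e" "y \<in> ball t e" "x \<noteq> y" "c x = vert x" "c y = vert y" "s \<in> ball t e"
    for t e x y s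
  proof (rule vert_eqI[OF c \<open>x \<noteq> y\<close>])
    show "hdist (vert x) (c s) = \<bar>s - x\<bar>"
      using that(1)[rule_format, OF that(2,7)] that(5) by (simp add: dist_real_def abs_minus_commute)
    show "hdist (vert y) (c s) = \<bar>s - y\<bar>"
      using that(1)[rule_format, OF that(3,7)] that(6) by (simp add: dist_real_def abs_minus_commute)
  qed
  have "open A"
    unfolding open_contains_ball
  proof
    fix t assume "t \<in> A"
    then obtain e where e: "e > 0" "\<forall>s\<in>ball t e. c s = vert s" by (auto simp: A_def)
    have "ball t e \<subseteq> A"
    proof
      fix s assume s: "s \<in> ball t e"
      obtain e' where "e' > 0" "ball s e' \<subseteq> ball t e"
        using openE[OF open_ball s] .
      then show "s \<in> A" using e by (auto simp: A_def)
    qed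
    then show "\<exists>e>0. ball t e \<subseteq> A" using e by blast
  qed
  moreover have "closed A"
    unfolding closure_subset_eq[symmetric]
  proof
    fix t assume "t \<in> closure A"
    then have t: "\<forall>e>0. \<exists>y\<in>A. dist y t < e" by (simp add: closure_approachable)
    obtain e where e: "e > 0" "\<forall>r\<in>ball t e. \<forall>s\<in>ball t e. hdist (c r) (c s) = dist r s"
      using iso by blast
    obtain y where y: "y \<in> A" "y \<in> ball t e" using t e by (auto simp: dist_commute)
    obtain e1 where e1: "e1 > 0" "\<forall>s\<in>ball y e1. c s = vert s" using y by (auto simp: A_def)
    obtain e2 where e2: "e2 > 0" "ball y e2 \<subseteq> ball t e"
      using openE[OF open_ball y(2)] .
    \<comment> \<open>A second time of agreement; the offset keeps it inside both balls.\<close>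
    define y' where "y' = y + min e1 e2 / 2"
    have y': "y' \<noteq> y" "y' \<in> ball y e1" "y' \<in> ball y e2"
      using e1 e2 by (auto simp: y'_def dist_real_def min_def)
    have "\<forall>s\<in>ball t e. c s = vert s"
      using ext[OF e(2) y(2) _ y'(1)[symmetric]] y' e1 e2 by auto
    then show "t \<in> A" using e by (auto simp: A_def)
  qed
  moreover have "A \<noteq> {}"
  proof -
    obtain t e where "a \<in> ball t e" "b \<in> ball t e"
        "\<forall>r\<in>ball t e. \<forall>s\<in>ball t e. hdist (c r) (c s) = dist r s"
      using ab(4) by blast
    then have "\<forall>s\<in>ball t e. c s = vert s" using ext ab by blast
    moreover have "e > 0" using \<open>a \<in> ball t e\<close> by (metis ball_eq_empty empty_iff not_le)
    ultimately have "t \<in> A" by (auto simp: A_def)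
    then show ?thesis by auto
  qed
  ultimately have "A = UNIV" using clopen by blast
  then have "t \<in> A" by simp
  then show ?thesis by (auto simp: A_def)
qed

lemma local_isometry_is_line:
  fixes c :: "real \<Rightarrow> complex"
  assumes c: "\<And>t. c t \<in> hplane"
    and iso: "\<And>t. \<exists>e>0. \<forall>r\<in>ball t e. \<forall>s\<in>ball t e. hdist (c r) (c s) = dist r s"
  shows "is_line c"
proof -
  obtain e where e: "e > 0" "\<forall>r\<in>ball 0 e. \<forall>s\<in>ball 0 e. hdist (c r) (c s) = dist r s"
    using iso by blast
  define h where "h = e / 2"
  have h: "h \<in> ball 0 e" "h \<noteq> 0" "(0::real) \<in> ball 0 e" using e by (auto simp: h_def)
  then have "hdist (c 0) (c h) = h" using e by (auto simp: h_def)
  then obtain p q r s where m: "p * s - q * r = 1" "mob p q r s (vert 0) = c 0"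
      "mob p q r s (vert h) = c h"
    using exists_mob_vert[OF c c, of 0 h] by auto
  have m': "s * p - (-q) * (-r) = 1" using m by (simp add: algebra_simps)
  define c' where "c' t = mob s (-q) (-r) p (c t)" for t
  have hd: "hdist (c' x) (c' y) = hdist (c x) (c y)" for x y
    using hdist_mob[OF m' c c] by (simp add: c'_def)
  have "c' t = vert t" for t
  proof (rule local_isometry_vert)
    show "c' t \<in> hplane" for t using mob_in_hplane[OF m' c] by (simp add: c'_def)
    show "\<exists>e>0. \<forall>r\<in>ball t e. \<forall>s\<in>ball t e. hdist (c' r) (c' s) = dist r s" for t
      using iso hd by simp
    show "c' 0 = vert 0" "c' h = vert h"
      using mob_inv(1)[OF m(1)] m by (metis c'_def vert_in_hplane)+
    show "\<exists>t e. 0 \<in> ball t e \<and> h \<in> ball t e \<and>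
        (\<forall>r\<in>ball t e. \<forall>s\<in>ball t e. hdist (c' r) (c' s) = dist r s)"
      by (intro exI[of _ 0] exI[of _ e]) (use e h hd in auto)
  qed (use h in auto)
  then have "c t = mob p q r s (vert t)" for t
    using mob_inv(2)[OF m(1) c] by (metis c'_def)
  then show ?thesis using m(1) unfolding is_line_def by blast
qed

lemma line_in_hplane: "is_line c \<Longrightarrow> c t \<in> hplane"
  unfolding is_line_def using mob_in_hplane vert_in_hplane by metis

lemma hdist_line: "is_line c \<Longrightarrow> hdist (c s) (c t) = \<bar>s - t\<bar>"
  unfolding is_line_def using hdist_mob vert_in_hplane hdist_vert by metis

lemma is_line_isometry:
  assumes "is_line c" "\<And>z. z \<in> hplane \<Longrightarrow> g z \<in> hplane"
    "\<And>z w. z \<in> hplane \<Longrightarrow> w \<in> hplane \<Longrightarrow> hdist (g z) (g w) = hdist z w"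
  shows "is_line (\<lambda>t. g (c t))"
  by (rule local_isometry_is_line)
     (use assms in \<open>auto simp: line_in_hplane hdist_line dist_real_def intro!: exI[of _ 1]\<close>)

lemma is_line_shift: "is_line c \<Longrightarrow> is_line (\<lambda>t. c (t + s))"
  by (rule local_isometry_is_line)
     (auto simp: line_in_hplane hdist_line dist_real_def intro!: exI[of _ 1])

section \<open>Nearest-point projection to a line\<close>

lemma cosh_hdist_line:
  assumes "is_line c" "z \<in> hplane"
  shows "\<exists>K>0. \<exists>\<tau>. \<forall>t. cosh (hdist z (c t)) = K * cosh (t - \<tau>)"
proof -
  obtain a b c' d where m: "a * d - b * c' = 1" "\<And>t. c t = mob a b c' d (vert t)"
    using assms unfolding is_line_def by blast
  define w where "w = mob d (-b) (-c') a z"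
  have w: "w \<in> hplane" "z = mob a b c' d w"
    using mob_inv(2)[OF m(1) assms(2)] mob_in_hplane[of d a "-b" "-c'" z] m(1) assms(2)
    by (simp_all add: w_def algebra_simps)
  have "cmod w > 0" "Im w > 0" using w(1) by (auto simp: hplane_def)
  then have "cmod w / Im w > 0" by simp
  moreover have "cosh (hdist z (c t)) = cmod w / Im w * cosh (t - ln (cmod w))" for t
    using w m(2) hdist_mob[OF m(1) w(1) vert_in_hplane] cosh_hdist_vert[OF w(1)] by simp
  ultimately show ?thesis by blast
qed

text \<open>Asking for a strict minimum makes uniqueness immediate (\<open>foot_eqI\<close>);
  existence for lines is \<open>foot_less\<close>.\<close>

definition foot :: "(real \<Rightarrow> complex) \<Rightarrow> complex \<Rightarrow> real" where
  "foot c z = (THE \<tau>. \<forall>t. t \<noteq> \<tau> \<longrightarrow> hdist z (c \<tau>) < hdist z (c t))"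

lemma foot_eqI:
  assumes "\<And>t. t \<noteq> \<tau> \<Longrightarrow> hdist z (c \<tau>) < hdist z (c t)"
  shows "foot c z = \<tau>"
  unfolding foot_def
proof (rule the_equality)
  fix \<tau>' assume "\<forall>t. t \<noteq> \<tau>' \<longrightarrow> hdist z (c \<tau>') < hdist z (c t)"
  with assms show "\<tau>' = \<tau>" by (metis less_asym)
qed (use assms in auto)

lemma foot_cosh:
  assumes "is_line c" "z \<in> hplane" "0 < K" "\<And>t. cosh (hdist z (c t)) = K * cosh (t - \<tau>)"
  shows "foot c z = \<tau>"
proof (rule foot_eqI)
  fix t :: real assume "t \<noteq> \<tau>"
  then have "1 < cosh (t - \<tau>)"
    using cosh_real_ge_1[of "t - \<tau>"] cosh_real_one_iff[of "t - \<tau>"] by linarith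
  then have "cosh (hdist z (c \<tau>)) < cosh (hdist z (c t))" using assms(3) by (simp add: assms(4))
  then show "hdist z (c \<tau>) < hdist z (c t)"
    using assms(1,2) by (simp add: cosh_real_nonneg_less_iff hdist_nonneg line_in_hplane)
qed

lemma foot_less:
  assumes "is_line c" "z \<in> hplane" "t \<noteq> foot c z"
  shows "hdist z (c (foot c z)) < hdist z (c t)"
proof -
  obtain K \<tau> where K: "K > 0" "\<And>t. cosh (hdist z (c t)) = K * cosh (t - \<tau>)"
    using cosh_hdist_line[OF assms(1,2)] by blast
  have f: "foot c z = \<tau>" using foot_cosh[OF assms(1,2) K] .
  with assms(3) have "1 < cosh (t - \<tau>)"
    using cosh_real_ge_1[of "t - \<tau>"] cosh_real_one_iff[of "t - \<tau>"] by linarith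
  then have "cosh (hdist z (c \<tau>)) < cosh (hdist z (c t))" using K by simp
  then show ?thesis
    using assms(1,2) f by (simp add: cosh_real_nonneg_less_iff hdist_nonneg line_in_hplane)
qed

text \<open>Links the normalization in \<open>is_tracking_geodesic\<close>, which is an infimum,
  with the foot.\<close>

lemma foot_eq_iff:
  assumes "is_line c" "z \<in> hplane"
  shows "hdist z (c s) = (INF t. hdist z (c t)) \<longleftrightarrow> foot c z = s"
proof -
  have le: "hdist z (c (foot c z)) \<le> hdist z (c t)" for t
    using foot_less[OF assms] by (cases "t = foot c z") (auto intro: less_imp_le)
  have "(INF t. hdist z (c t)) = hdist z (c (foot c z))"
    by (rule cInf_eq_minimum) (use le in auto)
  then show ?thesis using foot_less[OF assms, of s] by force
qed

text \<open>A formula in the coefficients, from which both the Lipschitz bound and the measurability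
  of feet are read off.\<close>

lemma foot_mob:
  assumes "a * d - b * c = 1" "z \<in> hplane" "\<And>t. \<gamma> t = mob a b c d (vert t)"
  shows "foot \<gamma> z = ln (cmod (mob d (-b) (-c) a z))"
proof -
  define w where "w = mob d (-b) (-c) a z"
  have w: "w \<in> hplane" "z = mob a b c d w"
    using mob_inv(2)[OF assms(1,2)] mob_in_hplane[of d a "-b" "-c" z] assms(1,2)
    by (simp_all add: w_def algebra_simps)
  have "cmod w > 0" "Im w > 0" using w(1) by (auto simp: hplane_def)
  then have "cmod w / Im w > 0" by simp
  moreover have "cosh (hdist z (\<gamma> t)) = cmod w / Im w * cosh (t - ln (cmod w))" for t
    using w assms(3) hdist_mob[OF assms(1) w(1) vert_in_hplane] cosh_hdist_vert[OF w(1)] by simp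
  moreover have "is_line \<gamma>" using assms(1,3) unfolding is_line_def by blast
  ultimately show ?thesis unfolding w_def[symmetric] using foot_cosh assms(2) by blast
qed

lemma foot_line: "is_line c \<Longrightarrow> foot c (c t) = t"
  by (rule foot_eqI) (simp add: hdist_line)

lemma foot_isometry:
  assumes "\<And>t. hdist z' (c' t) = hdist z (c t)"
  shows "foot c' z' = foot c z"
  using assms by (simp add: foot_def)

lemma foot_shift:
  assumes "is_line c" "z \<in> hplane"
  shows "foot (\<lambda>t. c (t + s)) z = foot c z - s"
  by (rule foot_eqI) (use foot_less[OF assms] in auto)

lemma foot_lipschitz:
  assumes "is_line c" "z \<in> hplane" "w \<in> hplane"
  shows "\<bar>foot c z - foot c w\<bar> \<le> hdist z w"
proof -
  obtain p q r s where m: "p * s - q * r = 1" "\<And>t. c t = mob p q r s (vert t)"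
    using assms(1) unfolding is_line_def by blast
  have m': "s * p - (- q) * (- r) = 1" using m(1) by (simp add: algebra_simps)
  have "\<bar>foot c z - foot c w\<bar> \<le> hdist (mob s (-q) (-r) p z) (mob s (-q) (-r) p w)"
    unfolding foot_mob[OF m(1) assms(2) m(2)] foot_mob[OF m(1) assms(3) m(2)]
    using ln_cmod_le_hdist mob_in_hplane[OF m'] assms by blast
  also have "\<dots> = hdist z w" using hdist_mob[OF m'] assms by blast
  finally show ?thesis .
qed

subsection \<open>The boundary at infinity\<close>

text \<open>The Cayley transform to the unit disc with centre \<open>cay \<i> = 0\<close>. The unit
  circle serves as the boundary at infinity, and convergence to it is measured in the Euclidean
  metric.\<close>

definition cay :: "complex \<Rightarrow> complex" where
  "cay z = (z - \<i>) / (z + \<i>)"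

lemma plus_i_nonzero: "z \<in> hplane \<Longrightarrow> z + \<i> \<noteq> 0"
  by (auto simp: hplane_def complex_eq_iff)

lemma cmod_cay: "(cmod (cay z))\<^sup>2 = (cmod (z - \<i>))\<^sup>2 / (cmod (z + \<i>))\<^sup>2"
  by (simp add: cay_def norm_divide power_divide)

lemma one_minus_cay:
  assumes "z \<in> hplane"
  shows "1 - (cmod (cay z))\<^sup>2 = 2 / (1 + cosh (hdist \<i> z))"
proof -
  have y: "Im z > 0" using assms by (auto simp: hplane_def)
  have p: "(cmod (z + \<i>))\<^sup>2 > 0" using plus_i_nonzero[OF assms] by simp
  have e: "(cmod (z + \<i>))\<^sup>2 - (cmod (z - \<i>))\<^sup>2 = 4 * Im z"
    unfolding cmod_power2 by (simp add: power2_eq_square algebra_simps)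
  have "1 - (cmod (cay z))\<^sup>2 = ((cmod (z + \<i>))\<^sup>2 - (cmod (z - \<i>))\<^sup>2) / (cmod (z + \<i>))\<^sup>2"
    unfolding cmod_cay diff_divide_distrib using p by simp
  also have "\<dots> = 4 * Im z / (cmod (z + \<i>))\<^sup>2" by (simp only: e)
  also have "\<dots> = 2 / (1 + cosh (hdist \<i> z))"
  proof -
    have "1 + cosh (hdist \<i> z) = (4 * Im z + (cmod (z - \<i>))\<^sup>2) / (2 * Im z)"
      using y by (simp add: cosh_hdist[OF i_in_hplane assms] norm_minus_commute field_simps)
    also have "\<dots> = (cmod (z + \<i>))\<^sup>2 / (2 * Im z)" using e by simp
    finally have "1 + cosh (hdist \<i> z) = (cmod (z + \<i>))\<^sup>2 / (2 * Im z)" .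
    then show ?thesis using y p by simp
  qed
  finally show ?thesis .
qed

text \<open>The distance formula of the disc, cosh d = 1 + 2|Z - W|^2 / ((1 - |Z|^2)(1 - |W|^2)),
  solved for |Z - W|^2.\<close>

lemma cay_diff:
  assumes "z \<in> hplane" "w \<in> hplane"
  shows "(cmod (cay z - cay w))\<^sup>2 =
    (cosh (hdist z w) - 1) / 2 * (1 - (cmod (cay z))\<^sup>2) * (1 - (cmod (cay w))\<^sup>2)"
proof -
  have y: "Im z > 0" "Im w > 0" using assms by (auto simp: hplane_def)
  have p: "(cmod (z + \<i>))\<^sup>2 > 0" "(cmod (w + \<i>))\<^sup>2 > 0" using plus_i_nonzero assms by simp_all
  have one: "1 - (cmod (cay z))\<^sup>2 = 4 * Im z / (cmod (z + \<i>))\<^sup>2" if "z \<in> hplane" for z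
  proof -
    have "(cmod (z + \<i>))\<^sup>2 > 0" using plus_i_nonzero that by simp
    moreover have "(cmod (z + \<i>))\<^sup>2 - (cmod (z - \<i>))\<^sup>2 = 4 * Im z"
      unfolding cmod_power2 by (simp add: power2_eq_square algebra_simps)
    ultimately have "1 = 4 * Im z / (cmod (z + \<i>))\<^sup>2 + (cmod (z - \<i>))\<^sup>2 / (cmod (z + \<i>))\<^sup>2"
      by (metis add_divide_distrib diff_add_cancel divide_self less_irrefl)
    then show ?thesis unfolding cmod_cay by simp
  qed
  have "cay z - cay w = 2 * \<i> * (z - w) / ((z + \<i>) * (w + \<i>))"
    unfolding cay_def diff_frac_eq[OF plus_i_nonzero[OF assms(1)] plus_i_nonzero[OF assms(2)]]
    by (simp add: algebra_simps)
  then have "(cmod (cay z - cay w))\<^sup>2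
      = 4 * (cmod (z - w))\<^sup>2 / ((cmod (z + \<i>))\<^sup>2 * (cmod (w + \<i>))\<^sup>2)"
    by (simp add: norm_divide norm_mult power_divide power_mult_distrib)
  then show ?thesis
    using y p by (simp add: cosh_hdist[OF assms] one[OF assms(1)] one[OF assms(2)])
qed

lemma exp_le_2_cosh: "exp (x::real) \<le> 2 * cosh x"
  by (simp add: cosh_field_def)

text \<open>At distance r from \<open>\<i>\<close> the gap is 2 / (1 + cosh r), which is exp (-r) up
  to a factor between 1 and 4.\<close>

lemma one_minus_cay_bounds:
  assumes "z \<in> hplane"
  shows "1 - (cmod (cay z))\<^sup>2 \<le> 4 * exp (- hdist \<i> z)" "exp (- hdist \<i> z) \<le> 1 - (cmod (cay z))\<^sup>2"
proof -
  define r where "r = hdist \<i> z"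
  have r: "r \<ge> 0" by (simp add: r_def hdist_nonneg assms)
  have "2 / (1 + cosh r) \<le> 2 / (exp r / 2)"
    using exp_le_2_cosh[of r] cosh_real_pos[of r] by (intro divide_left_mono mult_pos_pos add_pos_pos) auto
  then show "1 - (cmod (cay z))\<^sup>2 \<le> 4 * exp (- hdist \<i> z)"
    unfolding one_minus_cay[OF assms] r_def[symmetric] by (simp add: exp_minus field_simps)
  have "exp (- r) \<le> exp r" "1 \<le> exp r" using r by auto
  moreover have "1 + (x + y) / 2 \<le> 2 * x" if "y \<le> x" "1 \<le> x" for x y :: real
    using that by (simp add: field_simps)
  ultimately have "1 + cosh r \<le> 2 * exp r" unfolding cosh_field_def by blast
  moreover have "0 < 1 + cosh r" using cosh_real_ge_1[of r] by linarith
  ultimately have "2 / (2 * exp r) \<le> 2 / (1 + cosh r)"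
    by (intro divide_left_mono mult_pos_pos) auto
  then show "exp (- hdist \<i> z) \<le> 1 - (cmod (cay z))\<^sup>2"
    unfolding one_minus_cay[OF assms] r_def[symmetric] by (simp add: exp_minus field_simps)
qed

text \<open>The exponent is minus twice the Gromov product of \<open>z\<close> and \<open>w\<close>
  at \<open>\<i>\<close>: points far from \<open>\<i>\<close> but close to each other are
  exponentially close in the disc.\<close>

lemma cay_diff_le:
  assumes "z \<in> hplane" "w \<in> hplane"
  shows "(cmod (cay z - cay w))\<^sup>2 \<le> 8 * exp (hdist z w - hdist \<i> z - hdist \<i> w)"
proof -
  have "cosh (hdist z w) \<le> exp (hdist z w)"
    using hdist_nonneg[OF assms] by (simp add: cosh_field_def)
  then have "(cosh (hdist z w) - 1) / 2 \<le> exp (hdist z w) / 2" by simp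
  moreover have "0 \<le> 1 - (cmod (cay z))\<^sup>2" "0 \<le> 1 - (cmod (cay w))\<^sup>2"
    using one_minus_cay_bounds(2) assms by (meson exp_ge_zero order_trans)+
  ultimately have "(cmod (cay z - cay w))\<^sup>2
      \<le> exp (hdist z w) / 2 * (4 * exp (- hdist \<i> z)) * (4 * exp (- hdist \<i> w))"
    unfolding cay_diff[OF assms] using one_minus_cay_bounds(1) assms
    by (intro mult_mono mult_nonneg_nonneg) auto
  also have "\<dots> = 8 * exp (hdist z w - hdist \<i> z - hdist \<i> w)"
  proof -
    have "exp (hdist z w - hdist \<i> z - hdist \<i> w)
        = exp (hdist z w) * exp (- hdist \<i> z) * exp (- hdist \<i> w)"
      unfolding exp_add[symmetric] by simp
    then show ?thesis by simp
  qed
  finally show ?thesis .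
qed

text \<open>The converse of \<open>cay_diff_le\<close>: closeness in the disc bounds the hyperbolic
  distance.\<close>

lemma exp_hdist_le:
  assumes "z \<in> hplane" "w \<in> hplane"
  shows "exp (hdist z w) \<le> 2 + 4 * (cmod (cay z - cay w))\<^sup>2 * exp (hdist \<i> z + hdist \<i> w)"
proof -
  define A B where "A = 1 - (cmod (cay z))\<^sup>2" and "B = 1 - (cmod (cay w))\<^sup>2"
  have AB: "exp (- hdist \<i> z) \<le> A" "exp (- hdist \<i> w) \<le> B"
    using one_minus_cay_bounds(2) assms by (simp_all add: A_def B_def)
  then have pos: "A > 0" "B > 0" by (meson exp_gt_zero less_le_trans)+
  have "exp (- hdist \<i> z - hdist \<i> w) \<le> A * B"
    using AB by (simp add: exp_diff exp_minus divide_inverse mult_mono less_imp_le pos)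
  then have le: "inverse (A * B) \<le> exp (hdist \<i> z + hdist \<i> w)"
  proof -
    have "inverse (A * B) \<le> inverse (exp (- hdist \<i> z - hdist \<i> w))"
      by (rule le_imp_inverse_le) (use \<open>exp (- hdist \<i> z - hdist \<i> w) \<le> A * B\<close> in auto)
    also have "\<dots> = exp (hdist \<i> z + hdist \<i> w)" unfolding exp_minus[symmetric] by simp
    finally show ?thesis .
  qed
  have "cosh (hdist z w) = 1 + 2 * (cmod (cay z - cay w))\<^sup>2 * inverse (A * B)"
    using pos by (simp add: cay_diff[OF assms] A_def[symmetric] B_def[symmetric] field_simps)
  also have "\<dots> \<le> 1 + 2 * (cmod (cay z - cay w))\<^sup>2 * exp (hdist \<i> z + hdist \<i> w)"
    using le by (intro add_left_mono mult_left_mono) auto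
  finally show ?thesis using exp_le_2_cosh[of "hdist z w"] by linarith
qed

text \<open>Limits of averages become inequalities for all n, including 0, with a constant that
  absorbs finitely many exceptions. Such bounds can be added and put into exponents.\<close>

lemma linear_growth_iff:
  fixes r :: "nat \<Rightarrow> real"
  shows "(\<lambda>n. r n / real n) \<longlonglongrightarrow> v \<longleftrightarrow> (\<forall>\<epsilon>>0::real. \<exists>B::real. \<forall>n. \<bar>r n - v * n\<bar> \<le> \<epsilon> * n + B)"
proof
  assume L: "(\<lambda>n. r n / real n) \<longlonglongrightarrow> v"
  show "\<forall>\<epsilon>>0::real. \<exists>B::real. \<forall>n. \<bar>r n - v * n\<bar> \<le> \<epsilon> * n + B"
  proof (intro allI impI)
    fix \<epsilon> :: real assume "\<epsilon> > 0"
    then obtain N where N: "\<And>n. n \<ge> N \<Longrightarrow> \<bar>r n / real n - v\<bar> < \<epsilon>"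
      using LIMSEQ_D[OF L] by auto
    have "\<bar>r n - v * n\<bar> \<le> \<epsilon> * n + (\<Sum>k\<le>N. \<bar>r k - v * k\<bar>)" for n
    proof (cases "n > N")
      case True
      then have n: "real n > 0" "\<bar>r n / real n - v\<bar> < \<epsilon>" using N[of n] by auto
      have "\<bar>r n - v * n\<bar> = \<bar>r n / real n - v\<bar> * n"
        using n(1) by (simp add: abs_mult_pos' field_simps)
      also have "\<dots> \<le> \<epsilon> * n" using n by (intro mult_right_mono) auto
      finally show ?thesis by (smt (verit) sum_nonneg abs_ge_zero)
    next
      case False
      then have "\<bar>r n - v * n\<bar> \<le> (\<Sum>k\<le>N. \<bar>r k - v * k\<bar>)"
        by (intro member_le_sum) auto
      then show ?thesis using \<open>\<epsilon> > 0\<close> by (smt (verit) mult_nonneg_nonneg of_nat_0_le_iff)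
    qed
    then show "\<exists>B. \<forall>n. \<bar>r n - v * n\<bar> \<le> \<epsilon> * n + B" by blast
  qed
next
  assume H: "\<forall>\<epsilon>>0::real. \<exists>B::real. \<forall>n. \<bar>r n - v * n\<bar> \<le> \<epsilon> * n + B"
  show "(\<lambda>n. r n / real n) \<longlonglongrightarrow> v"
  proof (rule LIMSEQ_I)
    fix e :: real assume "e > 0"
    then obtain B where B: "\<And>n. \<bar>r n - v * n\<bar> \<le> e / 2 * n + B" using H by (meson half_gt_zero)
    obtain N :: nat where N: "real N > 2 * \<bar>B\<bar> / e + 1" using reals_Archimedean2 by blast
    have "norm (r n / real n - v) < e" if "n \<ge> N" for n
    proof -
      have "real n \<ge> real N" using that by simp
      moreover have "2 * \<bar>B\<bar> / e \<ge> 0" using \<open>e > 0\<close> by simp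
      ultimately have n: "real n > 2 * \<bar>B\<bar> / e" "real n > 0" using N by linarith+
      have "B < e / 2 * n" using n(1) \<open>e > 0\<close> by (simp add: field_simps)
      then have "\<bar>r n - v * n\<bar> < e * n" using B[of n] by simp
      moreover have "norm (r n / real n - v) = \<bar>r n - v * n\<bar> / n"
      proof -
        have "r n / real n - v = (r n - v * n) / n"
          unfolding diff_divide_distrib using n(2) by simp
        then show ?thesis using n(2) by simp
      qed
      ultimately show ?thesis using n(2) by (simp add: pos_divide_less_eq)
    qed
    then show "\<exists>no. \<forall>n\<ge>no. norm (r n / real n - v) < e" by blast
  qed
qed

lemma geometric_limit:
  fixes w :: "nat \<Rightarrow> 'a::banach"
  assumes q: "0 \<le> q" "q < 1" and step: "\<And>n. dist (w n) (w (Suc n)) \<le> K * q ^ n"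
  shows "\<exists>\<omega>. w \<longlonglongrightarrow> \<omega> \<and> (\<forall>n. dist (w n) \<omega> \<le> K / (1 - q) * q ^ n)"
proof -
  have K: "K \<ge> 0" using step[of 0] by (simp add: order_trans[OF zero_le_dist])
  \<comment> \<open>Keeping the subtracted term q^(n+k) makes the induction on k close
    exactly.\<close>
  have tail: "dist (w n) (w (n + k)) \<le> K / (1 - q) * (q ^ n - q ^ (n + k))" for n k
  proof (induction k)
    case (Suc k)
    have "dist (w n) (w (n + Suc k)) \<le> dist (w n) (w (n + k)) + dist (w (n + k)) (w (Suc (n + k)))"
      using dist_triangle by simp
    also have "\<dots> \<le> K / (1 - q) * (q ^ n - q ^ (n + k)) + K * q ^ (n + k)"
      using Suc step by (intro add_mono)
    also have "\<dots> = K / (1 - q) * (q ^ n - q ^ (n + Suc k))"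
      using q by (simp add: field_simps)
    finally show ?case .
  qed simp
  have tail': "dist (w n) (w m) \<le> K / (1 - q) * q ^ n" if "m \<ge> n" for n m
  proof -
    define k where "k = m - n"
    have "m = n + k" using that by (simp add: k_def)
    moreover have "K / (1 - q) * (q ^ n - q ^ (n + k)) \<le> K / (1 - q) * q ^ n"
      using q K by (intro mult_left_mono) auto
    ultimately show ?thesis using tail[of n k] by simp
  qed
  have "Cauchy w"
  proof (rule metric_CauchyI)
    fix e :: real assume e: "e > 0"
    have "(\<lambda>n. K / (1 - q) * q ^ n) \<longlonglongrightarrow> K / (1 - q) * 0"
      using q by (intro tendsto_intros LIMSEQ_realpow_zero)
    then have "\<forall>\<^sub>F n in sequentially. K / (1 - q) * q ^ n < e / 2"
      using e by (intro order_tendstoD(2)[of _ 0]) auto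
    then obtain N where N: "K / (1 - q) * q ^ N < e / 2" by (auto simp: eventually_sequentially)
    have "dist (w m) (w n) < e" if "m \<ge> N" "n \<ge> N" for m n
    proof -
      have "dist (w m) (w n) \<le> dist (w N) (w m) + dist (w N) (w n)"
        by (simp add: dist_triangle3)
      then show ?thesis using tail'[OF that(1)] tail'[OF that(2)] N by linarith
    qed
    then show "\<exists>M. \<forall>m\<ge>M. \<forall>n\<ge>M. dist (w m) (w n) < e" by blast
  qed
  then obtain \<omega> where \<omega>: "w \<longlonglongrightarrow> \<omega>" using Cauchy_convergent_iff convergent_def by blast
  have "dist (w n) \<omega> \<le> K / (1 - q) * q ^ n" for n
  proof (rule LIMSEQ_le_const2)
    show "(\<lambda>m. dist (w n) (w m)) \<longlonglongrightarrow> dist (w n) \<omega>" by (intro tendsto_intros \<omega>)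
    show "\<exists>N. \<forall>m\<ge>N. dist (w n) (w m) \<le> K / (1 - q) * q ^ n" using tail' by blast
  qed
  with \<omega> show ?thesis by blast
qed

text \<open>Covers both the orbits of a lift and the points n v of a line, so that the two can be
  compared.\<close>

definition regular :: "(nat \<Rightarrow> complex) \<Rightarrow> real \<Rightarrow> bool" where
  "regular z v \<longleftrightarrow> (\<forall>n. z n \<in> hplane) \<and> (\<exists>C. \<forall>n. hdist (z n) (z (Suc n)) \<le> C) \<and>
     (\<lambda>n. hdist \<i> (z n) / real n) \<longlonglongrightarrow> v"

lemma regular_growth:
  assumes "regular z v" "0 < \<epsilon>"
  shows "\<exists>B. \<forall>n. \<bar>hdist \<i> (z n) - v * real n\<bar> \<le> \<epsilon> * real n + B"
  using assms linear_growth_iff[of "\<lambda>n. hdist \<i> (z n)" v] by (simp add: regular_def)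

text \<open>Neighbours are at bounded distance and about v n away from \<open>\<i>\<close>, so by
  \<open>cay_diff_le\<close> their images differ by a multiple of exp (-(v - \<epsilon>) n), the
  terms of a geometric series.\<close>

lemma regular_limit_bound:
  assumes "regular z v" "v > 0" "0 < \<epsilon>" "\<epsilon> < v"
  shows "\<exists>\<omega> K. (\<lambda>n. cay (z n)) \<longlonglongrightarrow> \<omega> \<and> (\<forall>n. dist (cay (z n)) \<omega> \<le> K * exp (- (v - \<epsilon>) * n))"
proof -
  have z: "\<And>n. z n \<in> hplane" using assms(1) by (simp add: regular_def)
  obtain C where C: "\<And>n. hdist (z n) (z (Suc n)) \<le> C" using assms(1) by (auto simp: regular_def)
  obtain B where B: "\<And>n. \<bar>hdist \<i> (z n) - v * n\<bar> \<le> \<epsilon> * n + B"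
    using regular_growth[OF assms(1,3)] by blast
  define q where "q = exp (- (v - \<epsilon>))"
  have q: "0 \<le> q" "q < 1" using assms by (auto simp: q_def)
  have qn: "exp (- (v - \<epsilon>) * n) = q ^ n" for n :: nat
    by (simp add: q_def exp_of_nat_mult[symmetric] mult.commute)
  define K where "K = sqrt (8 * exp (2 * C + 2 * B))"
  have "dist (cay (z n)) (cay (z (Suc n))) \<le> K * q ^ n" for n
  proof -
    have "hdist \<i> (z n) \<le> hdist \<i> (z (Suc n)) + C"
      using hdist_triangle[of \<i> "z (Suc n)" "z n"] z C[of n] by (simp add: hdist_commute)
    moreover have "hdist \<i> (z n) \<ge> (v - \<epsilon>) * n - B"
      using B[of n] by (simp add: left_diff_distrib abs_le_iff)
    ultimately have "hdist (z n) (z (Suc n)) - hdist \<i> (z n) - hdist \<i> (z (Suc n))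
        \<le> 2 * C + 2 * B + 2 * (- (v - \<epsilon>) * n)"
      using C[of n] by argo
    then have "8 * exp (hdist (z n) (z (Suc n)) - hdist \<i> (z n) - hdist \<i> (z (Suc n)))
        \<le> 8 * exp (2 * C + 2 * B + 2 * (- (v - \<epsilon>) * n))" by simp
    also have "\<dots> = (K * q ^ n)\<^sup>2"
      unfolding qn[symmetric] by (simp add: K_def power_mult_distrib exp_add flip: exp_double)
    finally have "(dist (cay (z n)) (cay (z (Suc n))))\<^sup>2 \<le> (K * q ^ n)\<^sup>2"
      using cay_diff_le[OF z z, of n "Suc n"] by (simp add: dist_norm)
    then show ?thesis
      by (rule power2_le_imp_le) (simp add: K_def q_def)
  qed
  from geometric_limit[OF q this] show ?thesis unfolding qn by blast
qed

text \<open>The limit is on the circle because the gap 1 - |Z|^2 is bounded by a multiple of exp (-v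
  n / 2).\<close>

lemma regular_limit:
  assumes "regular z v" "v > 0"
  shows "\<exists>\<omega>. cmod \<omega> = 1 \<and> (\<lambda>n. cay (z n)) \<longlonglongrightarrow> \<omega>"
proof -
  obtain \<omega> where \<omega>: "(\<lambda>n. cay (z n)) \<longlonglongrightarrow> \<omega>"
    using regular_limit_bound[OF assms half_gt_zero[OF assms(2)]] assms(2) by (metis field_sum_of_halves less_add_same_cancel1 half_gt_zero)
  have z: "\<And>n. z n \<in> hplane" using assms(1) by (simp add: regular_def)
  obtain B where B: "\<And>n. \<bar>hdist \<i> (z n) - v * n\<bar> \<le> v / 2 * n + B"
    using regular_growth[OF assms(1) half_gt_zero[OF assms(2)]] by blast
  have u: "1 - (cmod (cay (z n)))\<^sup>2 \<le> 4 * exp (B - v / 2 * real n)" for n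
  proof -
    have "- hdist \<i> (z n) \<le> B - v / 2 * n" using B[of n] by (simp add: abs_le_iff)
    then show ?thesis using one_minus_cay_bounds(1)[OF z, of n] by (smt (verit) exp_le_cancel_iff)
  qed
  have l: "0 \<le> 1 - (cmod (cay (z n)))\<^sup>2" for n
    using one_minus_cay_bounds(2)[OF z] by (meson exp_ge_zero order_trans)
  have t: "(\<lambda>n. 4 * exp (B - v/2 * real n)) \<longlonglongrightarrow> 0"
    using \<open>v > 0\<close> by real_asymp
  have "(\<lambda>n. 1 - (cmod (cay (z n)))\<^sup>2) \<longlonglongrightarrow> 0"
    by (rule tendsto_sandwich[OF always_eventually always_eventually tendsto_const t])
       (use l u in blast)+
  moreover have "(\<lambda>n. 1 - (cmod (cay (z n)))\<^sup>2) \<longlonglongrightarrow> 1 - (cmod \<omega>)\<^sup>2"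
    by (intro tendsto_intros \<omega>)
  ultimately have "1 - (cmod \<omega>)\<^sup>2 = 0" using LIMSEQ_unique by blast
  then have "(cmod \<omega>)\<^sup>2 = 1\<^sup>2" by simp
  then have "cmod \<omega> = 1" by (subst (asm) power2_eq_iff_nonneg) auto
  with \<omega> show ?thesis by blast
qed

text \<open>Both images are within a multiple of exp (-(v - \<epsilon>) n) of \<omega>. In
  \<open>exp_hdist_le\<close> the exponents -2(v - \<epsilon>) n and 2(v + \<epsilon>) n almost
  cancel, which leaves a distance of at most 4\<epsilon> n plus a constant.\<close>

lemma regular_same_limit:
  assumes z: "regular z v" and p: "regular p v" and "v > 0"
    and "(\<lambda>n. cay (z n)) \<longlonglongrightarrow> \<omega>" "(\<lambda>n. cay (p n)) \<longlonglongrightarrow> \<omega>"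
  shows "(\<lambda>n. hdist (z n) (p n) / real n) \<longlonglongrightarrow> 0"
  unfolding linear_growth_iff
proof (intro allI impI)
  fix \<epsilon>' :: real assume "\<epsilon>' > 0"
  \<comment> \<open>The factor 4 anticipates the remaining exponent 4\<epsilon> n; the bound
    \<open>v / 2\<close> keeps the convergence rate v - \<epsilon> positive.\<close>
  define \<epsilon> where "\<epsilon> = min (\<epsilon>' / 4) (v / 2)"
  have \<epsilon>: "0 < \<epsilon>" "\<epsilon> < v" "4 * \<epsilon> \<le> \<epsilon>'" using \<open>\<epsilon>' > 0\<close> \<open>v > 0\<close> by (auto simp: \<epsilon>_def)
  have zh: "\<And>n. z n \<in> hplane" and ph: "\<And>n. p n \<in> hplane" using z p by (auto simp: regular_def)
  obtain B1 where B1: "\<And>n. \<bar>hdist \<i> (z n) - v * n\<bar> \<le> \<epsilon> * n + B1"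
    using regular_growth[OF z \<epsilon>(1)] by blast
  obtain B2 where B2: "\<And>n. \<bar>hdist \<i> (p n) - v * n\<bar> \<le> \<epsilon> * n + B2"
    using regular_growth[OF p \<epsilon>(1)] by blast
  obtain K1 where K1: "\<And>n. dist (cay (z n)) \<omega> \<le> K1 * exp (- (v - \<epsilon>) * n)"
    using regular_limit_bound[OF z \<open>v > 0\<close> \<epsilon>(1,2)] LIMSEQ_unique assms(4) by metis
  obtain K2 where K2: "\<And>n. dist (cay (p n)) \<omega> \<le> K2 * exp (- (v - \<epsilon>) * n)"
    using regular_limit_bound[OF p \<open>v > 0\<close> \<epsilon>(1,2)] LIMSEQ_unique assms(5) by metis
  define K where "K = 4 * (K1 + K2)\<^sup>2 * exp (B1 + B2)"
  have K: "K \<ge> 0" by (simp add: K_def)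
  have "hdist (z n) (p n) \<le> \<epsilon>' * n + ln (2 + K)" for n
  proof -
    have "dist (cay (z n)) (cay (p n)) \<le> (K1 + K2) * exp (- (v - \<epsilon>) * n)"
      using dist_triangle2[of "cay (z n)" "cay (p n)" \<omega>] K1[of n] K2[of n] by (simp add: distrib_right)
    then have "(cmod (cay (z n) - cay (p n)))\<^sup>2 \<le> ((K1 + K2) * exp (- (v - \<epsilon>) * n))\<^sup>2"
      unfolding dist_norm by (intro power_mono) auto
    also have "\<dots> = (K1 + K2)\<^sup>2 * exp (2 * (- (v - \<epsilon>) * n))"
      by (simp only: power_mult_distrib exp_double)
    finally have 1: "(cmod (cay (z n) - cay (p n)))\<^sup>2 \<le> (K1 + K2)\<^sup>2 * exp (2 * (- (v - \<epsilon>) * n))" .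
    have 2: "hdist \<i> (z n) + hdist \<i> (p n) \<le> 2 * (v + \<epsilon>) * n + (B1 + B2)"
      using B1[of n] B2[of n] by (simp add: algebra_simps abs_le_iff)
    have "exp (hdist (z n) (p n))
        \<le> 2 + 4 * (cmod (cay (z n) - cay (p n)))\<^sup>2 * exp (hdist \<i> (z n) + hdist \<i> (p n))"
      by (rule exp_hdist_le[OF zh ph])
    also have "\<dots> \<le> 2 + 4 * ((K1 + K2)\<^sup>2 * exp (2 * (- (v - \<epsilon>) * n))) * exp (2 * (v + \<epsilon>) * n + (B1 + B2))"
      using 1 2 by (intro add_left_mono mult_mono) auto
    also have "\<dots> = 2 + K * exp (2 * (- (v - \<epsilon>) * n) + 2 * (v + \<epsilon>) * n)"
      by (simp add: K_def exp_add)
    also have "2 * (- (v - \<epsilon>) * n) + 2 * (v + \<epsilon>) * n = 4 * \<epsilon> * n" by (simp add: algebra_simps)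
    also have "2 + K * exp (4 * \<epsilon> * n) \<le> (2 + K) * exp (\<epsilon>' * n)"
    proof -
      have a: "4 * \<epsilon> * n \<le> \<epsilon>' * n" using \<epsilon> by (intro mult_right_mono) auto
      then have "K * exp (4 * \<epsilon> * n) \<le> K * exp (\<epsilon>' * n)" using K by (intro mult_left_mono) auto
      moreover have "1 \<le> exp (\<epsilon>' * n)" using \<open>\<epsilon>' > 0\<close> by simp
      ultimately show ?thesis unfolding distrib_right by linarith
    qed
    finally have "exp (hdist (z n) (p n)) \<le> exp (\<epsilon>' * n + ln (2 + K))"
      using K by (simp add: exp_add mult.commute)
    then show ?thesis by simp
  qed
  moreover have "hdist (z n) (p n) \<ge> 0" for n using hdist_nonneg zh ph by blast
  ultimately show "\<exists>B. \<forall>n. \<bar>hdist (z n) (p n) - 0 * real n\<bar> \<le> \<epsilon>' * real n + B"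
    by (intro exI[of _ "ln (2 + K)"]) auto
qed

text \<open>A distance of at most v n / 4 is beaten by an escape of at least 3 v n / 4, up to
  constants, so the exponent in \<open>cay_diff_le\<close> is at most -v n / 2 plus a
  constant.\<close>

lemma sublinear_same_limit:
  assumes z: "regular z v" and "v > 0" and p: "\<And>n. p n \<in> hplane"
    and d: "(\<lambda>n. hdist (z n) (p n) / real n) \<longlonglongrightarrow> 0" and lim: "(\<lambda>n. cay (z n)) \<longlonglongrightarrow> \<omega>"
  shows "(\<lambda>n. cay (p n)) \<longlonglongrightarrow> \<omega>"
proof -
  have zh: "\<And>n. z n \<in> hplane" using z by (auto simp: regular_def)
  obtain B1 where B1: "\<And>n. \<bar>hdist \<i> (z n) - v * n\<bar> \<le> v/4 * n + B1"
    using regular_growth[OF z, of "v/4"] \<open>v > 0\<close> by auto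
  obtain B2 where B2: "\<And>n. \<bar>hdist (z n) (p n) - 0 * real n\<bar> \<le> v/4 * n + B2"
    using d[unfolded linear_growth_iff, rule_format, of "v/4"] \<open>v > 0\<close> by auto
  have u: "(cmod (cay (z n) - cay (p n)))\<^sup>2 \<le> 8 * exp (B1 + B2 - v/2 * n)" for n
  proof -
    have "hdist (z n) (p n) - hdist \<i> (z n) - hdist \<i> (p n) \<le> B1 + B2 - v/2 * n"
      using B1[of n] B2[of n] hdist_nonneg[OF i_in_hplane p, of n] by (simp add: abs_le_iff)
    then show ?thesis using cay_diff_le[OF zh p, of n n] by (smt (verit) exp_le_cancel_iff)
  qed
  have t: "(\<lambda>n. 8 * exp (B1 + B2 - v/2 * real n)) \<longlonglongrightarrow> 0"
    using \<open>v > 0\<close> by real_asymp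
  have "(\<lambda>n. (cmod (cay (z n) - cay (p n)))\<^sup>2) \<longlonglongrightarrow> 0"
    by (rule tendsto_sandwich[OF always_eventually always_eventually tendsto_const t])
       (use u in \<open>auto simp del: One_nat_def\<close>)
  then have "(\<lambda>n. cay (z n) - cay (p n)) \<longlonglongrightarrow> 0"
    by (simp add: tendsto_norm_zero_iff)
  then show ?thesis using Lim_transform2[OF lim] by (simp add: LIM_zero_iff tendsto_diff)
qed

section \<open>Endpoints of lines\<close>

lemma cay_mob:
  assumes "a * d - b * c = 1" "z \<in> hplane"
  shows "cay (mob a b c d z) =
    ((of_real a - \<i> * of_real c) * z + (of_real b - \<i> * of_real d)) /
    ((of_real a + \<i> * of_real c) * z + (of_real b + \<i> * of_real d))"
proof -
  let ?q = "of_real c * z + complex_of_real d" and ?p = "of_real a * z + complex_of_real b"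
  have q: "?q \<noteq> 0" by (rule mob_denom[OF assms])
  have "cay (mob a b c d z) = ((?p - \<i> * ?q) / ?q) / ((?p + \<i> * ?q) / ?q)"
    unfolding cay_def mob_def diff_divide_distrib add_divide_distrib using q by simp
  also have "\<dots> = (?p - \<i> * ?q) / (?p + \<i> * ?q)" using q by simp
  finally show ?thesis by (simp add: algebra_simps)
qed

lemma mob_column_nonzero:
  assumes "a * d - b * c = 1"
  shows "complex_of_real a + \<i> * of_real c \<noteq> 0" "complex_of_real b + \<i> * of_real d \<noteq> 0"
  using assms by (auto simp: complex_eq_iff)

lemma tendsto_fraction_zero:
  fixes e :: "'b \<Rightarrow> 'a::real_normed_field"
  assumes "(e \<longlongrightarrow> 0) F" "a' \<noteq> 0"
  shows "((\<lambda>t. (a + b * e t) / (a' + b' * e t)) \<longlongrightarrow> a / a') F"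
proof -
  have "((\<lambda>t. x + y * e t) \<longlongrightarrow> x + 0) F" for x y
    by (rule tendsto_add[OF tendsto_const tendsto_mult_right_zero[OF assms(1)]])
  from tendsto_divide[OF this this] show ?thesis using assms(2) by simp
qed

text \<open>In the half-plane the endpoints are a/c and b/d. Their Cayley images, written as
  quotients of conjugates, also make sense when c or d is 0.\<close>

lemma mob_vert_endpoints:
  assumes m: "a * d - b * c = 1"
  shows "((\<lambda>t. cay (mob a b c d (vert t))) \<longlongrightarrow>
      (of_real a - \<i> * of_real c) / (of_real a + \<i> * of_real c)) at_top"
    and "((\<lambda>t. cay (mob a b c d (vert t))) \<longlongrightarrow>
      (of_real b - \<i> * of_real d) / (of_real b + \<i> * of_real d)) at_bot"
proof -
  let ?a = "of_real a - \<i> * complex_of_real c" and ?b = "of_real b - \<i> * complex_of_real d"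
  let ?a' = "of_real a + \<i> * complex_of_real c" and ?b' = "of_real b + \<i> * complex_of_real d"
  have nz: "?a' \<noteq> 0" "?b' \<noteq> 0" using mob_column_nonzero[OF m] by auto
  have "((\<lambda>t::real. exp t) \<longlongrightarrow> 0) at_bot" by (rule exp_at_bot)
  from tendsto_of_real[OF this] have "((\<lambda>t. complex_of_real (exp t)) \<longlongrightarrow> 0) at_bot" by simp
  then have v0: "(vert \<longlongrightarrow> 0) at_bot"
    unfolding vert_def[abs_def] by (rule tendsto_mult_right_zero)
  show "((\<lambda>t. cay (mob a b c d (vert t))) \<longlongrightarrow> ?b / ?b') at_bot"
    unfolding cay_mob[OF m vert_in_hplane]
    using tendsto_fraction_zero[OF v0 nz(2), of ?b ?a ?a'] by (simp add: add.commute)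
  have "((\<lambda>t::real. exp (- t)) \<longlongrightarrow> 0) at_top" by real_asymp
  from tendsto_of_real[OF this] have "((\<lambda>t. complex_of_real (exp (- t))) \<longlongrightarrow> 0) at_top" by simp
  then have v1: "((\<lambda>t. - \<i> * complex_of_real (exp (- t))) \<longlongrightarrow> 0) at_top"
    by (rule tendsto_mult_right_zero)
  have "((\<lambda>t. (?a + ?b * (- \<i> * of_real (exp (- t)))) / (?a' + ?b' * (- \<i> * of_real (exp (- t))))) \<longlongrightarrow>
      ?a / ?a') at_top"
    by (rule tendsto_fraction_zero[OF v1 nz(1)])
  \<comment> \<open>Numerator and denominator are divided by \<open>vert t\<close>, whose inverse is
    -\<open>\<i>\<close> exp (-t).\<close>
  moreover have "cay (mob a b c d (vert t)) =
      (?a + ?b * (- \<i> * of_real (exp (- t)))) / (?a' + ?b' * (- \<i> * of_real (exp (- t))))" for t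
  proof -
    have e: "- \<i> * of_real (exp (- t)) * vert t = 1"
    proof -
      have "complex_of_real (exp (- t)) * of_real (exp t) = 1"
        by (simp flip: of_real_mult exp_add)
      then show ?thesis by (simp add: vert_def mult.assoc mult.left_commute)
    qed
    have vz: "vert t \<noteq> 0" by (simp add: vert_def)
    let ?e = "- \<i> * complex_of_real (exp (- t))"
    have "(?a + ?b * ?e) / (?a' + ?b' * ?e) = ((?a + ?b * ?e) * vert t) / ((?a' + ?b' * ?e) * vert t)"
      using vz by simp
    also have "(?a + ?b * ?e) * vert t = ?a * vert t + ?b"
      using e by (metis (no_types, lifting) distrib_right mult.assoc mult.right_neutral)
    also have "(?a' + ?b' * ?e) * vert t = ?a' * vert t + ?b'"
      using e by (metis (no_types, lifting) distrib_right mult.assoc mult.right_neutral)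
    finally show ?thesis by (simp add: cay_mob[OF m])
  qed
  ultimately show "((\<lambda>t. cay (mob a b c d (vert t))) \<longlongrightarrow> ?a / ?a') at_top" by simp
qed

text \<open>Equality of endpoints means that the columns (a, c) and (a', c') are parallel.\<close>

lemma cnj_ratio_eq:
  assumes "complex_of_real a + \<i> * of_real c \<noteq> 0" "complex_of_real a' + \<i> * of_real c' \<noteq> 0"
    and "(of_real a - \<i> * of_real c) / (of_real a + \<i> * of_real c) =
         (of_real a' - \<i> * of_real c') / (complex_of_real a' + \<i> * of_real c')"
  shows "a * c' = a' * c"
proof -
  have "(of_real a - \<i> * of_real c) * (complex_of_real a' + \<i> * of_real c') =
      (of_real a' - \<i> * of_real c') * (complex_of_real a + \<i> * of_real c)"
    using assms by (simp add: frac_eq_eq)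
  from arg_cong[OF this, of Im] show ?thesis by (simp add: algebra_simps)
qed

text \<open>Equal endpoints make the columns of the two matrices A and A' proportional, so A' = A
  diag(l, k) with l k = 1 by the determinants. This diagonal matrix translates the axis by 2 ln
  |l|.\<close>

lemma line_unique:
  assumes "is_line \<gamma>" "is_line \<gamma>'"
    and "((\<lambda>t. cay (\<gamma> t)) \<longlongrightarrow> \<omega>) at_top" "((\<lambda>t. cay (\<gamma>' t)) \<longlongrightarrow> \<omega>) at_top"
    and "((\<lambda>t. cay (\<gamma> t)) \<longlongrightarrow> \<omega>') at_bot" "((\<lambda>t. cay (\<gamma>' t)) \<longlongrightarrow> \<omega>') at_bot"
  shows "\<exists>s. \<forall>t. \<gamma>' t = \<gamma> (t + s)"
proof -
  obtain a b c d where m: "a * d - b * c = 1" and g: "\<And>t. \<gamma> t = mob a b c d (vert t)"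
    using assms(1) unfolding is_line_def by blast
  obtain a' b' c' d' where m': "a' * d' - b' * c' = 1" and g': "\<And>t. \<gamma>' t = mob a' b' c' d' (vert t)"
    using assms(2) unfolding is_line_def by blast
  note nz = mob_column_nonzero[OF m] mob_column_nonzero[OF m']
  have 1: "a * c' = a' * c"
  proof (rule cnj_ratio_eq[OF nz(1,3)])
    show "(of_real a - \<i> * of_real c) / (of_real a + \<i> * of_real c) =
         (of_real a' - \<i> * of_real c') / (complex_of_real a' + \<i> * of_real c')"
      using tendsto_unique[OF trivial_limit_at_top_linorder assms(3)[unfolded g] mob_vert_endpoints(1)[OF m]]
        tendsto_unique[OF trivial_limit_at_top_linorder assms(4)[unfolded g'] mob_vert_endpoints(1)[OF m']]
      by simp
  qed
  have 2: "b * d' = b' * d"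
  proof (rule cnj_ratio_eq[OF nz(2,4)])
    show "(of_real b - \<i> * of_real d) / (of_real b + \<i> * of_real d) =
         (of_real b' - \<i> * of_real d') / (complex_of_real b' + \<i> * of_real d')"
      using tendsto_unique[OF trivial_limit_at_bot_linorder assms(5)[unfolded g] mob_vert_endpoints(2)[OF m]]
        tendsto_unique[OF trivial_limit_at_bot_linorder assms(6)[unfolded g'] mob_vert_endpoints(2)[OF m']]
      by simp
  qed
  \<comment> \<open>The diagonal entries of the product of the inverse of the first matrix with the
    second.\<close>
  define l k where "l = d * a' - b * c'" and "k = a * d' - c * b'"
  have a': "a' = l * a" and c': "c' = l * c" and b': "b' = k * b" and d': "d' = k * d"
    using m 1 2 unfolding l_def k_def by algebra+
  have lk: "l * k = 1" using m m' unfolding a' b' c' d' by algebra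
  then have l0: "l \<noteq> 0" by auto
  have "\<gamma>' t = \<gamma> (t + 2 * ln \<bar>l\<bar>)" for t
  proof -
    have "exp (2 * ln \<bar>l\<bar>) = l\<^sup>2" using l0 by (simp add: exp_double)
    then have v: "vert (t + 2 * ln \<bar>l\<bar>) = of_real (l * l) * vert t"
      by (simp add: vert_def exp_add power2_eq_square)
    have k: "k = 1 / l" using lk l0 by (simp add: field_simps)
    have "\<gamma>' t = (of_real l * (of_real a * vert t) + of_real k * of_real b)
        / (of_real l * (of_real c * vert t) + of_real k * of_real d)"
      by (simp add: g' mob_def a' b' c' d' mult.assoc)
    also have "\<dots> = (of_real l * (of_real l * (of_real a * vert t) + of_real k * of_real b))
        / (of_real l * (of_real l * (of_real c * vert t) + of_real k * of_real d))"
      using l0 by simp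
    also have "\<dots> = \<gamma> (t + 2 * ln \<bar>l\<bar>)"
    proof -
      have "complex_of_real l * of_real k = 1" using lk by (metis of_real_1 of_real_mult)
      then have "of_real l * (of_real l * (of_real x * vert t) + of_real k * of_real y)
          = of_real x * (of_real (l * l) * vert t) + complex_of_real y" for x y
        by (simp add: algebra_simps)
      then show ?thesis unfolding g v mob_def by simp
    qed
    finally show ?thesis .
  qed
  then show ?thesis by blast
qed

text \<open>The line from \<open>\<omega>'\<close> to \<open>\<omega>\<close>: writing the columns of a matrix as complex numbers, the square roots
  of the conjugate endpoints are the directions of the columns.\<close>

definition axis_den :: "complex \<Rightarrow> complex \<Rightarrow> real" where
  "axis_den \<omega> \<omega>' = Re (csqrt \<omega>') * Im (csqrt \<omega>) - Re (csqrt \<omega>) * Im (csqrt \<omega>')"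

definition axis :: "complex \<Rightarrow> complex \<Rightarrow> real \<Rightarrow> complex" where
  "axis \<omega> \<omega>' t = mob (Re (csqrt \<omega>) / axis_den \<omega> \<omega>') (Re (csqrt \<omega>'))
     (- Im (csqrt \<omega>) / axis_den \<omega> \<omega>') (- Im (csqrt \<omega>')) (vert t)"

text \<open>\<open>axis_den\<close> is Im (u cnj w) for the square roots u and w of the endpoints.
  If it vanishes, u cnj w is real, and then u^2 = w^2.\<close>

lemma axis_den_nonzero:
  assumes "cmod \<omega> = 1" "cmod \<omega>' = 1" "\<omega> \<noteq> \<omega>'"
  shows "axis_den \<omega> \<omega>' \<noteq> 0"
proof
  define u w where "u = csqrt \<omega>" and "w = csqrt \<omega>'"
  have uw: "u\<^sup>2 = \<omega>" "w\<^sup>2 = \<omega>'" by (simp_all add: u_def w_def)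
  have n: "u * cnj u = 1" "w * cnj w = 1"
    using assms by (simp_all add: u_def w_def complex_norm_square[symmetric])
  assume "axis_den \<omega> \<omega>' = 0"
  then have "Im (u * cnj w) = 0" unfolding axis_den_def u_def[symmetric] w_def[symmetric]
    by (simp add: mult.commute)
  then have "u * cnj w = cnj (u * cnj w)" by (simp add: complex_eq_iff)
  then have "u * cnj w = cnj u * w" by simp
  then have "u\<^sup>2 = w\<^sup>2" using n unfolding power2_eq_square by algebra
  with uw assms(3) show False by simp
qed

lemma axis_det:
  assumes "axis_den \<omega> \<omega>' \<noteq> 0"
  shows "Re (csqrt \<omega>) / axis_den \<omega> \<omega>' * (- Im (csqrt \<omega>'))
     - Re (csqrt \<omega>') * (- Im (csqrt \<omega>) / axis_den \<omega> \<omega>') = 1"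
proof -
  have "Re (csqrt \<omega>) / axis_den \<omega> \<omega>' * (- Im (csqrt \<omega>'))
     - Re (csqrt \<omega>') * (- Im (csqrt \<omega>) / axis_den \<omega> \<omega>') = axis_den \<omega> \<omega>' / axis_den \<omega> \<omega>'"
  proof -
    have "x / k * (- y') - x' * (- y / k) = (x' * y - x * y') / k" for x y x' y' k :: real
      by (simp add: diff_divide_distrib)
    then show ?thesis unfolding axis_den_def[of \<omega> \<omega>', symmetric]
      by (subst axis_den_def[of \<omega> \<omega>']) blast
  qed
  then show ?thesis using assms by simp
qed

text \<open>For |u| = 1 the quotient u / cnj u is u^2, the prescribed endpoint, and the real scale k
  cancels.\<close>

lemma csqrt_ratio:
  assumes "cmod \<omega> = 1" "k \<noteq> 0"
  shows "(of_real (Re (csqrt \<omega>) / k) - \<i> * of_real (- Im (csqrt \<omega>) / k)) /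
     (of_real (Re (csqrt \<omega>) / k) + \<i> * of_real (- Im (csqrt \<omega>) / k)) = \<omega>"
proof -
  define u where "u = csqrt \<omega>"
  have u2: "u * u = \<omega>" by (simp add: u_def flip: power2_eq_square)
  have n: "u * cnj u = 1" using assms by (simp add: u_def complex_norm_square[symmetric])
  then have u0: "cnj u \<noteq> 0" by auto
  have 1: "of_real (Re u / k) - \<i> * of_real (- Im u / k) = u / of_real k"
    and 2: "of_real (Re u / k) + \<i> * of_real (- Im u / k) = cnj u / of_real k"
    by (simp_all add: complex_eq_iff)
  have "u / cnj u = (u * u) / (u * cnj u)" using u0 by simp
  then have "u / cnj u = \<omega>" using n u2 by simp
  then show ?thesis unfolding u_def[symmetric] 1 2 using assms(2) by simp
qed

lemma axis_line:
  assumes "cmod \<omega> = 1" "cmod \<omega>' = 1" "\<omega> \<noteq> \<omega>'"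
  shows "is_line (axis \<omega> \<omega>')"
    and "((\<lambda>t. cay (axis \<omega> \<omega>' t)) \<longlongrightarrow> \<omega>) at_top"
    and "((\<lambda>t. cay (axis \<omega> \<omega>' t)) \<longlongrightarrow> \<omega>') at_bot"
proof -
  note d = axis_den_nonzero[OF assms]
  note m = axis_det[OF d]
  show "is_line (axis \<omega> \<omega>')" using m unfolding is_line_def axis_def by blast
  show "((\<lambda>t. cay (axis \<omega> \<omega>' t)) \<longlongrightarrow> \<omega>) at_top"
    using mob_vert_endpoints(1)[OF m] unfolding csqrt_ratio[OF assms(1) d] axis_def .
  show "((\<lambda>t. cay (axis \<omega> \<omega>' t)) \<longlongrightarrow> \<omega>') at_bot"
    using mob_vert_endpoints(2)[OF m] csqrt_ratio[OF assms(2), of 1] unfolding axis_def by simp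
qed

section \<open>Unit tangent vectors and the geodesic flow of the plane\<close>

lemma mob_vert_deriv:
  assumes m: "a * d - b * c = 1"
  shows "((\<lambda>t. mob a b c d (vert t)) has_vector_derivative
    vert t / (of_real c * vert t + of_real d)\<^sup>2) (at t)"
proof -
  have q: "of_real c * vert t + complex_of_real d \<noteq> 0" by (rule mob_denom[OF m vert_in_hplane])
  have e: "complex_of_real a * of_real d - of_real b * of_real c = 1"
    by (metis m of_real_1 of_real_diff of_real_mult)
  have "(vert has_vector_derivative vert t) (at t)"
  proof -
    have "((\<lambda>z. \<i> * exp z) has_field_derivative \<i> * exp (of_real t)) (at (of_real t))"
      by (auto intro!: derivative_eq_intros)
    from has_vector_derivative_real_field[OF this] show ?thesis
      by (simp add: vert_def[abs_def] exp_of_real)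
  qed
  moreover have "(mob a b c d has_field_derivative
      1 / (of_real c * vert t + of_real d)\<^sup>2) (at (vert t))"
    unfolding mob_def[abs_def]
    using q e by (auto intro!: derivative_eq_intros simp: power2_eq_square) algebra
  ultimately have "((mob a b c d \<circ> vert) has_vector_derivative
      vert t * (1 / (of_real c * vert t + of_real d)\<^sup>2)) (at t)"
    by (rule field_vector_diff_chain_at)
  then show ?thesis by (simp add: o_def)
qed

definition tang :: "(real \<Rightarrow> complex) \<Rightarrow> real \<Rightarrow> complex \<times> complex" where
  "tang c t = (c t, vector_derivative c (at t))"

lemma tang_mob:
  assumes "a * d - b * c = 1" "\<And>t. \<gamma> t = mob a b c d (vert t)"
  shows "tang \<gamma> t = (mob a b c d (vert t), vert t / (of_real c * vert t + of_real d)\<^sup>2)"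
proof -
  have "\<gamma> = (\<lambda>t. mob a b c d (vert t))" using assms(2) by auto
  then show ?thesis using mob_vert_deriv[OF assms(1)] by (simp add: tang_def vector_derivative_at)
qed

lemma tang_in_T1_hplane:
  assumes "is_line \<gamma>"
  shows "tang \<gamma> t \<in> T1_hplane"
proof -
  obtain a b c d where m: "a * d - b * c = 1" and g: "\<And>t. \<gamma> t = mob a b c d (vert t)"
    using assms unfolding is_line_def by blast
  show ?thesis
    unfolding tang_mob[OF m g] T1_hplane_def
    by (simp add: mob_in_hplane[OF m] Im_mob[OF m] norm_divide norm_power)
qed

lemma line_has_vector_derivative:
  assumes "is_line \<gamma>"
  shows "(\<gamma> has_vector_derivative vector_derivative \<gamma> (at t)) (at t)"
proof -
  obtain a b c d where m: "a * d - b * c = 1" and g: "\<And>t. \<gamma> t = mob a b c d (vert t)"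
    using assms unfolding is_line_def by blast
  have "\<gamma> = (\<lambda>t. mob a b c d (vert t))" using g by auto
  then show ?thesis using mob_vert_deriv[OF m, of t] by (metis vector_derivative_at)
qed

lemma continuous_on_line: "is_line \<gamma> \<Longrightarrow> continuous_on A \<gamma>"
  by (meson continuous_at_imp_continuous_on has_vector_derivative_continuous line_has_vector_derivative)

lemma continuous_on_tang:
  assumes "is_line \<gamma>"
  shows "continuous_on A (tang \<gamma>)"
proof -
  obtain a b c d where m: "a * d - b * c = 1" and g: "\<And>t. \<gamma> t = mob a b c d (vert t)"
    using assms unfolding is_line_def by blast
  have q: "of_real c * vert t + complex_of_real d \<noteq> 0" for t by (rule mob_denom[OF m vert_in_hplane])
  have v: "continuous_on A vert" unfolding vert_def by (intro continuous_intros)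
  have "continuous_on A (\<lambda>t. (mob a b c d (vert t), vert t / (of_real c * vert t + of_real d)\<^sup>2))"
    unfolding mob_def by (intro continuous_intros v) (use q in auto)
  then show ?thesis by (rule continuous_on_eq) (simp add: tang_mob[OF m g])
qed

lemma tang_shift:
  assumes "is_line \<gamma>"
  shows "tang (\<lambda>t. \<gamma> (t + s)) t = tang \<gamma> (t + s)"
proof -
  have "((\<lambda>t. t + s) has_vector_derivative 1) (at t)"
    by (auto intro!: derivative_eq_intros)
  then have "((\<gamma> \<circ> (\<lambda>t. t + s)) has_vector_derivative 1 *\<^sub>R vector_derivative \<gamma> (at (t + s))) (at t)"
    by (rule vector_diff_chain_at) (rule line_has_vector_derivative[OF assms])
  then show ?thesis by (simp add: tang_def o_def vector_derivative_at)
qed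

text \<open>The geodesic flow on unit tangent vectors, written without the matrix \<open>(a, b; c, d)\<close> of the
  geodesic in order to see its continuity: if \<open>u = c\<i> + d\<close> then \<open>\<i> / snd \<xi> = u\<^sup>2\<close> and
  \<open>Im (fst \<xi>) = 1 / \<bar>u\<bar>\<^sup>2\<close>, so the denominator below is \<open>2u(c\<i>e\<^sup>t + d)\<close>.\<close>

definition hflow_den :: "real \<Rightarrow> complex \<times> complex \<Rightarrow> complex" where
  "hflow_den t \<xi> = \<i> / snd \<xi> * of_real (1 + exp t) + of_real ((1 - exp t) / Im (fst \<xi>))"

definition hflow :: "real \<Rightarrow> complex \<times> complex \<Rightarrow> complex \<times> complex" where
  "hflow t \<xi> = (fst \<xi> + 2 * \<i> * of_real (exp t - 1) / hflow_den t \<xi>,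
     4 * vert t * (\<i> / snd \<xi>) / (hflow_den t \<xi>)\<^sup>2)"

lemma hflow_tang_0:
  assumes "is_line \<gamma>"
  shows "tang \<gamma> t = hflow t (tang \<gamma> 0)" "hflow_den t (tang \<gamma> 0) \<noteq> 0"
proof -
  obtain a b c d where m: "a * d - b * c = 1" and g: "\<And>t. \<gamma> t = mob a b c d (vert t)"
    using assms unfolding is_line_def by blast
  define u where "u = of_real c * \<i> + complex_of_real d"
  define q where "q = of_real c * vert t + complex_of_real d"
  have u: "u \<noteq> 0" and q: "q \<noteq> 0"
    using mob_denom[OF m] by (auto simp: u_def q_def)
  have 0: "tang \<gamma> 0 = (mob a b c d \<i>, \<i> / u\<^sup>2)"
    by (simp add: tang_mob[OF m g] vert_0 u_def)
  have iv: "\<i> / (\<i> / u\<^sup>2) = u * u" using u by (simp add: power2_eq_square)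
  have im: "complex_of_real ((1 - exp t) / Im (mob a b c d \<i>)) = (u * cnj u) * of_real (1 - exp t)"
    unfolding Im_mob[OF m] u_def[symmetric] complex_norm_square[symmetric] by simp
  have den: "hflow_den t (tang \<gamma> 0) = 2 * u * q"
  proof -
    have "hflow_den t (tang \<gamma> 0) = u * (u * of_real (1 + exp t) + cnj u * of_real (1 - exp t))"
      unfolding 0 hflow_den_def fst_conv snd_conv iv im by (simp add: algebra_simps)
    also have "u * of_real (1 + exp t) + cnj u * of_real (1 - exp t) = 2 * q"
      by (simp add: complex_eq_iff u_def q_def vert_def algebra_simps)
    finally show ?thesis by simp
  qed
  then show "hflow_den t (tang \<gamma> 0) \<noteq> 0" using u q by simp
  have "mob a b c d (vert t) = mob a b c d \<i> + (vert t - \<i>) / (q * u)"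
    using mob_diff[OF m vert_in_hplane i_in_hplane, of t] by (simp add: u_def q_def algebra_simps)
  also have "(vert t - \<i>) / (q * u) = 2 * \<i> * of_real (exp t - 1) / (2 * u * q)"
    using u q by (simp add: vert_def field_simps)
  finally have 1: "mob a b c d (vert t) = mob a b c d \<i> + 2 * \<i> * of_real (exp t - 1) / (2 * u * q)" .
  have 2: "vert t / q\<^sup>2 = 4 * vert t * (u * u) / (2 * u * q)\<^sup>2"
    using u q by (simp add: power2_eq_square)
  have "hflow t (tang \<gamma> 0) = (mob a b c d (vert t), vert t / q\<^sup>2)"
    unfolding hflow_def den unfolding 0 fst_conv snd_conv iv 1 2 ..
  then show "tang \<gamma> t = hflow t (tang \<gamma> 0)"
    by (simp add: tang_mob[OF m g] q_def)
qed

lemma hflow_tang: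
  assumes "is_line \<gamma>"
  shows "tang \<gamma> (t + s) = hflow t (tang \<gamma> s)"
  using hflow_tang_0(1)[OF is_line_shift[OF assms, of s], of t] unfolding tang_shift[OF assms] by simp

lemma exists_line_tang:
  assumes "\<xi> \<in> T1_hplane"
  shows "\<exists>\<gamma>. is_line \<gamma> \<and> tang \<gamma> 0 = \<xi>"
proof -
  obtain z v where \<xi>: "\<xi> = (z, v)" "Im z > 0" "cmod v = Im z"
    using assms by (auto simp: T1_hplane_def hplane_def)
  \<comment> \<open>Inverts v = \<open>\<i>\<close> / u^2. The bottom row of the matrix is read off
    from u = c\<open>\<i>\<close> + d and the top row from z u = a\<open>\<i>\<close> + b; the
    determinant is Im z |u|^2 = 1.\<close>
  define u where "u = csqrt (\<i> / v)"
  have v0: "v \<noteq> 0" using \<xi> by auto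
  have u2: "u\<^sup>2 = \<i> / v" by (simp add: u_def)
  have "(cmod u)\<^sup>2 = 1 / Im z" using \<xi> by (simp add: u_def norm_divide)
  then have n: "Im z * (Re u * Re u + Im u * Im u) = 1"
    using \<xi> unfolding cmod_power2 by (simp add: power2_eq_square field_simps)
  define \<gamma> where "\<gamma> t = mob (Im (z * u)) (Re (z * u)) (Im u) (Re u) (vert t)" for t
  have m: "Im (z * u) * Re u - Re (z * u) * Im u = 1"
    using n by (simp add: algebra_simps)
  have ue: "of_real (Im u) * \<i> + of_real (Re u) = u" by (simp add: complex_eq_iff)
  have zue: "of_real (Im (z * u)) * \<i> + of_real (Re (z * u)) = z * u" by (simp add: complex_eq_iff)
  have u0: "u \<noteq> 0" using n by auto
  have "tang \<gamma> 0 = (mob (Im (z * u)) (Re (z * u)) (Im u) (Re u) \<i>, \<i> / u\<^sup>2)"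
    using tang_mob[OF m \<gamma>_def, of 0] by (simp only: vert_0 ue)
  also have "\<i> / u\<^sup>2 = v" using u2 v0 by simp
  also have "mob (Im (z * u)) (Re (z * u)) (Im u) (Re u) \<i> = z"
    unfolding mob_def ue zue using u0 by simp
  finally have "tang \<gamma> 0 = \<xi>" by (simp add: \<xi>)
  moreover have "is_line \<gamma>" using m \<gamma>_def unfolding is_line_def by blast
  ultimately show ?thesis by blast
qed

lemma hflow_in_T1_hplane: "\<xi> \<in> T1_hplane \<Longrightarrow> hflow t \<xi> \<in> T1_hplane"
  using exists_line_tang hflow_tang_0(1) tang_in_T1_hplane by metis

lemma continuous_on_hflow: "continuous_on T1_hplane (hflow t)"
proof -
  have dn: "hflow_den t \<xi> \<noteq> 0" if "\<xi> \<in> T1_hplane" for \<xi>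
    using exists_line_tang[OF that] hflow_tang_0(2) by metis
  have nz: "snd \<xi> \<noteq> 0" "Im (fst \<xi>) \<noteq> 0" if "\<xi> \<in> T1_hplane" for \<xi>
    using that by (auto simp: T1_hplane_def hplane_def)
  have "continuous_on T1_hplane (hflow_den t)"
    unfolding hflow_den_def[abs_def] using nz by (intro continuous_intros) auto
  then show ?thesis
    unfolding hflow_def[abs_def] using nz dn by (intro continuous_intros) auto
qed

subsection \<open>Covering spaces of metric spaces\<close>

text \<open>The library lifts maps into real normed vector spaces only. A metric space embeds
  isometrically into the bounded continuous functions on it (Kuratowski).\<close>

definition kuratowski :: "'a::metric_space \<Rightarrow> 'a \<Rightarrow>\<^sub>C real" where
  "kuratowski x = Bcontfun (\<lambda>y. dist x y - dist undefined y)"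

lemma apply_kuratowski: "apply_bcontfun (kuratowski x) y = dist x y - dist undefined y"
proof -
  have "(\<lambda>y. dist x y - dist undefined y) \<in> bcontfun"
  proof (rule bcontfun_normI)
    show "norm (dist x y - dist undefined y) \<le> dist x undefined" for y
      using abs_dist_diff_le[of x y undefined] by (simp add: dist_commute)
  qed (intro continuous_intros)
  then show ?thesis by (simp add: kuratowski_def Bcontfun_inverse)
qed

lemma dist_kuratowski: "dist (kuratowski x) (kuratowski y) = dist x y"
proof (rule antisym)
  show "dist (kuratowski x) (kuratowski y) \<le> dist x y"
  proof (rule dist_bound)
    show "dist (apply_bcontfun (kuratowski x) z) (apply_bcontfun (kuratowski y) z) \<le> dist x y" for z
      using abs_dist_diff_le[of x z y] by (simp add: apply_kuratowski dist_real_def dist_commute)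
  qed
  have "dist (apply_bcontfun (kuratowski x) y) (apply_bcontfun (kuratowski y) y)
      \<le> dist (kuratowski x) (kuratowski y)"
    by (rule dist_bounded)
  then show "dist x y \<le> dist (kuratowski x) (kuratowski y)"
    by (simp add: apply_kuratowski dist_real_def)
qed

lemma homeomorphism_kuratowski:
  "homeomorphism S (kuratowski ` S) kuratowski (inv_into S kuratowski)"
proof -
  have inj: "inj_on kuratowski S" by (metis dist_eq_0_iff dist_kuratowski inj_onI)
  have c: "continuous_on S kuratowski"
    by (auto simp: continuous_on_iff dist_kuratowski)
  have "continuous_on (kuratowski ` S) (inv_into S kuratowski)"
    unfolding continuous_on_iff
    by (metis (no_types, lifting) dist_kuratowski f_inv_into_f)
  then show ?thesis
    using inj c by (auto simp: homeomorphism_def inv_into_into)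
qed

lemma covering_space_homeomorphism_compose:
  assumes "covering_space c p S" "homeomorphism S S' e e'"
  shows "covering_space c (e \<circ> p) S'"
proof
  have pc: "p ` c = S" "continuous_on c p" using assms(1) by (auto simp: covering_space_def)
  have ee: "e ` S = S'" "continuous_on S e" using assms(2) by (auto simp: homeomorphism_def)
  show "continuous_on c (e \<circ> p)" using pc ee by (intro continuous_on_compose) simp_all
  show "(e \<circ> p) ` c = S'" using pc ee by (metis image_comp)
  fix y assume "y \<in> S'"
  then obtain x where x: "x \<in> S" "y = e x" using ee by auto
  obtain T v where T: "x \<in> T" "openin (top_of_set S) T" "\<Union>v = c \<inter> p -` T"
      "\<forall>u \<in> v. openin (top_of_set c) u" "pairwise disjnt v" "\<forall>u \<in> v. \<exists>q. homeomorphism u T p q"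
    using assms(1) x(1) unfolding covering_space_def by meson
  have TS: "T \<subseteq> S" using T(2) openin_imp_subset by blast
  show "\<exists>T. y \<in> T \<and> openin (top_of_set S') T \<and>
         (\<exists>v. \<Union>v = c \<inter> (e \<circ> p) -` T \<and> (\<forall>u\<in>v. openin (top_of_set c) u) \<and>
              pairwise disjnt v \<and> (\<forall>u\<in>v. \<exists>q. homeomorphism u T (e \<circ> p) q))"
  proof (intro exI[of _ "e ` T"] conjI exI[of _ v] ballI)
    show "y \<in> e ` T" using x T by auto
    show "openin (top_of_set S') (e ` T)"
      using assms(2) T(2) homeomorphism_imp_open_map by blast
    have "inj_on e S" by (metis assms(2) homeomorphism_apply1 inj_on_inverseI)
    then have "e (p y) \<in> e ` T \<longleftrightarrow> p y \<in> T" if "y \<in> c" for y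
      by (rule inj_on_image_mem_iff) (use that pc TS in auto)
    then have "c \<inter> (e \<circ> p) -` (e ` T) = c \<inter> p -` T"
      unfolding set_eq_iff Int_iff vimage_eq comp_apply by blast
    then show "\<Union>v = c \<inter> (e \<circ> p) -` (e ` T)" using T(3) by simp
    fix u assume "u \<in> v"
    then obtain q where "homeomorphism u T p q" using T by blast
    moreover have "homeomorphism T (e ` T) e e'"
      by (rule homeomorphism_of_subsets[OF assms(2)]) (use TS ee in auto)
    ultimately show "\<exists>q. homeomorphism u (e ` T) (e \<circ> p) q"
      using homeomorphism_compose by blast
  qed (use T in auto)
qed

lemma covering_lift_metric:
  fixes p :: "'b::real_normed_vector \<Rightarrow> 'a::metric_space" and f :: "'c::real_normed_vector \<Rightarrow> 'a"
  assumes cov: "covering_space C p S" and a: "a \<in> C" "z \<in> U"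
    and U: "simply_connected U" "locally path_connected U"
    and f: "continuous_on U f" "f ` U \<subseteq> S" "f z = p a"
  shows "\<exists>g. continuous_on U g \<and> g ` U \<subseteq> C \<and> g z = a \<and> (\<forall>y\<in>U. p (g y) = f y)"
proof -
  note h = homeomorphism_kuratowski[of S]
  have cov': "covering_space C (kuratowski \<circ> p) (kuratowski ` S)"
    by (rule covering_space_homeomorphism_compose[OF cov h])
  have "continuous_on S kuratowski" using h by (simp add: homeomorphism_def)
  then have c: "continuous_on U (kuratowski \<circ> f)"
    using f by (metis continuous_on_compose continuous_on_subset)
  have "kuratowski \<circ> f \<in> U \<rightarrow> kuratowski ` S" using f(2) by auto
  moreover have "(kuratowski \<circ> f) z = (kuratowski \<circ> p) a" using f(3) by simp
  ultimately obtain g where g: "continuous_on U g" "g \<in> U \<rightarrow> C" "g z = a"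
      "\<And>y. y \<in> U \<Longrightarrow> (kuratowski \<circ> p) (g y) = (kuratowski \<circ> f) y"
    using covering_space_lift_strong[OF cov' a U c] by blast
  have "p (g y) = f y" if "y \<in> U" for y
    using g(4)[OF that] by (metis comp_apply dist_eq_0_iff dist_kuratowski)
  then show ?thesis using g by (intro exI[of _ g]) auto
qed

lemma covering_lift_homotopy_metric:
  fixes p :: "'b::real_normed_vector \<Rightarrow> 'a::metric_space"
    and h :: "real \<times> 'c::real_normed_vector \<Rightarrow> 'a"
  assumes cov: "covering_space C p S"
    and h: "continuous_on ({0..1} \<times> U) h" "h ` ({0..1} \<times> U) \<subseteq> S"
    and f: "\<And>y. y \<in> U \<Longrightarrow> h (0, y) = p (f y)" "continuous_on U f" "f ` U \<subseteq> C"
  shows "\<exists>k. continuous_on ({0..1} \<times> U) k \<and> k ` ({0..1} \<times> U) \<subseteq> C \<and>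
    (\<forall>y\<in>U. k (0, y) = f y) \<and> (\<forall>z\<in>{0..1} \<times> U. p (k z) = h z)"
proof -
  note e = homeomorphism_kuratowski[of S]
  have cov': "covering_space C (kuratowski \<circ> p) (kuratowski ` S)"
    by (rule covering_space_homeomorphism_compose[OF cov e])
  have "continuous_on S kuratowski" using e by (simp add: homeomorphism_def)
  then have c: "continuous_on ({0..1} \<times> U) (kuratowski \<circ> h)"
    using h by (metis continuous_on_compose continuous_on_subset)
  have i: "kuratowski \<circ> h \<in> {0..1} \<times> U \<rightarrow> kuratowski ` S" using h(2) by (auto simp: image_subset_iff)
  have s: "(kuratowski \<circ> h) (0, y) = (kuratowski \<circ> p) (f y)" if "y \<in> U" for y
    using f(1)[OF that] by simp
  have fi: "f \<in> U \<rightarrow> C" using f(3) by auto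
  obtain k where k: "continuous_on ({0..1} \<times> U) k" "k \<in> {0..1} \<times> U \<rightarrow> C"
      "\<And>y. y \<in> U \<Longrightarrow> k (0, y) = f y"
      "\<And>z. z \<in> {0..1} \<times> U \<Longrightarrow> (kuratowski \<circ> h) z = (kuratowski \<circ> p) (k z)"
    using covering_space_lift_homotopy[OF cov' c i s f(2) fi] by blast
  have "p (k z) = h z" if "z \<in> {0..1} \<times> U" for z
    using k(4)[OF that] by (metis comp_apply dist_eq_0_iff dist_kuratowski)
  then show ?thesis using k by (intro exI[of _ k]) auto
qed

lemma hdist_small_imp_close:
  assumes z: "z \<in> hplane" and "\<delta> > 0"
  shows "\<exists>e>0. \<forall>a\<in>hplane. hdist z a < e \<longrightarrow> cmod (z - a) < \<delta>"
proof -
  have y: "Im z > 0" using z by (simp add: hplane_def)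
  \<comment> \<open>If |z - a| = D then Im a is at most Im z + D, so cosh of the distance is at
    least 1 + D^2 / (2 Im z (Im z + D)). This increases with D, and \<open>M\<close> is its value at
    D = \<delta>.\<close>
  define M where "M = 1 + \<delta>\<^sup>2 / (2 * Im z * (Im z + \<delta>))"
  have M: "M > 1" using y \<open>\<delta> > 0\<close> by (simp add: M_def)
  have "cmod (z - a) < \<delta>" if a: "a \<in> hplane" "hdist z a < arcosh M" for a
  proof (rule ccontr)
    define D where "D = cmod (z - a)"
    assume "\<not> cmod (z - a) < \<delta>"
    then have D: "\<delta> \<le> D" by (simp add: D_def)
    have ya: "Im a > 0" using a by (simp add: hplane_def)
    have "Im a \<le> Im z + D" using abs_Im_le_cmod[of "z - a"] by (simp add: D_def abs_le_iff)
    have "\<delta>\<^sup>2 * (Im z + D) \<le> D\<^sup>2 * (Im z + \<delta>)"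
    proof -
      have "\<delta>\<^sup>2 \<le> D\<^sup>2" using D \<open>\<delta> > 0\<close> by (intro power_mono) auto
      then have "\<delta>\<^sup>2 * Im z \<le> D\<^sup>2 * Im z" using y by (intro mult_right_mono) auto
      moreover have "\<delta> * \<delta> * D \<le> D * D * \<delta>"
        using D \<open>\<delta> > 0\<close> by (simp add: mult_left_mono mult_right_mono mult.assoc mult.commute)
      ultimately show ?thesis by (simp add: power2_eq_square algebra_simps)
    qed
    then have "\<delta>\<^sup>2 / (Im z + \<delta>) \<le> D\<^sup>2 / (Im z + D)"
      using y D \<open>\<delta> > 0\<close> by (simp add: frac_le_eq divide_le_eq pos_divide_le_eq field_simps)
    also have "\<dots> \<le> D\<^sup>2 / Im a"
      using \<open>Im a \<le> Im z + D\<close> ya by (intro divide_left_mono) (auto intro: mult_pos_pos)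
    finally have 1: "\<delta>\<^sup>2 / (Im z + \<delta>) \<le> D\<^sup>2 / Im a" .
    have "M = 1 + \<delta>\<^sup>2 / (Im z + \<delta>) / (2 * Im z)" by (simp add: M_def mult_ac)
    also have "\<dots> \<le> 1 + D\<^sup>2 / Im a / (2 * Im z)"
      using y by (intro add_left_mono divide_right_mono 1) auto
    also have "\<dots> = cosh (hdist z a)"
      by (simp add: cosh_hdist[OF z a(1)] D_def mult_ac)
    finally have "arcosh M \<le> hdist z a"
      using M hdist_nonneg[OF z a(1)] by (metis arcosh_cosh_real arcosh_less_iff_real cosh_real_ge_1 less_imp_le not_le)
    then show False using a by simp
  qed
  moreover have "arcosh M > 0" using M by simp
  ultimately show ?thesis by blast
qed

text \<open>Invariance of the distance says |g w - g z|^2 / |w - z|^2 = Im (g w) Im (g z) / (Im w Im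
  z); let w tend to z.\<close>

lemma isometry_deriv_norm:
  assumes hol: "g holomorphic_on hplane" and im: "\<And>z. z \<in> hplane \<Longrightarrow> g z \<in> hplane"
    and iso: "\<And>z w. z \<in> hplane \<Longrightarrow> w \<in> hplane \<Longrightarrow> hdist (g z) (g w) = hdist z w"
    and z: "z \<in> hplane"
  shows "cmod (deriv g z) = Im (g z) / Im z"
proof -
  have D: "(g has_field_derivative deriv g z) (at z)"
    using hol z open_hplane holomorphic_derivI by blast
  have y: "Im z > 0" "Im (g z) > 0" using z im[OF z] by (auto simp: hplane_def)
  have L1: "((\<lambda>w. (cmod ((g w - g z) / (w - z)))\<^sup>2) \<longlongrightarrow> (cmod (deriv g z))\<^sup>2) (at z)"
    using D unfolding has_field_derivative_iff by (intro tendsto_intros)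
  have "isCont g z" using D DERIV_isCont by blast
  then have gz: "(g \<longlongrightarrow> g z) (at z)" by (simp add: isCont_def)
  have L2: "((\<lambda>w. Im (g w) * Im (g z) / (Im w * Im z)) \<longlongrightarrow> Im (g z) * Im (g z) / (Im z * Im z)) (at z)"
    using y by (intro tendsto_intros gz) auto
  have "eventually (\<lambda>w. w \<in> hplane) (at z)"
    using z open_hplane eventually_at_topological by blast
  moreover have "eventually (\<lambda>w. w \<noteq> z) (at z)" by (rule eventually_neq_at_within)
  ultimately have ev: "eventually (\<lambda>w. Im (g w) * Im (g z) / (Im w * Im z) = (cmod ((g w - g z) / (w - z)))\<^sup>2) (at z)"
  proof eventually_elim
    case (elim w)
    have yw: "Im w > 0" "Im (g w) > 0" using elim im[OF elim(1)] by (auto simp: hplane_def)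
    have "1 + (cmod (g w - g z))\<^sup>2 / (2 * Im (g w) * Im (g z)) = 1 + (cmod (w - z))\<^sup>2 / (2 * Im w * Im z)"
      using cosh_hdist[OF elim(1) z] cosh_hdist[OF im[OF elim(1)] im[OF z]] iso[OF elim(1) z] by simp
    then have "(cmod (g w - g z))\<^sup>2 * (Im w * Im z) = (cmod (w - z))\<^sup>2 * (Im (g w) * Im (g z))"
      using y yw by (simp add: frac_eq_eq)
    moreover have "(cmod (w - z))\<^sup>2 \<noteq> 0" using elim by simp
    ultimately show ?case using y yw
      by (simp add: norm_divide power_divide frac_eq_eq mult_ac)
  qed
  have "(cmod (deriv g z))\<^sup>2 = Im (g z) * Im (g z) / (Im z * Im z)"
    using tendsto_unique[OF _ L1 tendsto_cong[THEN iffD1, OF ev L2]] by simp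
  then have "(cmod (deriv g z))\<^sup>2 = (Im (g z) / Im z)\<^sup>2" by (simp add: power2_eq_square)
  then show ?thesis
    using y by (subst (asm) power2_eq_iff_nonneg) auto
qed

subsection \<open>Hyperbolic surfaces and their geodesics\<close>

definition dact :: "(complex \<Rightarrow> complex) \<Rightarrow> complex \<times> complex \<Rightarrow> complex \<times> complex" where
  "dact g \<xi> = (g (fst \<xi>), deriv g (fst \<xi>) * snd \<xi>)"

lemma T1_proj_eq: "T1_proj p \<xi> = (\<lambda>g. dact g \<xi>) ` deck p"
  by (cases \<xi>) (auto simp: T1_proj_def dact_def)

text \<open>Deck maps are determined on \<open>hplane\<close> only; their derivatives agree there
  because \<open>hplane\<close> is open.\<close>

lemma dact_cong:
  assumes "\<And>z. z \<in> hplane \<Longrightarrow> g z = h z" "\<xi> \<in> T1_hplane"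
  shows "dact g \<xi> = dact h \<xi>"
proof -
  have z: "fst \<xi> \<in> hplane" using assms(2) by (auto simp: T1_hplane_def)
  have "eventually (\<lambda>w. w \<in> hplane) (nhds (fst \<xi>))"
    using z open_hplane eventually_nhds by blast
  then have "eventually (\<lambda>w. g w = h w) (nhds (fst \<xi>))"
    by (rule eventually_mono) (rule assms(1))
  then have "deriv g (fst \<xi>) = deriv h (fst \<xi>)" by (rule deriv_cong_ev) simp
  then show ?thesis using assms(1)[OF z] by (simp add: dact_def)
qed

locale hyp_surface =
  fixes S :: "'a::metric_space set" and p :: "complex \<Rightarrow> 'a"
  assumes surf: "closed_hyperbolic_surface S p"
begin

lemma compact_S: "compact S" and covering: "covering_space hplane p S"
  using surf by (auto simp: closed_hyperbolic_surface_def)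

lemma p_image: "p ` hplane = S" and continuous_on_p: "continuous_on hplane p"
  using covering by (auto simp: covering_space_def)

lemma p_in_S: "z \<in> hplane \<Longrightarrow> p z \<in> S"
  using p_image by blast

lemma exists_lift: "x \<in> S \<Longrightarrow> \<exists>z\<in>hplane. p z = x"
  using p_image by blast

lemma deck_isometry:
  assumes "g \<in> deck p"
  shows "g holomorphic_on hplane" "\<And>z. z \<in> hplane \<Longrightarrow> g z \<in> hplane"
    "\<And>z w. z \<in> hplane \<Longrightarrow> w \<in> hplane \<Longrightarrow> hdist (g z) (g w) = hdist z w"
    "\<And>z. z \<in> hplane \<Longrightarrow> p (g z) = p z" "continuous_on hplane g"
proof -
  have "oriented_hisometry g" using assms surf by (simp add: closed_hyperbolic_surface_def)
  then show "g holomorphic_on hplane" "\<And>z. z \<in> hplane \<Longrightarrow> g z \<in> hplane"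
    "\<And>z w. z \<in> hplane \<Longrightarrow> w \<in> hplane \<Longrightarrow> hdist (g z) (g w) = hdist z w"
    by (auto simp: oriented_hisometry_def bij_betw_def)
  then show "continuous_on hplane g" by (simp add: holomorphic_on_imp_continuous_on)
  show "\<And>z. z \<in> hplane \<Longrightarrow> p (g z) = p z" using assms by (simp add: deck_def)
qed

lemma lift_unique:
  fixes g1 g2 :: "'c::topological_space \<Rightarrow> complex"
  assumes "connected T" "a \<in> T" "g1 a = g2 a"
    and "continuous_on T g1" "g1 ` T \<subseteq> hplane" "continuous_on T g2" "g2 ` T \<subseteq> hplane"
    and "\<And>x. x \<in> T \<Longrightarrow> p (g1 x) = p (g2 x)" "x \<in> T"
  shows "g1 x = g2 x"
proof (rule covering_space_lift_unique[of hplane p S g1 a g2 T "\<lambda>x. p (g1 x)" x, OF covering assms(3)])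
  show "continuous_on T (\<lambda>x. p (g1 x))"
    using continuous_on_compose2[OF continuous_on_p assms(4,5)] .
qed (use assms p_in_S in auto)

lemma deck_unique:
  assumes "g \<in> deck p" "h \<in> deck p" "z \<in> hplane" "g z = h z" "w \<in> hplane"
  shows "g w = h w"
  using deck_isometry[OF assms(1)] deck_isometry[OF assms(2)] assms
  by (intro lift_unique[of hplane z g h w]) (auto intro: convex_connected convex_hplane)

text \<open>The plane is simply connected, so \<open>p\<close> lifts through itself with z -> w and
  with w -> z; by uniqueness of lifts the two maps are mutually inverse.\<close>

lemma deck_trans:
  assumes "z \<in> hplane" "w \<in> hplane" "p z = p w"
  shows "\<exists>g\<in>deck p. g z = w"
proof -
  have sc: "simply_connected hplane" "locally path_connected hplane"
    using convex_hplane convex_imp_simply_connected convex_imp_locally_path_connected by blast+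
  have ex: "\<exists>g. continuous_on hplane g \<and> g ` hplane \<subseteq> hplane \<and> g z = w \<and> (\<forall>y\<in>hplane. p (g y) = p y)"
    if "z \<in> hplane" "w \<in> hplane" "p z = p w" for z w
    by (rule covering_lift_metric[OF covering _ _ sc continuous_on_p]) (use that p_image in auto)
  obtain g where g: "continuous_on hplane g" "g ` hplane \<subseteq> hplane" "g z = w" "\<forall>y\<in>hplane. p (g y) = p y"
    using ex[OF assms] by (elim exE conjE)
  obtain h where h: "continuous_on hplane h" "h ` hplane \<subseteq> hplane" "h w = z" "\<forall>y\<in>hplane. p (h y) = p y"
    using ex[OF assms(2,1) assms(3)[symmetric]] by (elim exE conjE)
  have inv: "h (g y) = y"
    if "continuous_on hplane g" "g ` hplane \<subseteq> hplane" "g z = w" "\<forall>y\<in>hplane. p (g y) = p y"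
       "continuous_on hplane h" "h ` hplane \<subseteq> hplane" "h w = z" "\<forall>y\<in>hplane. p (h y) = p y"
       "z \<in> hplane" "y \<in> hplane" for g h z w y
  proof -
    have "(h \<circ> g) y = id y"
    proof (rule lift_unique[of hplane z "h \<circ> g" id y])
      show "continuous_on hplane (h \<circ> g)"
        using that by (metis continuous_on_compose continuous_on_subset)
    qed (use that in \<open>auto intro: convex_connected convex_hplane\<close>)
    then show ?thesis by simp
  qed
  have "homeomorphism hplane hplane g h"
    unfolding homeomorphism_def using inv[OF g h assms(1)] inv[OF h g assms(2)] g h
    by (auto simp: image_subset_iff) (metis image_eqI)+
  then have "g \<in> deck p" using g by (auto simp: deck_def)
  then show ?thesis using g by blast
qed

lemma deck_compose:
  assumes "g \<in> deck p" "h \<in> deck p"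
  shows "h \<circ> g \<in> deck p"
proof -
  obtain g' h' where "homeomorphism hplane hplane g g'" "homeomorphism hplane hplane h h'"
    using assms by (auto simp: deck_def)
  then have "homeomorphism hplane hplane (h \<circ> g) (g' \<circ> h')" by (rule homeomorphism_compose)
  then show ?thesis
    using deck_isometry[OF assms(1)] deck_isometry[OF assms(2)] by (auto simp: deck_def)
qed

lemma deck_inverse:
  assumes "g \<in> deck p"
  shows "\<exists>h\<in>deck p. \<forall>z\<in>hplane. h (g z) = z \<and> g (h z) = z"
proof -
  obtain h where h: "homeomorphism hplane hplane g h" using assms by (auto simp: deck_def)
  have "p (h z) = p z" if "z \<in> hplane" for z
  proof -
    have "h z \<in> hplane" using h that by (auto simp: homeomorphism_def)
    then show ?thesis
      using deck_isometry(4)[OF assms, of "h z"] h that by (simp add: homeomorphism_def)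
  qed
  then have "h \<in> deck p" unfolding deck_def using homeomorphism_symD[OF h] by blast
  then show ?thesis using h by (auto simp: homeomorphism_def)
qed

lemma id_deck: "(\<lambda>z. z) \<in> deck p"
  unfolding deck_def using homeomorphism_ident[of hplane] by (auto simp: id_def)

lemma locally_injective:
  assumes z: "z \<in> hplane"
  shows "\<exists>e>0. \<forall>a\<in>hplane. \<forall>b\<in>hplane. hdist z a < e \<longrightarrow> hdist z b < e \<longrightarrow> p a = p b \<longrightarrow> a = b"
proof -
  obtain T u q where T: "z \<in> T" "openin (top_of_set hplane) T" "p z \<in> u"
      "openin (top_of_set S) u" "homeomorphism T u p q"
    by (rule covering_space_local_homeomorphism[OF covering z])
  have "open T" using T(2) open_hplane openin_open_eq by blast
  then obtain d where d: "d > 0" "ball z d \<subseteq> T" using T(1) open_contains_ball by blast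
  obtain e where e: "e > 0" "\<forall>a\<in>hplane. hdist z a < e \<longrightarrow> cmod (z - a) < d"
    using hdist_small_imp_close[OF z d(1)] by blast
  have "a = b" if "a \<in> hplane" "b \<in> hplane" "hdist z a < e" "hdist z b < e" "p a = p b" for a b
  proof -
    have "a \<in> T" "b \<in> T" using that e d(2) by (auto simp: dist_norm subset_iff)
    then show ?thesis using T(5) that(5) by (metis homeomorphism_apply1)
  qed
  with e(1) show ?thesis by blast
qed

lemma locally_isometric:
  assumes z: "z \<in> hplane"
  shows "\<exists>e>0. \<forall>a\<in>hplane. \<forall>b\<in>hplane. hdist z a < e \<longrightarrow> hdist z b < e \<longrightarrow> dist (p a) (p b) = hdist a b"
proof -
  obtain e where e: "e > 0" "\<And>a b. a \<in> hplane \<Longrightarrow> b \<in> hplane \<Longrightarrow> hdist z a < e \<Longrightarrow> hdist z b < e \<Longrightarrow> p a = p b \<Longrightarrow> a = b"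
    using locally_injective[OF z] by blast
  \<comment> \<open>The distance in S is an infimum over a fibre. With radius e/3, any point of the
    fibre closer to \<open>a\<close> than \<open>b\<close> would lie within e of \<open>z\<close>,
    where \<open>p\<close> is injective.\<close>
  have "dist (p a) (p b) = hdist a b"
    if a: "a \<in> hplane" "hdist z a < e/3" and b: "b \<in> hplane" "hdist z b < e/3" for a b
  proof -
    have ab: "hdist a b < 2 * e / 3"
      using hdist_triangle[OF a(1) z b(1)] a b by (simp add: hdist_commute)
    have "dist (p a) (p b) = (INF u\<in>{u\<in>hplane. p u = p b}. hdist a u)"
      using surf a b by (auto simp: closed_hyperbolic_surface_def)
    also have "\<dots> = hdist a b"
    proof (rule cInf_eq_minimum)
      show "hdist a b \<in> hdist a ` {u \<in> hplane. p u = p b}" using b by auto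
      fix x assume "x \<in> hdist a ` {u \<in> hplane. p u = p b}"
      then obtain u where u: "u \<in> hplane" "p u = p b" "x = hdist a u" by auto
      show "hdist a b \<le> x"
      proof (rule ccontr)
        assume "\<not> hdist a b \<le> x"
        then have "hdist z u < e"
          using hdist_triangle[OF z a(1) u(1)] ab a u(3) by simp
        then have "u = b" using e(2) u b e(1) by auto
        then show False using u \<open>\<not> hdist a b \<le> x\<close> by simp
      qed
    qed
    finally show ?thesis .
  qed
  then show ?thesis using e(1) by (intro exI[of _ "e/3"]) auto
qed

lemma line_is_geodesic:
  assumes "is_line c"
  shows "is_geodesic S (\<lambda>t. p (c t))"
  unfolding is_geodesic_def
proof (intro conjI allI)
  show "range (\<lambda>t. p (c t)) \<subseteq> S" using line_in_hplane[OF assms] p_in_S by auto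
  fix t
  obtain e where e: "e > 0" "\<forall>a\<in>hplane. \<forall>b\<in>hplane. hdist (c t) a < e \<longrightarrow> hdist (c t) b < e \<longrightarrow> dist (p a) (p b) = hdist a b"
    using locally_isometric[OF line_in_hplane[OF assms]] by blast
  then show "\<exists>e>0. \<forall>r\<in>ball t e. \<forall>s\<in>ball t e. dist (p (c r)) (p (c s)) = dist r s"
    using line_in_hplane[OF assms] by (intro exI[of _ e]) (auto simp: hdist_line[OF assms] dist_real_def)
qed

lemma geodesic_continuous: "is_geodesic S \<gamma> \<Longrightarrow> continuous_on UNIV \<gamma>"
  unfolding continuous_on_iff
proof (intro ballI allI impI)
  fix t e :: real assume g: "is_geodesic S \<gamma>" and "e > 0"
  obtain d where d: "d > 0" "\<forall>r\<in>ball t d. \<forall>s\<in>ball t d. dist (\<gamma> r) (\<gamma> s) = dist r s"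
    using g unfolding is_geodesic_def by meson
  then show "\<exists>d>0. \<forall>t'\<in>UNIV. dist t' t < d \<longrightarrow> dist (\<gamma> t') (\<gamma> t) < e"
    using \<open>e > 0\<close> by (intro exI[of _ "min d e"]) (auto simp: dist_commute)
qed

lemma geodesic_has_lift:
  assumes "is_geodesic S \<gamma>" "z \<in> hplane" "p z = \<gamma> 0"
  shows "\<exists>c. is_curve_lift p \<gamma> c \<and> c 0 = z"
proof -
  have "\<exists>c. continuous_on UNIV c \<and> c ` UNIV \<subseteq> hplane \<and> c 0 = z \<and> (\<forall>y\<in>UNIV. p (c y) = \<gamma> y)"
  proof (rule covering_lift_metric[OF covering assms(2)])
    show "simply_connected (UNIV :: real set)" "locally path_connected (UNIV :: real set)"
      using convex_UNIV convex_imp_simply_connected convex_imp_locally_path_connected by blast+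
  qed (use assms geodesic_continuous in \<open>auto simp: is_geodesic_def\<close>)
  then show ?thesis by (auto simp: is_curve_lift_def)
qed

lemma geodesic_lift_is_line:
  assumes g: "is_geodesic S \<gamma>" and c: "is_curve_lift p \<gamma> c"
  shows "is_line c"
proof (rule local_isometry_is_line)
  show h: "c t \<in> hplane" for t using c by (auto simp: is_curve_lift_def)
  fix t
  obtain d where d: "d > 0" "\<forall>r\<in>ball t d. \<forall>s\<in>ball t d. dist (\<gamma> r) (\<gamma> s) = dist r s"
    using g unfolding is_geodesic_def by meson
  obtain e where e: "e > 0" "\<forall>a\<in>hplane. \<forall>b\<in>hplane. hdist (c t) a < e \<longrightarrow> hdist (c t) b < e \<longrightarrow> dist (p a) (p b) = hdist a b"
    using locally_isometric[OF h] by blast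
  have "continuous_on UNIV (\<lambda>s. hdist (c t) (c s))"
    using c by (intro continuous_intros) (auto simp: is_curve_lift_def)
  then obtain d' where d': "d' > 0" "\<forall>s. dist s t < d' \<longrightarrow> dist (hdist (c t) (c s)) (hdist (c t) (c t)) < e"
    using e(1) unfolding continuous_on_iff by (metis UNIV_I)
  have "hdist (c r) (c s) = dist r s" if "r \<in> ball t (min d d')" "s \<in> ball t (min d d')" for r s
  proof -
    have "hdist (c t) (c r) < e" "hdist (c t) (c s) < e"
      using that d'(2) by (auto simp: dist_commute dist_real_def)
    then have "dist (p (c r)) (p (c s)) = hdist (c r) (c s)" using e(2) h by blast
    then have "hdist (c r) (c s) = dist (\<gamma> r) (\<gamma> s)" using c by (simp add: is_curve_lift_def)
    then show ?thesis using that d(2) by simp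
  qed
  then show "\<exists>e>0. \<forall>r\<in>ball t e. \<forall>s\<in>ball t e. hdist (c r) (c s) = dist r s"
    using d(1) d'(1) by (intro exI[of _ "min d d'"]) auto
qed

lemma curve_lift_deck:
  assumes "is_curve_lift p \<gamma> c" "is_curve_lift p \<gamma> c'"
  shows "\<exists>g\<in>deck p. \<forall>t. c' t = g (c t)"
proof -
  have c: "c t \<in> hplane" "c' t \<in> hplane" "p (c t) = p (c' t)" for t
    using assms by (auto simp: is_curve_lift_def)
  obtain g where g: "g \<in> deck p" "g (c 0) = c' 0" using deck_trans[OF c] by blast
  have "g (c t) = c' t" for t
  proof (rule lift_unique[of UNIV 0 "\<lambda>t. g (c t)" c' t])
    show "continuous_on UNIV (\<lambda>t. g (c t))"
      using assms(1) c continuous_on_compose2[OF deck_isometry(5)[OF g(1)], of UNIV c]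
      by (auto simp: is_curve_lift_def)
  qed (use g c deck_isometry[OF g(1)] assms(2) in \<open>auto simp: is_curve_lift_def\<close>)
  then show ?thesis using g by metis
qed

lemma line_is_curve_lift: "is_line c \<Longrightarrow> is_curve_lift p (\<lambda>t. p (c t)) c"
  using continuous_on_line line_in_hplane by (auto simp: is_curve_lift_def)

lemma is_line_deck: "is_line c \<Longrightarrow> g \<in> deck p \<Longrightarrow> is_line (\<lambda>t. g (c t))"
  by (rule is_line_isometry) (simp_all add: deck_isometry)

section \<open>The deck action on unit tangent vectors\<close>

lemma dact_T1_hplane:
  assumes "g \<in> deck p" "\<xi> \<in> T1_hplane"
  shows "dact g \<xi> \<in> T1_hplane"
proof -
  obtain z v where \<xi>: "\<xi> = (z, v)" "z \<in> hplane" "cmod v = Im z"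
    using assms(2) by (auto simp: T1_hplane_def)
  have "cmod (deriv g z) = Im (g z) / Im z"
    using deck_isometry[OF assms(1)] \<xi> by (intro isometry_deriv_norm) auto
  then show ?thesis
    using \<xi> deck_isometry(2)[OF assms(1)] by (auto simp: T1_hplane_def dact_def norm_mult hplane_def)
qed

lemma dact_compose:
  assumes "g \<in> deck p" "h \<in> deck p" "\<xi> \<in> T1_hplane"
  shows "dact h (dact g \<xi>) = dact (h \<circ> g) \<xi>"
proof -
  have z: "fst \<xi> \<in> hplane" using assms(3) by (auto simp: T1_hplane_def)
  have "g field_differentiable at (fst \<xi>)" "h field_differentiable at (g (fst \<xi>))"
    using deck_isometry(1,2)[OF assms(1)] deck_isometry(1)[OF assms(2)] z open_hplane
    by (meson holomorphic_on_imp_differentiable_at)+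
  then have "deriv (h \<circ> g) (fst \<xi>) = deriv h (g (fst \<xi>)) * deriv g (fst \<xi>)"
    by (rule deriv_chain)
  then show ?thesis by (simp add: dact_def mult.assoc)
qed

lemma T1_proj_eq_iff:
  assumes "\<xi> \<in> T1_hplane" "\<eta> \<in> T1_hplane"
  shows "T1_proj p \<xi> = T1_proj p \<eta> \<longleftrightarrow> (\<exists>g\<in>deck p. dact g \<xi> = \<eta>)"
proof
  assume eq: "T1_proj p \<xi> = T1_proj p \<eta>"
  have "dact (\<lambda>z. z) \<eta> = \<eta>" by (simp add: dact_def)
  then have "\<eta> \<in> T1_proj p \<eta>" using id_deck unfolding T1_proj_eq by force
  then have "\<eta> \<in> T1_proj p \<xi>" using eq by simp
  then show "\<exists>g\<in>deck p. dact g \<xi> = \<eta>" unfolding T1_proj_eq by blast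
next
  have sub: "T1_proj p (dact g \<xi>) \<subseteq> T1_proj p \<xi>" if "g \<in> deck p" "\<xi> \<in> T1_hplane" for g \<xi>
  proof
    fix \<zeta> assume "\<zeta> \<in> T1_proj p (dact g \<xi>)"
    then obtain h where "h \<in> deck p" "\<zeta> = dact h (dact g \<xi>)" unfolding T1_proj_eq by blast
    then have "\<zeta> = dact (h \<circ> g) \<xi>" "h \<circ> g \<in> deck p" using dact_compose deck_compose that by auto
    then show "\<zeta> \<in> T1_proj p \<xi>" unfolding T1_proj_eq by blast
  qed
  assume "\<exists>g\<in>deck p. dact g \<xi> = \<eta>"
  then obtain g where g: "g \<in> deck p" "dact g \<xi> = \<eta>" by blast
  obtain h where h: "h \<in> deck p" "\<forall>z\<in>hplane. h (g z) = z \<and> g (h z) = z"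
    using deck_inverse[OF g(1)] by blast
  have "dact h \<eta> = dact (h \<circ> g) \<xi>" using g(2) dact_compose[OF g(1) h(1) assms(1)] by simp
  also have "\<dots> = dact (\<lambda>z. z) \<xi>" by (rule dact_cong) (use h assms in auto)
  also have "\<dots> = \<xi>" by (simp add: dact_def)
  finally have "dact h \<eta> = \<xi>" .
  then show "T1_proj p \<xi> = T1_proj p \<eta>"
    using sub[OF g(1) assms(1)] sub[OF h(1) assms(2)] g(2) by simp
qed

lemma tang_deck:
  assumes "is_line c" "g \<in> deck p"
  shows "tang (\<lambda>t. g (c t)) t = dact g (tang c t)"
proof -
  have z: "c t \<in> hplane" by (rule line_in_hplane[OF assms(1)])
  have "(g has_field_derivative deriv g (c t)) (at (c t))"
    using deck_isometry(1)[OF assms(2)] z open_hplane holomorphic_derivI by blast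
  from field_vector_diff_chain_at[OF line_has_vector_derivative[OF assms(1)] this]
  have "((\<lambda>t. g (c t)) has_vector_derivative vector_derivative c (at t) * deriv g (c t)) (at t)"
    by (simp add: o_def)
  then show ?thesis by (simp add: tang_def dact_def vector_derivative_at mult.commute)
qed

lemma velocity_lift:
  assumes "is_geodesic S \<gamma>" "is_curve_lift p \<gamma> c"
  shows "velocity p \<gamma> t = T1_proj p (tang c t)"
proof -
  define c' where "c' = (SOME c. is_curve_lift p \<gamma> c)"
  have c': "is_curve_lift p \<gamma> c'" unfolding c'_def using someI[of "is_curve_lift p \<gamma>", OF assms(2)] .
  obtain g where g: "g \<in> deck p" "\<forall>t. c' t = g (c t)" using curve_lift_deck[OF assms(2) c'] by blast
  have l: "is_line c" "is_line c'" using geodesic_lift_is_line assms c' by auto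
  have "c' = (\<lambda>t. g (c t))" using g by auto
  then have "tang c' t = dact g (tang c t)" using tang_deck[OF l(1) g(1)] by simp
  then have "T1_proj p (tang c t) = T1_proj p (tang c' t)"
    using T1_proj_eq_iff[OF tang_in_T1_hplane[OF l(1)] tang_in_T1_hplane[OF l(2)]] g(1) by metis
  then show ?thesis by (simp add: velocity_def c'_def[symmetric] tang_def Let_def)
qed

lemma velocity_line: "is_line c \<Longrightarrow> velocity p (\<lambda>t. p (c t)) t = T1_proj p (tang c t)"
  by (rule velocity_lift[OF line_is_geodesic line_is_curve_lift])

lemma hflow_dact:
  assumes "g \<in> deck p" "\<xi> \<in> T1_hplane"
  shows "hflow t (dact g \<xi>) = dact g (hflow t \<xi>)"
proof -
  obtain c where c: "is_line c" "tang c 0 = \<xi>" using exists_line_tang[OF assms(2)] by blast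
  have "tang (\<lambda>t. g (c t)) t = hflow t (tang (\<lambda>t. g (c t)) 0)"
    using hflow_tang_0(1)[OF is_line_deck[OF c(1) assms(1)]] .
  then show ?thesis
    using c hflow_tang_0(1)[OF c(1), of t] by (simp add: tang_deck[OF c(1) assms(1)])
qed

text \<open>Uniqueness behind the definite description: lifts of two geodesics with equal initial
  velocity have initial vectors that differ by a deck transformation, and \<open>hflow\<close>
  commutes with it.\<close>

lemma geodesic_flow_proj:
  assumes "\<xi> \<in> T1_hplane"
  shows "geodesic_flow S p t (T1_proj p \<xi>) = T1_proj p (hflow t \<xi>)"
  unfolding geodesic_flow_def
proof (rule the_equality)
  obtain c where c: "is_line c" "tang c 0 = \<xi>" using exists_line_tang[OF assms] by blast
  then show "\<exists>\<gamma>. is_geodesic S \<gamma> \<and> velocity p \<gamma> 0 = T1_proj p \<xi> \<and> velocity p \<gamma> t = T1_proj p (hflow t \<xi>)"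
    using line_is_geodesic velocity_line hflow_tang_0(1) by metis
next
  fix \<eta> assume "\<exists>\<gamma>. is_geodesic S \<gamma> \<and> velocity p \<gamma> 0 = T1_proj p \<xi> \<and> velocity p \<gamma> t = \<eta>"
  then obtain \<gamma> where g: "is_geodesic S \<gamma>" "velocity p \<gamma> 0 = T1_proj p \<xi>" "velocity p \<gamma> t = \<eta>" by blast
  have "\<gamma> 0 \<in> S" using g by (auto simp: is_geodesic_def)
  then obtain c where c: "is_curve_lift p \<gamma> c"
    using exists_lift geodesic_has_lift[OF g(1)] by blast
  have l: "is_line c" using geodesic_lift_is_line[OF g(1) c] .
  note T = tang_in_T1_hplane[OF l]
  have "T1_proj p \<xi> = T1_proj p (tang c 0)" using g velocity_lift[OF g(1) c] by simp
  then obtain h where h: "h \<in> deck p" "dact h \<xi> = tang c 0" using T1_proj_eq_iff[OF assms T] by blast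
  have "tang c t = dact h (hflow t \<xi>)"
    using hflow_tang_0(1)[OF l] hflow_dact[OF h(1) assms] h(2) by metis
  then have "T1_proj p (hflow t \<xi>) = T1_proj p (tang c t)"
    using T1_proj_eq_iff[OF hflow_in_T1_hplane[OF assms] T] h(1) by metis
  then show "\<eta> = T1_proj p (hflow t \<xi>)" using g velocity_lift[OF g(1) c] by simp
qed

subsection \<open>The unit tangent bundle\<close>

lemma topspace_T1: "topspace (T1 p) = T1_proj p ` T1_hplane"
proof
  show "topspace (T1 p) \<subseteq> T1_proj p ` T1_hplane"
    using openin_topspace[of "T1 p"] openin_T1 by blast
  have "{\<xi> \<in> T1_hplane. T1_proj p \<xi> \<in> T1_proj p ` T1_hplane} = T1_hplane" by auto
  then have "openin (T1 p) (T1_proj p ` T1_hplane)" by (simp add: openin_T1)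
  then show "T1_proj p ` T1_hplane \<subseteq> topspace (T1 p)" by (rule openin_subset)
qed

lemma continuous_on_dact:
  assumes "g \<in> deck p"
  shows "continuous_on T1_hplane (dact g)"
proof -
  have "continuous_on hplane (deriv g)"
    using deck_isometry(1)[OF assms] open_hplane
    by (intro holomorphic_on_imp_continuous_on holomorphic_deriv)
  moreover have "fst ` T1_hplane \<subseteq> hplane" by (auto simp: T1_hplane_def)
  ultimately have "continuous_on T1_hplane (\<lambda>\<xi>. deriv g (fst \<xi>))" "continuous_on T1_hplane (\<lambda>\<xi>. g (fst \<xi>))"
    using deck_isometry(5)[OF assms]
    using continuous_on_compose2[OF _ continuous_on_fst[OF continuous_on_id]] by blast+
  then show ?thesis unfolding dact_def[abs_def] by (intro continuous_intros)
qed

text \<open>The preimage of the image is the union of the deck translates of an open set.\<close>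

lemma openin_T1_image:
  assumes "open b"
  shows "openin (T1 p) (T1_proj p ` (b \<inter> T1_hplane))"
  unfolding openin_T1
proof
  show "T1_proj p ` (b \<inter> T1_hplane) \<subseteq> T1_proj p ` T1_hplane" by auto
  have "{\<xi> \<in> T1_hplane. T1_proj p \<xi> \<in> T1_proj p ` (b \<inter> T1_hplane)} =
      (\<Union>g\<in>deck p. T1_hplane \<inter> dact g -` b)"
  proof (intro set_eqI iffI)
    fix \<xi> assume "\<xi> \<in> {\<xi> \<in> T1_hplane. T1_proj p \<xi> \<in> T1_proj p ` (b \<inter> T1_hplane)}"
    then obtain \<eta> where "\<xi> \<in> T1_hplane" "\<eta> \<in> b" "\<eta> \<in> T1_hplane" "T1_proj p \<xi> = T1_proj p \<eta>" by auto
    then show "\<xi> \<in> (\<Union>g\<in>deck p. T1_hplane \<inter> dact g -` b)" using T1_proj_eq_iff by fastforce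
  next
    fix \<xi> assume "\<xi> \<in> (\<Union>g\<in>deck p. T1_hplane \<inter> dact g -` b)"
    then obtain g where g: "g \<in> deck p" "\<xi> \<in> T1_hplane" "dact g \<xi> \<in> b" by auto
    then have "T1_proj p \<xi> = T1_proj p (dact g \<xi>)" "dact g \<xi> \<in> T1_hplane"
      using T1_proj_eq_iff dact_T1_hplane by blast+
    then show "\<xi> \<in> {\<xi> \<in> T1_hplane. T1_proj p \<xi> \<in> T1_proj p ` (b \<inter> T1_hplane)}" using g by auto
  qed
  moreover have "openin (top_of_set T1_hplane) (\<Union>g\<in>deck p. T1_hplane \<inter> dact g -` b)"
    using continuous_openin_preimage_gen[OF continuous_on_dact assms] by (intro openin_Union) blast
  ultimately show "openin (top_of_set T1_hplane) {\<xi> \<in> T1_hplane. T1_proj p \<xi> \<in> T1_proj p ` (b \<inter> T1_hplane)}"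
    by (simp only:)
qed

text \<open>Lets statements about all open sets hold outside one null set of points of S.\<close>

lemma T1_countable_base:
  "\<exists>U :: nat \<Rightarrow> _. (\<forall>n. openin (T1 p) (U n)) \<and>
     (\<forall>V. openin (T1 p) V \<longrightarrow> (\<forall>\<xi>\<in>V. \<exists>n. \<xi> \<in> U n \<and> U n \<subseteq> V))"
proof -
  obtain B :: "(complex \<times> complex) set set" where B: "countable B" "topological_basis B"
    using ex_countable_basis by blast
  have "B \<noteq> {}" using topological_basisE[OF B(2) open_UNIV, of undefined] by auto
  define U where "U n = T1_proj p ` (from_nat_into B n \<inter> T1_hplane)" for n
  have "openin (T1 p) (U n)" for n
    unfolding U_def by (rule openin_T1_image) (metis B(2) \<open>B \<noteq> {}\<close> from_nat_into topological_basis_open)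
  moreover have "\<exists>n. \<xi> \<in> U n \<and> U n \<subseteq> V" if V: "openin (T1 p) V" "\<xi> \<in> V" for V \<xi>
  proof -
    obtain \<eta> where \<eta>: "\<eta> \<in> T1_hplane" "\<xi> = T1_proj p \<eta>" using V openin_T1 by blast
    have "openin (top_of_set T1_hplane) {\<xi> \<in> T1_hplane. T1_proj p \<xi> \<in> V}" using V openin_T1 by blast
    then obtain W where W: "open W" "{\<xi> \<in> T1_hplane. T1_proj p \<xi> \<in> V} = T1_hplane \<inter> W"
      unfolding openin_open by blast
    have "\<eta> \<in> W" using \<eta> V(2) W(2) by blast
    then obtain b where b: "b \<in> B" "\<eta> \<in> b" "b \<subseteq> W" using topological_basisE[OF B(2) W(1)] by blast
    obtain n where n: "b = from_nat_into B n" using from_nat_into_surj[OF B(1) b(1)] by metis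
    have "\<xi> \<in> U n" using \<eta> b n by (auto simp: U_def)
    moreover have "U n \<subseteq> V"
    proof
      fix \<zeta> assume "\<zeta> \<in> U n"
      then obtain \<theta> where "\<theta> \<in> b" "\<theta> \<in> T1_hplane" "\<zeta> = T1_proj p \<theta>" using n by (auto simp: U_def)
      moreover from this have "\<theta> \<in> T1_hplane \<inter> W" using b by blast
      ultimately show "\<zeta> \<in> V" using W(2) by blast
    qed
    ultimately show ?thesis by blast
  qed
  ultimately show ?thesis by blast
qed

lemma exists_fundamental_compact: "\<exists>K. compact K \<and> K \<subseteq> hplane \<and> p ` K = S"
proof -
  \<comment> \<open>Each open image is stored with its compact ball, so that a finite subcover still
    knows the balls that produced it.\<close>
  define \<C> where "\<C> = {(p ` ball z r, cball z r) | z r. r > 0 \<and> cball z r \<subseteq> hplane}"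
  have "\<exists>\<D>\<subseteq>fst ` \<C>. finite \<D> \<and> S \<subseteq> \<Union>\<D>"
  proof -
    have op: "\<forall>T\<in>fst ` \<C>. openin (top_of_set S) T"
    proof
      fix T assume "T \<in> fst ` \<C>"
      then obtain z r where "T = p ` ball z r" "cball z r \<subseteq> hplane" by (auto simp: \<C>_def)
      moreover from this have "openin (top_of_set hplane) (ball z r)"
        using ball_subset_cball by (intro open_openin_trans open_hplane) auto
      ultimately show "openin (top_of_set S) T" using covering_space_open_map[OF covering] by blast
    qed
    have "S \<subseteq> \<Union> (fst ` \<C>)"
    proof
      fix x assume "x \<in> S"
      then obtain z where z: "z \<in> hplane" "p z = x" using exists_lift by blast
      obtain r where "r > 0" "cball z r \<subseteq> hplane" using z open_hplane open_contains_cball by blast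
      then have "(p ` ball z r, cball z r) \<in> \<C>" "x \<in> p ` ball z r" using z by (auto simp: \<C>_def)
      then show "x \<in> \<Union> (fst ` \<C>)" by force
    qed
    then show ?thesis
      using compact_S op unfolding compact_eq_openin_cover by meson
  qed
  then obtain \<D> where \<D>: "\<D> \<subseteq> fst ` \<C>" "finite \<D>" "S \<subseteq> \<Union>\<D>" by blast
  then obtain \<C>' where C: "\<C>' \<subseteq> \<C>" "finite \<C>'" "\<D> = fst ` \<C>'" by (meson finite_subset_image)
  define K where "K = \<Union> (snd ` \<C>')"
  have "compact K" unfolding K_def using C by (intro compact_Union) (auto simp: \<C>_def)
  moreover have "K \<subseteq> hplane"
  proof
    fix y assume "y \<in> K"
    then obtain c where c: "c \<in> \<C>'" "y \<in> snd c" by (auto simp: K_def)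
    then have "c \<in> \<C>" using C by blast
    then show "y \<in> hplane" using c(2) by (auto simp: \<C>_def)
  qed
  moreover have "S \<subseteq> p ` K"
  proof
    fix x assume "x \<in> S"
    then obtain c where c: "c \<in> \<C>'" "x \<in> fst c" using \<D> C by blast
    then obtain z r where "c = (p ` ball z r, cball z r)" using C by (auto simp: \<C>_def)
    then show "x \<in> p ` K" using c by (auto simp: K_def intro!: image_eqI bexI[of _ c])
  qed
  ultimately show ?thesis using p_image by blast
qed

lemma T1_proj_continuous:
  assumes "continuous_map (T1 p) euclideanreal \<phi>"
  shows "continuous_on T1_hplane (\<lambda>\<xi>. \<phi> (T1_proj p \<xi>))"
  unfolding continuous_openin_preimage_eq
proof (intro allI impI)
  fix U :: "real set" assume "open U"
  then have "openin (T1 p) {x \<in> topspace (T1 p). \<phi> x \<in> U}"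
    using assms by (auto simp: continuous_map_def)
  then have "openin (top_of_set T1_hplane) {\<xi> \<in> T1_hplane. T1_proj p \<xi> \<in> {x \<in> topspace (T1 p). \<phi> x \<in> U}}"
    using openin_T1 by blast
  moreover have "{\<xi> \<in> T1_hplane. T1_proj p \<xi> \<in> {x \<in> topspace (T1 p). \<phi> x \<in> U}}
      = T1_hplane \<inter> (\<lambda>\<xi>. \<phi> (T1_proj p \<xi>)) -` U" by (auto simp: topspace_T1)
  ultimately show "openin (top_of_set T1_hplane) (T1_hplane \<inter> (\<lambda>\<xi>. \<phi> (T1_proj p \<xi>)) -` U)" by simp
qed

text \<open>Every orbit of unit vectors meets the compact set of unit vectors over a compact set
  that projects onto S.\<close>

lemma T1_bounded:
  assumes "continuous_map (T1 p) euclideanreal \<phi>"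
  shows "\<exists>B>0. \<forall>\<xi>\<in>T1_hplane. \<bar>\<phi> (T1_proj p \<xi>)\<bar> \<le> B"
proof -
  note c = T1_proj_continuous[OF assms]
  obtain K where K: "compact K" "K \<subseteq> hplane" "p ` K = S" using exists_fundamental_compact by blast
  define KT where "KT = (\<lambda>(z, u). (z, of_real (Im z) * u)) ` (K \<times> sphere (0::complex) 1)"
  have "compact KT" unfolding KT_def case_prod_unfold
    by (intro compact_continuous_image continuous_intros compact_Times K compact_sphere)
  moreover have KT: "KT \<subseteq> T1_hplane" using K(2) by (auto simp: KT_def T1_hplane_def norm_mult hplane_def)
  ultimately have "bounded ((\<lambda>\<xi>. \<phi> (T1_proj p \<xi>)) ` KT)"
    using c by (meson compact_continuous_image compact_imp_bounded continuous_on_subset)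
  then obtain B where B: "B > 0" "\<And>\<xi>. \<xi> \<in> KT \<Longrightarrow> \<bar>\<phi> (T1_proj p \<xi>)\<bar> \<le> B"
    unfolding bounded_pos by auto
  have "\<bar>\<phi> (T1_proj p \<xi>)\<bar> \<le> B" if \<xi>: "\<xi> \<in> T1_hplane" for \<xi>
  proof -
    have f: "fst \<xi> \<in> hplane" using \<xi> by (auto simp: T1_hplane_def)
    then obtain z where z: "z \<in> K" "p z = p (fst \<xi>)" using p_in_S K(3) by (metis imageE)
    then obtain g where g: "g \<in> deck p" "g (fst \<xi>) = z" using deck_trans[OF f] K by (metis subsetD)
    define \<eta> where "\<eta> = dact g \<xi>"
    have \<eta>: "\<eta> \<in> T1_hplane" "fst \<eta> = z" using dact_T1_hplane[OF g(1) \<xi>] g by (auto simp: \<eta>_def dact_def)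
    have iz: "Im z > 0" using K z by (auto simp: hplane_def)
    have "snd \<eta> / of_real (Im z) \<in> sphere 0 1" "snd \<eta> = of_real (Im z) * (snd \<eta> / of_real (Im z))"
      using \<eta> iz by (auto simp: T1_hplane_def norm_divide)
    then have "\<eta> \<in> KT" using z \<eta>(2) unfolding KT_def
      by (intro image_eqI[of _ _ "(z, snd \<eta> / of_real (Im z))"]) (auto simp: prod_eq_iff)
    moreover have "T1_proj p \<xi> = T1_proj p \<eta>" using T1_proj_eq_iff[OF \<xi> \<eta>(1)] g \<eta>_def by blast
    ultimately show ?thesis using B by simp
  qed
  with B(1) show ?thesis by blast
qed

end

subsection \<open>The canonical lift\<close>

lemma bounded_perturbation_speed:
  fixes a b :: "nat \<Rightarrow> real"
  assumes "(\<lambda>n. a n / real n) \<longlonglongrightarrow> v" "\<And>n. \<bar>b n - a n\<bar> \<le> C"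
  shows "(\<lambda>n. b n / real n) \<longlonglongrightarrow> v"
  unfolding linear_growth_iff
proof (intro allI impI)
  fix \<epsilon> :: real assume "\<epsilon> > 0"
  then obtain B where B: "\<And>n. \<bar>a n - v * real n\<bar> \<le> \<epsilon> * real n + B"
    using assms(1) unfolding linear_growth_iff by blast
  have "\<bar>b n - v * real n\<bar> \<le> \<epsilon> * real n + (B + C)" for n
    using B[of n] assms(2)[of n] by linarith
  then show "\<exists>B. \<forall>n. \<bar>b n - v * real n\<bar> \<le> \<epsilon> * real n + B" by blast
qed

text \<open>Equal endpoints would make the columns parallel and the determinant 0.\<close>

lemma line_endpoints_distinct:
  assumes "is_line c"
  shows "\<exists>\<omega> \<omega>'. \<omega> \<noteq> \<omega>' \<and> ((\<lambda>t. cay (c t)) \<longlongrightarrow> \<omega>) at_top \<and> ((\<lambda>t. cay (c t)) \<longlongrightarrow> \<omega>') at_bot"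
proof -
  obtain a b c' d where m: "a * d - b * c' = 1" and g: "\<And>t. c t = mob a b c' d (vert t)"
    using assms unfolding is_line_def by blast
  have "(of_real a - \<i> * of_real c') / (complex_of_real a + \<i> * of_real c') \<noteq>
      (of_real b - \<i> * of_real d) / (of_real b + \<i> * of_real d)"
    using cnj_ratio_eq[OF mob_column_nonzero[OF m]] m by auto
  then show ?thesis unfolding g using mob_vert_endpoints[OF m] by blast
qed

lemma regular_line:
  assumes "is_line c" "v > 0" "\<bar>w\<bar> = v"
  shows "regular (\<lambda>n. c (real n * w)) v"
  unfolding regular_def
proof (intro conjI allI exI)
  show "c (real n * w) \<in> hplane" for n by (rule line_in_hplane[OF assms(1)])
  show "hdist (c (real n * w)) (c (real (Suc n) * w)) \<le> v" for n
    using assms(3) by (simp add: hdist_line[OF assms(1)] algebra_simps)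
  have "(\<lambda>n. real n * v / real n) \<longlonglongrightarrow> v"
    unfolding linear_growth_iff by (auto intro!: exI[of _ 0])
  moreover have "\<bar>hdist \<i> (c (real n * w)) - real n * v\<bar> \<le> hdist \<i> (c 0)" for n
  proof -
    have "hdist (c 0) (c (real n * w)) = real n * v"
      using assms by (simp add: hdist_line abs_mult)
    then show ?thesis
      using hdist_triangle'[OF i_in_hplane line_in_hplane[OF assms(1)] line_in_hplane[OF assms(1)],
        of "real n * w" 0] by simp
  qed
  ultimately show "(\<lambda>n. hdist \<i> (c (real n * w)) / real n) \<longlonglongrightarrow> v"
    by (rule bounded_perturbation_speed)
qed

locale surface_homeo = hyp_surface S p for S :: "'a::metric_space set" and p +
  fixes f :: "'a \<Rightarrow> 'a"
  assumes f: "f \<in> Homeo0 S"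
begin

lemma f_homeomorphism: "\<exists>h. homeomorphism S S f h"
  using f homotopic_with_imp_property unfolding Homeo0_def by blast

text \<open>Lift the homotopy from the identity, starting with the identity of the plane. For a deck
  map g, the paths k(t, g z) and g(k(t, z)) lift the same path from the same point, hence coincide;
  at t = 1 this is commutation.\<close>

lemma exists_commuting_lift: "\<exists>F. is_commuting_lift p f F"
proof -
  obtain h where h: "continuous_map (prod_topology (top_of_set {0..1}) (top_of_set S)) (top_of_set S) h"
      "\<And>x. h (0::real, x) = x" "\<And>x. h (1, x) = f x"
    using f unfolding Homeo0_def homotopic_with_def by auto
  have hc: "continuous_on ({0..1} \<times> S) h" "h ` ({0..1} \<times> S) \<subseteq> S"
    using h(1) by (auto simp: prod_topology_subtopology_eu image_subset_iff)
  define H where "H = (\<lambda>(t::real, z). h (t, p z))"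
  have "continuous_on ({0..1} \<times> hplane) H"
    unfolding H_def case_prod_unfold
  proof (rule continuous_on_compose2[OF hc(1)])
    show "continuous_on ({0..1} \<times> hplane) (\<lambda>x. (fst x, p (snd x)))"
      by (intro continuous_intros continuous_on_compose2[OF continuous_on_p]) auto
  qed (use p_in_S in auto)
  moreover have "H ` ({0..1} \<times> hplane) \<subseteq> S" using hc(2) p_in_S by (auto simp: H_def)
  moreover have "H (0, z) = p z" for z using h by (simp add: H_def)
  ultimately obtain k where k: "continuous_on ({0..1} \<times> hplane) k" "k ` ({0..1} \<times> hplane) \<subseteq> hplane"
      "\<forall>z\<in>hplane. k (0, z) = z" "\<forall>x\<in>{0..1} \<times> hplane. p (k x) = H x"
    using covering_lift_homotopy_metric[OF covering, of hplane H "\<lambda>z. z"] by auto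
  have kin: "k (t, z) \<in> hplane" if "t \<in> {0..1}" "z \<in> hplane" for t z
    using k(2) that by (meson SigmaI image_subset_iff)
  have kc: "continuous_on {0..1} (\<lambda>t. k (t, z))" if "z \<in> hplane" for z
    by (rule continuous_on_compose2[OF k(1)]) (use that in \<open>auto intro!: continuous_intros\<close>)
  have "is_commuting_lift p f (\<lambda>z. k (1, z))"
    unfolding is_commuting_lift_def
  proof (intro conjI ballI)
    show "continuous_on hplane (\<lambda>z. k (1, z))"
      by (rule continuous_on_compose2[OF k(1)]) (auto intro!: continuous_intros)
    show "(\<lambda>z. k (1, z)) ` hplane \<subseteq> hplane" using kin by auto
    show "p (k (1, z)) = f (p z)" if "z \<in> hplane" for z using k(4) that h by (auto simp: H_def)
    fix g z assume g: "g \<in> deck p" and z: "z \<in> hplane"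
    note D = deck_isometry[OF g]
    show "k (1, g z) = g (k (1, z))"
    proof (rule lift_unique[of "{0..1::real}" 0 "\<lambda>t. k (t, g z)" "\<lambda>t. g (k (t, z))" 1])
      show "continuous_on {0..1} (\<lambda>t. g (k (t, z)))"
        using kc[OF z] kin z by (intro continuous_on_compose2[OF D(5)]) auto
      show "(\<lambda>t. g (k (t, z))) ` {0..1} \<subseteq> hplane" "(\<lambda>t. k (t, g z)) ` {0..1} \<subseteq> hplane"
        using kin z D(2) by auto
      show "p (k (t, g z)) = p (g (k (t, z)))" if "t \<in> {0..1}" for t
        using k(4) that z D(2)[OF z] D(4) kin[OF that z] by (simp add: H_def)
    qed (use k(3) z D kc in auto)
  qed
  then show ?thesis by blast
qed

abbreviation F :: "complex \<Rightarrow> complex" where "F \<equiv> can_lift p f"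
abbreviation G :: "complex \<Rightarrow> complex" where "G \<equiv> inv_into hplane F"

lemma F_lift: "is_commuting_lift p f F"
  unfolding can_lift_def using exists_commuting_lift by (rule someI_ex)

lemma F_in: "z \<in> hplane \<Longrightarrow> F z \<in> hplane" and p_F: "z \<in> hplane \<Longrightarrow> p (F z) = f (p z)"
  and F_deck: "g \<in> deck p \<Longrightarrow> z \<in> hplane \<Longrightarrow> F (g z) = g (F z)"
  and continuous_on_F: "continuous_on hplane F"
  using F_lift by (auto simp: is_commuting_lift_def)

lemma f_inj: "inj_on f S" and f_image: "f ` S = S" and continuous_on_f: "continuous_on S f"
  using f_homeomorphism by (auto simp: homeomorphism_def inj_on_def) metis

text \<open>Points with equal image are in one fibre, w = g z. By commutation g fixes F z, and a
  deck map with a fixed point is the identity.\<close>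

lemma F_inj: "inj_on F hplane"
proof (rule inj_onI)
  fix z w assume z: "z \<in> hplane" "w \<in> hplane" "F z = F w"
  then have "f (p z) = f (p w)" by (metis p_F)
  then have "p z = p w" using f_inj p_in_S z by (meson inj_onD)
  then obtain g where g: "g \<in> deck p" "g z = w" using deck_trans z by blast
  then have "g (F z) = F z" using F_deck z by metis
  then have "g z = z" using deck_unique[OF g(1) id_deck F_in[OF z(1)] _ z(1)] by simp
  then show "z = w" using g by simp
qed

lemma F_surj: "F ` hplane = hplane"
proof
  show "hplane \<subseteq> F ` hplane"
  proof
    fix w assume w: "w \<in> hplane"
    then obtain y where y: "y \<in> S" "f y = p w" using f_image p_in_S by (metis imageE)
    then obtain z where z: "z \<in> hplane" "p z = y" using exists_lift by blast
    then have "p (F z) = p w" using p_F y by simp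
    then obtain g where g: "g \<in> deck p" "g (F z) = w" using deck_trans F_in z w by blast
    then have "F (g z) = w" "g z \<in> hplane" using F_deck z deck_isometry(2) by auto
    then show "w \<in> F ` hplane" by blast
  qed
qed (use F_in in auto)

lemma G_in: "z \<in> hplane \<Longrightarrow> G z \<in> hplane" and F_G: "z \<in> hplane \<Longrightarrow> F (G z) = z"
  and G_F: "z \<in> hplane \<Longrightarrow> G (F z) = z"
  using F_surj F_inj by (auto simp: inv_into_into f_inv_into_f)

lemma continuous_on_G: "continuous_on hplane G"
proof -
  obtain g where g: "homeomorphism hplane (F ` hplane) F g"
    using invariance_of_domain_homeomorphism[OF open_hplane continuous_on_F _ F_inj] by auto
  then have "continuous_on hplane g" by (simp add: F_surj homeomorphism_def)
  moreover have "g z = G z" if "z \<in> hplane" for z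
    using g F_G[OF that] G_in[OF that] by (metis homeomorphism_apply1)
  ultimately show ?thesis using continuous_on_cong by metis
qed

lemma G_deck: "g \<in> deck p \<Longrightarrow> z \<in> hplane \<Longrightarrow> G (g z) = g (G z)"
  by (metis F_G F_deck G_F G_in deck_isometry(2))

lemma p_G: "z \<in> hplane \<Longrightarrow> p (G z) = inv_into S f (p z)"
  by (metis F_G G_in f_inj inv_into_f_f p_F p_in_S)

lemma iter_F_in: "z \<in> hplane \<Longrightarrow> (F ^^ n) z \<in> hplane"
  and iter_G_in: "z \<in> hplane \<Longrightarrow> (G ^^ n) z \<in> hplane"
  by (induction n) (auto simp: F_in G_in)

lemma p_iter_F: "z \<in> hplane \<Longrightarrow> p ((F ^^ n) z) = (f ^^ n) (p z)"
  by (induction n) (auto simp: p_F iter_F_in)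

lemma p_iter_G: "z \<in> hplane \<Longrightarrow> p ((G ^^ n) z) = (inv_into S f ^^ n) (p z)"
  by (induction n) (auto simp: p_G iter_G_in)

lemma iter_F_deck: "g \<in> deck p \<Longrightarrow> z \<in> hplane \<Longrightarrow> (F ^^ n) (g z) = g ((F ^^ n) z)"
  by (induction n) (auto simp: F_deck iter_F_in)

lemma iter_G_deck: "g \<in> deck p \<Longrightarrow> z \<in> hplane \<Longrightarrow> (G ^^ n) (g z) = g ((G ^^ n) z)"
  by (induction n) (auto simp: G_deck iter_G_in)

lemma iter_F_iter_G: "z \<in> hplane \<Longrightarrow> (F ^^ n) ((G ^^ n) z) = z"
  by (induction n arbitrary: z) (auto simp: funpow_swap1 F_G G_in iter_G_in)

lemma continuous_on_iter_F: "continuous_on hplane (F ^^ n)"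
proof (induction n)
  case (Suc n)
  then show ?case
    using continuous_on_compose2[OF continuous_on_F Suc] iter_F_in by (simp add: image_subset_iff o_def)
qed (simp add: continuous_on_id)

lemma continuous_on_iter_G: "continuous_on hplane (G ^^ n)"
proof (induction n)
  case (Suc n)
  then show ?case
    using continuous_on_compose2[OF continuous_on_G Suc] iter_G_in by (simp add: image_subset_iff o_def)
qed (simp add: continuous_on_id)

section \<open>Displacement and rotation speed\<close>

lemma bounded_displacement: "\<exists>C. \<forall>z\<in>hplane. hdist z (F z) \<le> C"
proof -
  obtain K where K: "compact K" "K \<subseteq> hplane" "p ` K = S" using exists_fundamental_compact by blast
  have "continuous_on K (\<lambda>z. hdist z (F z))"
    using K continuous_on_F F_in
    by (intro continuous_intros continuous_on_subset[OF continuous_on_F]) auto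
  then have "bounded ((\<lambda>z. hdist z (F z)) ` K)"
    using K(1) compact_continuous_image compact_imp_bounded by blast
  then obtain C where C: "\<And>z. z \<in> K \<Longrightarrow> hdist z (F z) \<le> C"
    unfolding bounded_iff by (metis image_eqI real_norm_def abs_le_iff)
  have "hdist z (F z) \<le> C" if z: "z \<in> hplane" for z
  proof -
    obtain w where w: "w \<in> K" "p w = p z" using K p_in_S z by (metis imageE)
    then obtain g where g: "g \<in> deck p" "g z = w" using deck_trans z K by (metis subsetD)
    then have "hdist z (F z) = hdist w (F w)" using F_deck deck_isometry(3) z F_in by metis
    then show ?thesis using C w by simp
  qed
  then show ?thesis by blast
qed

text \<open>The first two bounds make orbits \<open>regular\<close>. The last two keep the orbits of
  z and F z at bounded distance at equal times, so that both follow the same line.\<close>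

lemma hdist_iter_step:
  "\<exists>C. \<forall>z\<in>hplane. \<forall>n. hdist ((F ^^ n) z) ((F ^^ Suc n) z) \<le> C \<and> hdist ((G ^^ n) z) ((G ^^ Suc n) z) \<le> C
     \<and> hdist ((F ^^ n) z) ((F ^^ n) (F z)) \<le> C \<and> hdist ((G ^^ n) z) ((G ^^ n) (F z)) \<le> C"
proof -
  obtain C where C: "\<And>z. z \<in> hplane \<Longrightarrow> hdist z (F z) \<le> C" using bounded_displacement by blast
  have GF: "(G ^^ n) (F z) = F ((G ^^ n) z)" if "z \<in> hplane" for n z
    using that by (induction n) (auto simp: G_F F_G iter_G_in G_in)
  show ?thesis
  proof (intro exI[of _ C] ballI allI conjI)
    fix z n assume z: "z \<in> hplane"
    show "hdist ((F ^^ n) z) ((F ^^ Suc n) z) \<le> C" using C[OF iter_F_in[OF z]] by simp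
    show "hdist ((G ^^ n) z) ((G ^^ Suc n) z) \<le> C"
      using C[OF G_in[OF iter_G_in[OF z]], of n] F_G[OF iter_G_in[OF z], of n] by (simp add: hdist_commute)
    show "hdist ((F ^^ n) z) ((F ^^ n) (F z)) \<le> C"
      using C[OF iter_F_in[OF z]] by (simp add: funpow_swap1)
    show "hdist ((G ^^ n) z) ((G ^^ n) (F z)) \<le> C"
      using C[OF iter_G_in[OF z]] by (simp add: GF[OF z])
  qed
qed

lemma displacement_eq:
  assumes "z \<in> hplane"
  shows "displacement p f n (p z) = hdist z ((F ^^ n) z)"
proof -
  define w where "w = (SOME w. w \<in> hplane \<and> p w = p z)"
  have "w \<in> hplane \<and> p w = p z" unfolding w_def by (rule someI[of _ z]) (simp add: assms)
  then obtain g where g: "g \<in> deck p" "g z = w" using deck_trans assms by metis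
  have "hdist w ((F ^^ n) w) = hdist z ((F ^^ n) z)"
    using g iter_F_deck[OF g(1) assms] deck_isometry(3)[OF g(1) assms iter_F_in[OF assms]] by metis
  then show ?thesis by (simp add: displacement_def w_def[symmetric] Let_def)
qed

text \<open>Starting at f^(-n)(x), n steps lead back to x; so the second limit is the speed of the
  backward orbit.\<close>

lemma has_rotation_speed_iff:
  assumes "z \<in> hplane"
  shows "has_rotation_speed S p f (p z) v \<longleftrightarrow>
    (\<lambda>n. hdist z ((F ^^ n) z) / real n) \<longlonglongrightarrow> v \<and> (\<lambda>n. hdist z ((G ^^ n) z) / real n) \<longlonglongrightarrow> v"
  unfolding has_rotation_speed_def p_iter_G[OF assms, symmetric]
    displacement_eq[OF assms] displacement_eq[OF iter_G_in[OF assms]] iter_F_iter_G[OF assms]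
  by (simp add: hdist_commute)

lemma regular_orbit:
  assumes "z \<in> hplane"
  shows "(\<lambda>n. hdist z ((F ^^ n) z) / real n) \<longlonglongrightarrow> v \<Longrightarrow> regular (\<lambda>n. (F ^^ n) z) v"
    and "(\<lambda>n. hdist z ((G ^^ n) z) / real n) \<longlonglongrightarrow> v \<Longrightarrow> regular (\<lambda>n. (G ^^ n) z) v"
proof -
  obtain C where C: "\<And>n. hdist ((F ^^ n) z) ((F ^^ Suc n) z) \<le> C" "\<And>n. hdist ((G ^^ n) z) ((G ^^ Suc n) z) \<le> C"
    using hdist_iter_step assms by blast
  have b: "\<bar>hdist \<i> w - hdist z w\<bar> \<le> hdist \<i> z" if "w \<in> hplane" for w
    using hdist_triangle'[OF i_in_hplane assms that] .
  show "regular (\<lambda>n. (F ^^ n) z) v" if "(\<lambda>n. hdist z ((F ^^ n) z) / real n) \<longlonglongrightarrow> v"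
    unfolding regular_def using C(1) iter_F_in[OF assms] bounded_perturbation_speed[OF that b]
    by blast
  show "regular (\<lambda>n. (G ^^ n) z) v" if "(\<lambda>n. hdist z ((G ^^ n) z) / real n) \<longlonglongrightarrow> v"
    unfolding regular_def using C(2) iter_G_in[OF assms] bounded_perturbation_speed[OF that b]
    by blast
qed

subsection \<open>Tracking lines\<close>

definition end_fwd :: "complex \<Rightarrow> complex" where
  "end_fwd z = lim (\<lambda>n. cay ((F ^^ n) z))"

definition end_bwd :: "complex \<Rightarrow> complex" where
  "end_bwd z = lim (\<lambda>n. cay ((G ^^ n) z))"

text \<open>A condition on the lift: comparison of orbits, lines and feet takes place in the plane
  and descends to S only later.\<close>

definition good :: "real \<Rightarrow> complex \<Rightarrow> bool" where
  "good v z \<longleftrightarrow> z \<in> hplane \<and> v > 0 \<and> has_rotation_speed S p f (p z) v \<and> end_fwd z \<noteq> end_bwd z"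

definition axis_of :: "complex \<Rightarrow> real \<Rightarrow> complex" where
  "axis_of z = axis (end_fwd z) (end_bwd z)"

definition track :: "complex \<Rightarrow> real \<Rightarrow> complex" where
  "track z t = axis_of z (t + foot (axis_of z) z)"

lemma endpoints:
  assumes "z \<in> hplane" "v > 0" "has_rotation_speed S p f (p z) v"
  shows "regular (\<lambda>n. (F ^^ n) z) v" "regular (\<lambda>n. (G ^^ n) z) v"
    "(\<lambda>n. cay ((F ^^ n) z)) \<longlonglongrightarrow> end_fwd z" "cmod (end_fwd z) = 1"
    "(\<lambda>n. cay ((G ^^ n) z)) \<longlonglongrightarrow> end_bwd z" "cmod (end_bwd z) = 1"
proof -
  show r: "regular (\<lambda>n. (F ^^ n) z) v" "regular (\<lambda>n. (G ^^ n) z) v"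
    using assms regular_orbit[OF assms(1)] has_rotation_speed_iff by blast+
  show "(\<lambda>n. cay ((F ^^ n) z)) \<longlonglongrightarrow> end_fwd z" "cmod (end_fwd z) = 1"
    using regular_limit[OF r(1) assms(2)] unfolding end_fwd_def by (auto dest: limI)
  show "(\<lambda>n. cay ((G ^^ n) z)) \<longlonglongrightarrow> end_bwd z" "cmod (end_bwd z) = 1"
    using regular_limit[OF r(2) assms(2)] unfolding end_bwd_def by (auto dest: limI)
qed

lemma goodD:
  assumes "good v z"
  shows "z \<in> hplane" "v > 0" "has_rotation_speed S p f (p z) v"
    "regular (\<lambda>n. (F ^^ n) z) v" "regular (\<lambda>n. (G ^^ n) z) v"
    "(\<lambda>n. cay ((F ^^ n) z)) \<longlonglongrightarrow> end_fwd z" "(\<lambda>n. cay ((G ^^ n) z)) \<longlonglongrightarrow> end_bwd z"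
    "is_line (axis_of z)"
    "((\<lambda>t. cay (axis_of z t)) \<longlongrightarrow> end_fwd z) at_top" "((\<lambda>t. cay (axis_of z t)) \<longlongrightarrow> end_bwd z) at_bot"
proof -
  show *: "z \<in> hplane" "v > 0" "has_rotation_speed S p f (p z) v" using assms by (auto simp: good_def)
  note e = endpoints[OF *]
  show "regular (\<lambda>n. (F ^^ n) z) v" "regular (\<lambda>n. (G ^^ n) z) v"
    "(\<lambda>n. cay ((F ^^ n) z)) \<longlonglongrightarrow> end_fwd z" "(\<lambda>n. cay ((G ^^ n) z)) \<longlonglongrightarrow> end_bwd z"
    using e by auto
  have "end_fwd z \<noteq> end_bwd z" using assms by (simp add: good_def)
  then show "is_line (axis_of z)"
    "((\<lambda>t. cay (axis_of z t)) \<longlongrightarrow> end_fwd z) at_top" "((\<lambda>t. cay (axis_of z t)) \<longlongrightarrow> end_bwd z) at_bot"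
    unfolding axis_of_def using axis_line e(4,6) by blast+
qed

lemma filterlim_real_mult_at_top: "v > 0 \<Longrightarrow> filterlim (\<lambda>n. real n * v) at_top sequentially"
  by real_asymp

lemma filterlim_real_mult_at_bot: "v > 0 \<Longrightarrow> filterlim (\<lambda>n. - real n * v) at_bot sequentially"
  by real_asymp

text \<open>The orbit and the points n v of the line are regular sequences with a common limit, so
  \<open>regular_same_limit\<close> applies, forward and backward.\<close>

lemma tracksI:
  assumes "z \<in> hplane" "v > 0" "has_rotation_speed S p f (p z) v" and c: "is_line c"
    and "((\<lambda>t. cay (c t)) \<longlongrightarrow> end_fwd z) at_top" "((\<lambda>t. cay (c t)) \<longlongrightarrow> end_bwd z) at_bot"
  shows "tracks F z v c"
proof -
  note e = endpoints[OF assms(1-3)]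
  have "(\<lambda>n. cay (c (real n * v))) \<longlonglongrightarrow> end_fwd z"
    using filterlim_compose[OF assms(5) filterlim_real_mult_at_top[OF assms(2)]] .
  moreover have "(\<lambda>n. cay (c (real n * (- v)))) \<longlonglongrightarrow> end_bwd z"
    using filterlim_compose[OF assms(6) filterlim_real_mult_at_bot[OF assms(2)]] by simp
  moreover have "regular (\<lambda>n. c (real n * v)) v" "regular (\<lambda>n. c (real n * (- v))) v"
    using regular_line[OF c assms(2), of v] regular_line[OF c assms(2), of "- v"] assms(2) by simp_all
  ultimately have "(\<lambda>n. hdist ((F ^^ n) z) (c (real n * v)) / real n) \<longlonglongrightarrow> 0"
    "(\<lambda>n. hdist ((G ^^ n) z) (c (real n * (- v))) / real n) \<longlonglongrightarrow> 0"
    using regular_same_limit e assms(2) by blast+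
  then show ?thesis by (simp add: tracks_def)
qed

text \<open>The converse of \<open>tracksI\<close>, by \<open>sublinear_same_limit\<close>. Since a
  line has distinct ends, a tracked orbit has distinct limits.\<close>

lemma tracks_endpoints:
  assumes "z \<in> hplane" "v > 0" "has_rotation_speed S p f (p z) v" and c: "is_line c" and t: "tracks F z v c"
  shows "((\<lambda>t. cay (c t)) \<longlongrightarrow> end_fwd z) at_top" "((\<lambda>t. cay (c t)) \<longlongrightarrow> end_bwd z) at_bot"
    "end_fwd z \<noteq> end_bwd z"
proof -
  note e = endpoints[OF assms(1-3)]
  obtain \<omega> \<omega>' where w: "\<omega> \<noteq> \<omega>'" "((\<lambda>t. cay (c t)) \<longlongrightarrow> \<omega>) at_top" "((\<lambda>t. cay (c t)) \<longlongrightarrow> \<omega>') at_bot"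
    using line_endpoints_distinct[OF c] by blast
  have "(\<lambda>n. cay (c (real n * v))) \<longlonglongrightarrow> \<omega>"
    using filterlim_compose[OF w(2) filterlim_real_mult_at_top[OF assms(2)]] .
  moreover have "(\<lambda>n. cay (c (real n * v))) \<longlonglongrightarrow> end_fwd z"
    using sublinear_same_limit[OF e(1) assms(2) line_in_hplane[OF c] _ e(3)] t by (simp add: tracks_def)
  ultimately have 1: "\<omega> = end_fwd z" by (rule LIMSEQ_unique)
  have "(\<lambda>n. cay (c (- real n * v))) \<longlonglongrightarrow> \<omega>'"
    using filterlim_compose[OF w(3) filterlim_real_mult_at_bot[OF assms(2)]] .
  moreover have "(\<lambda>n. cay (c (- real n * v))) \<longlonglongrightarrow> end_bwd z"
    using sublinear_same_limit[OF e(2) assms(2) line_in_hplane[OF c] _ e(5)] t by (simp add: tracks_def)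
  ultimately have "\<omega>' = end_bwd z" by (rule LIMSEQ_unique)
  with 1 w show "((\<lambda>t. cay (c t)) \<longlongrightarrow> end_fwd z) at_top" "((\<lambda>t. cay (c t)) \<longlongrightarrow> end_bwd z) at_bot"
    "end_fwd z \<noteq> end_bwd z" by auto
qed

lemma track_line:
  assumes "good v z"
  shows "is_line (track z)" "foot (track z) z = 0" "tracks F z v (track z)"
proof -
  note g = goodD[OF assms]
  have te: "track z = (\<lambda>t. axis_of z (t + foot (axis_of z) z))" by (auto simp: track_def)
  show l: "is_line (track z)" unfolding te by (rule is_line_shift[OF g(8)])
  show "foot (track z) z = 0" unfolding te using foot_shift[OF g(8,1)] by simp
  show "tracks F z v (track z)"
  proof (rule tracksI[OF g(1-3) l])
    have "filterlim (\<lambda>t. t + s) at_top at_top" "filterlim (\<lambda>t. t + s) at_bot at_bot" for s :: real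
      by real_asymp+
    then show "((\<lambda>t. cay (track z t)) \<longlongrightarrow> end_fwd z) at_top" "((\<lambda>t. cay (track z t)) \<longlongrightarrow> end_bwd z) at_bot"
      unfolding te using filterlim_compose[OF g(9)] filterlim_compose[OF g(10)] by blast+
  qed
qed

text \<open>Tracking determines the endpoints, these determine the line up to a shift, and the foot
  determines the shift.\<close>

lemma track_unique:
  assumes "z \<in> hplane" "v > 0" "has_rotation_speed S p f (p z) v" "is_line c" "tracks F z v c"
  shows "good v z" "\<And>t. c t = track z (t - foot c z)"
proof -
  note e = tracks_endpoints[OF assms]
  show g: "good v z" using e assms by (simp add: good_def)
  note t = track_line[OF g]
  note e' = tracks_endpoints[OF assms(1-3) t(1,3)]
  obtain s where s: "\<And>t. c t = track z (t + s)"
    using line_unique[OF t(1) assms(4) e'(1) e(1) e'(2) e(2)] by blast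
  then have "c = (\<lambda>t. track z (t + s))" by auto
  then have "foot c z = - s" using foot_shift[OF t(1) assms(1)] t(2) by simp
  then show "c t = track z (t - foot c z)" for t using s by simp
qed

lemma good_deck:
  assumes "good v z" "g \<in> deck p"
  shows "good v (g z)" "track (g z) t = g (track z t)"
proof -
  note D = deck_isometry[OF assms(2)] and G = goodD[OF assms(1)] and T = track_line[OF assms(1)]
  have gz: "g z \<in> hplane" using D G by blast
  have l: "is_line (\<lambda>t. g (track z t))" by (rule is_line_deck[OF T(1) assms(2)])
  have "tracks F (g z) v (\<lambda>t. g (track z t))"
    using T(3) unfolding tracks_def
    by (simp add: iter_F_deck[OF assms(2) G(1)] iter_G_deck[OF assms(2) G(1)] D(3) iter_F_in iter_G_in G(1)
       line_in_hplane[OF T(1)])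
  moreover have "has_rotation_speed S p f (p (g z)) v" using D(4) G by simp
  ultimately show "good v (g z)" using track_unique(1)[OF gz G(2) _ l] by blast
  have "foot (\<lambda>t. g (track z t)) (g z) = foot (track z) z"
    by (rule foot_isometry) (simp add: D(3) G(1) line_in_hplane[OF T(1)])
  then show "track (g z) t = g (track z t)"
    using track_unique(2)[OF gz G(2) _ l, of t] \<open>has_rotation_speed S p f (p (g z)) v\<close>
      \<open>tracks F (g z) v (\<lambda>t. g (track z t))\<close> T(2) by simp
qed

text \<open>A bounded error changes neither the speed nor the line that is tracked; only the foot,
  hence the origin of the parameter, moves.\<close>

lemma good_near:
  assumes "good v z" "w \<in> hplane"
    and C: "\<And>n. hdist ((F ^^ n) z) ((F ^^ n) w) \<le> C" "\<And>n. hdist ((G ^^ n) z) ((G ^^ n) w) \<le> C"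
  shows "good v w" "track w t = track z (t + foot (track z) w)"
proof -
  note G = goodD[OF assms(1)] and T = track_line[OF assms(1)]
  have b: "\<bar>hdist w y - hdist z x\<bar> \<le> hdist z w + C"
    if "hdist x y \<le> C" "x \<in> hplane" "y \<in> hplane" for x y
    using hdist_triangle'[of x y z] hdist_triangle'[of z w y] that G(1) assms(2)
    by (simp add: hdist_commute)
  have "(\<lambda>n. hdist w ((F ^^ n) w) / real n) \<longlonglongrightarrow> v"
  proof (rule bounded_perturbation_speed)
    show "(\<lambda>n. hdist z ((F ^^ n) z) / real n) \<longlonglongrightarrow> v"
      using G(3) has_rotation_speed_iff[OF G(1)] by blast
    show "\<bar>hdist w ((F ^^ n) w) - hdist z ((F ^^ n) z)\<bar> \<le> hdist z w + C" for n
      by (rule b[OF C(1) iter_F_in[OF G(1)] iter_F_in[OF assms(2)]])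
  qed
  moreover have "(\<lambda>n. hdist w ((G ^^ n) w) / real n) \<longlonglongrightarrow> v"
  proof (rule bounded_perturbation_speed)
    show "(\<lambda>n. hdist z ((G ^^ n) z) / real n) \<longlonglongrightarrow> v"
      using G(3) has_rotation_speed_iff[OF G(1)] by blast
    show "\<bar>hdist w ((G ^^ n) w) - hdist z ((G ^^ n) z)\<bar> \<le> hdist z w + C" for n
      by (rule b[OF C(2) iter_G_in[OF G(1)] iter_G_in[OF assms(2)]])
  qed
  ultimately have sp: "has_rotation_speed S p f (p w) v" using has_rotation_speed_iff[OF assms(2)] by blast
  have tr: "tracks F w v (track z)"
    unfolding tracks_def
  proof
    note h = line_in_hplane[OF T(1)]
    show "(\<lambda>n. hdist ((F ^^ n) w) (track z (real n * v)) / real n) \<longlonglongrightarrow> 0"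
    proof (rule bounded_perturbation_speed)
      show "(\<lambda>n. hdist ((F ^^ n) z) (track z (real n * v)) / real n) \<longlonglongrightarrow> 0" using T(3) by (simp add: tracks_def)
      show "\<bar>hdist ((F ^^ n) w) (track z (real n * v)) - hdist ((F ^^ n) z) (track z (real n * v))\<bar> \<le> C" for n
        by (subst abs_minus_commute)
           (rule order_trans[OF hdist_triangle'[OF iter_F_in[OF G(1)] iter_F_in[OF assms(2)] h] C(1)])
    qed
    show "(\<lambda>n. hdist ((G ^^ n) w) (track z (- real n * v)) / real n) \<longlonglongrightarrow> 0"
    proof (rule bounded_perturbation_speed)
      show "(\<lambda>n. hdist ((G ^^ n) z) (track z (- real n * v)) / real n) \<longlonglongrightarrow> 0" using T(3) by (simp add: tracks_def)
      show "\<bar>hdist ((G ^^ n) w) (track z (- real n * v)) - hdist ((G ^^ n) z) (track z (- real n * v))\<bar> \<le> C" for n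
        by (subst abs_minus_commute)
           (rule order_trans[OF hdist_triangle'[OF iter_G_in[OF G(1)] iter_G_in[OF assms(2)] h] C(2)])
    qed
  qed
  show "good v w" using track_unique(1)[OF assms(2) G(2) sp T(1) tr] .
  show "track w t = track z (t + foot (track z) w)"
    using track_unique(2)[OF assms(2) G(2) sp T(1) tr, of "t + foot (track z) w"] by simp
qed

text \<open>The shift \<tau> at the level of lifts. It may have either sign.\<close>

definition progress :: "complex \<Rightarrow> real" where
  "progress z = foot (track z) (F z)"

lemma good_F:
  assumes "good v z"
  shows "good v (F z)" "track (F z) t = track z (t + progress z)"
proof -
  obtain C where "\<And>n. hdist ((F ^^ n) z) ((F ^^ n) (F z)) \<le> C" "\<And>n. hdist ((G ^^ n) z) ((G ^^ n) (F z)) \<le> C"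
    using hdist_iter_step goodD(1)[OF assms] by blast
  from good_near[OF assms F_in[OF goodD(1)[OF assms]] this]
  show "good v (F z)" "track (F z) t = track z (t + progress z)" unfolding progress_def by blast+
qed

lemma good_G:
  assumes "good v z"
  shows "good v (G z)"
proof -
  have z: "z \<in> hplane" "G z \<in> hplane" using goodD(1)[OF assms] G_in by auto
  obtain C where "\<And>n. hdist ((F ^^ n) (G z)) ((F ^^ n) (F (G z))) \<le> C"
      "\<And>n. hdist ((G ^^ n) (G z)) ((G ^^ n) (F (G z))) \<le> C"
    using hdist_iter_step z(2) by blast
  then have "\<And>n. hdist ((F ^^ n) z) ((F ^^ n) (G z)) \<le> C" "\<And>n. hdist ((G ^^ n) z) ((G ^^ n) (G z)) \<le> C"
    by (simp_all add: F_G[OF z(1)] hdist_commute)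
  from good_near(1)[OF assms z(2) this] show ?thesis .
qed

lemma good_iter:
  assumes "good v z"
  shows "good v ((F ^^ n) z)" "good v ((G ^^ n) z)"
  using assms good_F(1) good_G by (induction n) auto

text \<open>Since all points of an orbit share one line, progress is an increment of the foot on the
  line of \<open>z\<close>, and its sums telescope.\<close>

lemma track_iter_F:
  assumes "good v z"
  shows "track ((F ^^ n) z) t = track z (t + foot (track z) ((F ^^ n) z))"
    and "progress ((F ^^ n) z) = foot (track z) ((F ^^ Suc n) z) - foot (track z) ((F ^^ n) z)"
proof -
  have pr: "progress ((F ^^ n) z) = foot (track z) ((F ^^ Suc n) z) - foot (track z) ((F ^^ n) z)"
    if "\<And>t. track ((F ^^ n) z) t = track z (t + foot (track z) ((F ^^ n) z))" for n
  proof -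
    have "track ((F ^^ n) z) = (\<lambda>t. track z (t + foot (track z) ((F ^^ n) z)))" using that by auto
    then show ?thesis
      using foot_shift[OF track_line(1)[OF assms] iter_F_in[OF goodD(1)[OF assms], of "Suc n"]]
      by (simp add: progress_def)
  qed
  show *: "track ((F ^^ n) z) t = track z (t + foot (track z) ((F ^^ n) z))" for n t
  proof (induction n arbitrary: t)
    case 0
    then show ?case by (simp add: track_line(2)[OF assms])
  next
    case (Suc n)
    have "track ((F ^^ Suc n) z) t = track ((F ^^ n) z) (t + progress ((F ^^ n) z))"
      using good_F(2)[OF good_iter(1)[OF assms]] by simp
    then show ?case using pr[OF Suc.IH] Suc.IH by simp
  qed
  show "progress ((F ^^ n) z) = foot (track z) ((F ^^ Suc n) z) - foot (track z) ((F ^^ n) z)"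
    by (rule pr[OF *])
qed

lemma track_iter_G:
  assumes "good v z"
  shows "track ((G ^^ n) z) t = track z (t + foot (track z) ((G ^^ n) z))"
    and "progress ((G ^^ Suc n) z) = foot (track z) ((G ^^ n) z) - foot (track z) ((G ^^ Suc n) z)"
proof -
  have h: "(G ^^ n) z \<in> hplane" for n using iter_G_in goodD(1)[OF assms] by blast
  have ft: "track z (t + foot (track z) ((G ^^ n) z)) = track ((G ^^ n) z) t" for n t
  proof -
    define w where "w = (G ^^ n) z"
    have g: "good v w" unfolding w_def by (rule good_iter(2)[OF assms])
    \<comment> \<open>\<open>track_iter_F\<close> is applied at the backward point, whose n-th image
      is \<open>z\<close>, and the resulting shift is inverted.\<close>
    have "(F ^^ n) w = z" unfolding w_def by (rule iter_F_iter_G[OF goodD(1)[OF assms]])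
    then have z: "track z t = track w (t + foot (track w) z)" for t using track_iter_F(1)[OF g, of n] by simp
    then have "track z = (\<lambda>t. track w (t + foot (track w) z))" by auto
    then have "foot (track z) w = foot (track w) w - foot (track w) z"
      using foot_shift[OF track_line(1)[OF g] goodD(1)[OF g]] by simp
    then show ?thesis using z track_line(2)[OF g] unfolding w_def[symmetric] by simp
  qed
  then show "track ((G ^^ n) z) t = track z (t + foot (track z) ((G ^^ n) z))" by simp
  have "track ((G ^^ Suc n) z) = (\<lambda>t. track z (t + foot (track z) ((G ^^ Suc n) z)))"
    using ft[of _ "Suc n"] by presburger
  moreover have "F ((G ^^ Suc n) z) = (G ^^ n) z" using F_G[OF h] by simp
  ultimately show "progress ((G ^^ Suc n) z) = foot (track z) ((G ^^ n) z) - foot (track z) ((G ^^ Suc n) z)"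
    unfolding progress_def using foot_shift[OF track_line(1)[OF assms] h] by simp
qed

lemma progress_deck:
  assumes "good v z" "g \<in> deck p"
  shows "progress (g z) = progress z"
proof -
  note D = deck_isometry[OF assms(2)] and G = goodD[OF assms(1)] and T = track_line[OF assms(1)]
  show ?thesis
    unfolding progress_def
    by (rule foot_isometry)
       (simp add: good_deck(2)[OF assms] F_deck[OF assms(2) G(1)] D(3) F_in G(1) line_in_hplane[OF T(1)])
qed

lemma progress_bounded: "\<exists>C. \<forall>v z. good v z \<longrightarrow> \<bar>progress z\<bar> \<le> C"
proof -
  obtain C where C: "\<And>z. z \<in> hplane \<Longrightarrow> hdist z (F z) \<le> C" using bounded_displacement by blast
  have "\<bar>progress z\<bar> \<le> C" if g: "good v z" for v z
    using foot_lipschitz[OF track_line(1)[OF g] goodD(1)[OF g] F_in[OF goodD(1)[OF g]]]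
      track_line(2)[OF g] C[OF goodD(1)[OF g]] by (simp add: progress_def)
  then show ?thesis by blast
qed

text \<open>The foot is 1-Lipschitz and the line at time n v is its own foot, so tracking transfers
  the speed to the feet.\<close>

lemma foot_orbit_growth:
  assumes "good v z"
  shows "(\<lambda>n. foot (track z) ((F ^^ n) z) / real n) \<longlonglongrightarrow> v"
    "(\<lambda>n. foot (track z) ((G ^^ n) z) / real n) \<longlonglongrightarrow> - v"
proof -
  note G = goodD[OF assms(1)] and T = track_line[OF assms(1)]
  have a: "\<bar>foot (track z) w - t\<bar> \<le> hdist w (track z t)" if "w \<in> hplane" for w t
    using foot_lipschitz[OF T(1) that line_in_hplane[OF T(1)], of t] by (simp add: foot_line[OF T(1)])
  show "(\<lambda>n. foot (track z) ((F ^^ n) z) / real n) \<longlonglongrightarrow> v"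
    unfolding linear_growth_iff
  proof (intro allI impI)
    fix \<epsilon> :: real assume "\<epsilon> > 0"
    moreover have "(\<lambda>n. hdist ((F ^^ n) z) (track z (real n * v)) / real n) \<longlonglongrightarrow> 0" using T(3) by (simp add: tracks_def)
    ultimately obtain B where B: "\<And>n. \<bar>hdist ((F ^^ n) z) (track z (real n * v)) - 0 * real n\<bar> \<le> \<epsilon> * real n + B"
      unfolding linear_growth_iff by blast
    have "\<bar>foot (track z) ((F ^^ n) z) - v * real n\<bar> \<le> \<epsilon> * real n + B" for n
      using B[of n] a[OF iter_F_in[OF G(1)], of n "real n * v"] by (simp add: mult.commute)
    then show "\<exists>B. \<forall>n. \<bar>foot (track z) ((F ^^ n) z) - v * real n\<bar> \<le> \<epsilon> * real n + B" by blast
  qed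
  show "(\<lambda>n. foot (track z) ((G ^^ n) z) / real n) \<longlonglongrightarrow> - v"
    unfolding linear_growth_iff
  proof (intro allI impI)
    fix \<epsilon> :: real assume "\<epsilon> > 0"
    moreover have "(\<lambda>n. hdist ((G ^^ n) z) (track z (- real n * v)) / real n) \<longlonglongrightarrow> 0" using T(3) by (simp add: tracks_def)
    ultimately obtain B where B: "\<And>n. \<bar>hdist ((G ^^ n) z) (track z (- real n * v)) - 0 * real n\<bar> \<le> \<epsilon> * real n + B"
      unfolding linear_growth_iff by blast
    have "\<bar>foot (track z) ((G ^^ n) z) - (- v) * real n\<bar> \<le> \<epsilon> * real n + B" for n
      using B[of n] a[OF iter_G_in[OF G(1)], of n "- real n * v"] by (simp add: mult.commute)
    then show "\<exists>B. \<forall>n. \<bar>foot (track z) ((G ^^ n) z) - (- v) * real n\<bar> \<le> \<epsilon> * real n + B" by blast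
  qed
qed

text \<open>The normalization removes the freedom of translation left by \<open>line_unique\<close>,
  so the definite description in \<open>tracking_geodesic\<close> is resolved.\<close>

lemma tracking_geodesic_track:
  assumes "good v z"
  shows "is_tracking_geodesic S p f (p z) (\<lambda>t. p (track z t))"
    and "tracking_geodesic S p f (p z) = (\<lambda>t. p (track z t))"
proof -
  note G = goodD[OF assms(1)] and T = track_line[OF assms(1)]
  show tr: "is_tracking_geodesic S p f (p z) (\<lambda>t. p (track z t))"
    unfolding is_tracking_geodesic_def
  proof (intro conjI exI[of _ v] ballI impI)
    show "is_geodesic S (\<lambda>t. p (track z t))" by (rule line_is_geodesic[OF T(1)])
    fix w assume w: "w \<in> hplane" "p w = p z"
    then obtain g where g: "g \<in> deck p" "g z = w" using deck_trans G(1) by metis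
    have gw: "good v w" "\<And>t. track w t = g (track z t)" using good_deck[OF assms g(1)] g(2) by auto
    note T' = track_line[OF gw(1)]
    have "p (track w t) = p (track z t)" for t
      using gw(2) deck_isometry(4)[OF g(1) line_in_hplane[OF T(1)]] by simp
    then have "is_curve_lift p (\<lambda>t. p (track z t)) (track w)"
      using line_is_curve_lift[OF T'(1)] by simp
    moreover have "hdist w (track w 0) = (INF t. hdist w (track w t))"
      using foot_eq_iff[OF T'(1) w(1)] T'(2) by blast
    ultimately show "\<exists>c. is_curve_lift p (\<lambda>t. p (track z t)) c \<and> tracks F w v c \<and> hdist w (c 0) = (INF t. hdist w (c t))"
      using T'(3) by blast
  qed (use G in auto)
  show "tracking_geodesic S p f (p z) = (\<lambda>t. p (track z t))"
    unfolding tracking_geodesic_def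
  proof (rule the_equality[where P = "is_tracking_geodesic S p f (p z)", OF tr])
    fix \<gamma> assume "is_tracking_geodesic S p f (p z) \<gamma>"
    then obtain v' c where \<gamma>: "is_geodesic S \<gamma>" "v' > 0" "has_rotation_speed S p f (p z) v'"
        "is_curve_lift p \<gamma> c" "tracks F z v' c" "hdist z (c 0) = (INF t. hdist z (c t))"
      using G(1) unfolding is_tracking_geodesic_def by blast
    have "v' = v" using \<gamma>(3) G(3) unfolding has_rotation_speed_def using LIMSEQ_unique by blast
    have l: "is_line c" using geodesic_lift_is_line \<gamma> by blast
    have "foot c z = 0" using foot_eq_iff[OF l G(1)] \<gamma>(6) by blast
    then have "c t = track z t" for t
      using track_unique(2)[OF G(1-3) l, of t] \<gamma>(5) \<open>v' = v\<close> by simp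
    then show "\<gamma> = (\<lambda>t. p (track z t))" using \<gamma>(4) by (auto simp: is_curve_lift_def)
  qed
qed

lemma velocity_tracking:
  assumes "good v z"
  shows "velocity p (tracking_geodesic S p f (p z)) t = T1_proj p (tang (track z) t)"
  unfolding tracking_geodesic_track(2)[OF assms] by (rule velocity_line[OF track_line(1)[OF assms]])

end

subsection \<open>Birkhoff's ergodic theorem\<close>

text \<open>The maximum of the Birkhoff sums of lengths \<open>1\<close> to \<open>n + 1\<close>.\<close>

fun max_birkhoff :: "('b \<Rightarrow> real) \<Rightarrow> ('b \<Rightarrow> 'b) \<Rightarrow> nat \<Rightarrow> 'b \<Rightarrow> real" where
  "max_birkhoff \<phi> T 0 x = \<phi> x"
| "max_birkhoff \<phi> T (Suc n) x = \<phi> x + max 0 (max_birkhoff \<phi> T n (T x))"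

lemma max_birkhoff_mono: "max_birkhoff \<phi> T n x \<le> max_birkhoff \<phi> T (Suc n) x"
proof (induction n arbitrary: x)
  case (Suc n)
  have "max 0 (max_birkhoff \<phi> T n (T x)) \<le> max 0 (max_birkhoff \<phi> T (Suc n) (T x))"
    by (rule max.mono[OF order_refl Suc])
  then show ?case by (subst (1 2) max_birkhoff.simps(2)) (rule add_left_mono)
qed simp

lemma max_birkhoff_ge: "\<phi> x \<le> max_birkhoff \<phi> T n x"
  by (cases n) auto

lemma birkhoff_sum_le_max: "(\<Sum>k<Suc n. \<phi> ((T ^^ k) x)) \<le> max_birkhoff \<phi> T n x"
proof (induction n arbitrary: x)
  case (Suc n)
  have "(\<Sum>k<Suc (Suc n). \<phi> ((T ^^ k) x)) = \<phi> x + (\<Sum>k<Suc n. \<phi> ((T ^^ k) (T x)))"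
    by (subst sum.lessThan_Suc_shift) (simp add: funpow_swap1)
  then show ?case using Suc[of "T x"] by simp
qed simp

text \<open>A maximal ergodic argument. The set where the maxima P_n are unbounded is invariant; if
  it had full measure, P_(n+1) - P_n o T would converge boundedly to \<phi>, while its integral,
  that of P_(n+1) - P_n, is nonnegative. This contradicts the negative mean.\<close>

lemma (in prob_space) birkhoff_bounded_above:
  fixes \<phi> :: "'a \<Rightarrow> real"
  assumes T: "T \<in> measurable M M" "distr M M T = M"
    and erg: "ergodic_under M {T}"
    and \<phi>: "\<phi> \<in> borel_measurable M" "\<And>x. x \<in> space M \<Longrightarrow> \<bar>\<phi> x\<bar> \<le> K"
    and neg: "(\<integral>x. \<phi> x \<partial>M) < 0"
  shows "AE x in M. \<exists>C. \<forall>n. (\<Sum>k<n. \<phi> ((T ^^ k) x)) \<le> C"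
proof -
  let ?P = "max_birkhoff \<phi> T"
  note [measurable] = T(1) \<phi>(1)
  have Tsp: "x \<in> space M \<Longrightarrow> T x \<in> space M" for x using T(1) by (rule measurable_space)
  have P[measurable]: "?P n \<in> borel_measurable M" for n
  proof (induction n)
    case (Suc n)
    note [measurable] = Suc
    have "(\<lambda>x. \<phi> x + max 0 (?P n (T x))) \<in> borel_measurable M" by measurable
    then show ?case by (simp add: fun_eq_iff[symmetric] cong: measurable_cong)
  qed (simp add: \<phi>(1) fun_eq_iff cong: measurable_cong)
  have Pbd: "\<bar>?P n x\<bar> \<le> (real n + 1) * K" if "x \<in> space M" for n x
    using that
  proof (induction n arbitrary: x)
    case (Suc n)
    then show ?case using Suc.IH[OF Tsp[OF Suc.prems]] \<phi>(2)[OF Suc.prems] by (auto simp: algebra_simps)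
  qed (simp add: \<phi>(2))
  have Pint: "integrable M (?P n)" for n
    by (rule integrable_const_bound[of _ "(real n + 1) * K"]) (auto intro: Pbd)
  have mono: "?P m x \<le> ?P n x" if "m \<le> n" for m n x
    using lift_Suc_mono_le[of "\<lambda>n. ?P n x", OF max_birkhoff_mono that] .
  \<comment> \<open>Moving from x to T x changes the maxima by at most a bounded amount, up to an
    index shift; so \<open>B\<close> is exactly invariant.\<close>
  define B where "B = {x \<in> space M. \<forall>k::nat. \<exists>n. real k < ?P n x}"
  have Bm: "B \<in> sets M" unfolding B_def by measurable
  have "T -` B \<inter> space M = B"
  proof (intro set_eqI iffI)
    fix x assume "x \<in> T -` B \<inter> space M"
    then have x: "x \<in> space M" "\<And>k. \<exists>n. real k < ?P n (T x)" by (auto simp: B_def)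
    have "\<exists>n. real k < ?P n x" for k
    proof -
      obtain k' :: nat where "real k + K < real k'" using reals_Archimedean2 by blast
      moreover obtain n where "real k' < ?P n (T x)" using x by blast
      ultimately have "real k < ?P (Suc n) x" using \<phi>(2)[OF x(1)] by (auto simp: abs_le_iff)
      then show ?thesis by blast
    qed
    then show "x \<in> B" using x by (auto simp: B_def)
  next
    fix x assume "x \<in> B"
    then have x: "x \<in> space M" "\<And>k. \<exists>n. real k < ?P n x" by (auto simp: B_def)
    have "\<exists>n. real k < ?P n (T x)" for k
    proof -
      obtain k' :: nat where "real k + K < real k'" using reals_Archimedean2 by blast
      moreover obtain n where "real k' < ?P n x" using x by blast
      ultimately have "real k + K < ?P (Suc n) x" using max_birkhoff_mono[of \<phi> T n x] by linarith
      then have "real k < max 0 (?P n (T x))" using \<phi>(2)[OF x(1)] by (auto simp: abs_le_iff)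
      then show ?thesis by (auto simp: max_def split: if_splits)
    qed
    then show "x \<in> T -` B \<inter> space M" using x Tsp by (auto simp: B_def)
  qed
  with erg Bm have "emeasure M B = 0 \<or> emeasure M B = 1" by (auto simp: ergodic_under_def)
  moreover have "emeasure M B \<noteq> 1"
  proof
    assume "emeasure M B = 1"
    then have "AE x in M. x \<in> B" using Bm by (simp add: AE_in_set_eq_1 emeasure_eq_measure)
    \<comment> \<open>By the recursion this is \<phi> minus the negative part of P_n o T, and on
      \<open>B\<close> that part vanishes for large n.\<close>
    define D where "D n x = ?P (Suc n) x - ?P n (T x)" for n x
    have D: "D n x = \<phi> x - min 0 (?P n (T x))" for n x by (simp add: D_def)
    have "(\<lambda>n. \<integral>x. D n x \<partial>M) \<longlonglongrightarrow> (\<integral>x. \<phi> x \<partial>M)"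
    proof (rule integral_dominated_convergence[of _ _ _ "\<lambda>_. 2 * K"])
      show "D n \<in> borel_measurable M" for n unfolding D_def[abs_def] by measurable
      show "AE x in M. (\<lambda>n. D n x) \<longlonglongrightarrow> \<phi> x"
        using \<open>AE x in M. x \<in> B\<close>
      proof eventually_elim
        case (elim x)
        then have "T x \<in> B" using \<open>T -` B \<inter> space M = B\<close> by blast
        then obtain m where m: "real 0 < ?P m (T x)" unfolding B_def by blast
        have "eventually (\<lambda>n. D n x = \<phi> x) sequentially"
          using eventually_ge_at_top[of m]
        proof eventually_elim
          case (elim n)
          then have "0 < ?P n (T x)" using mono[OF elim, of "T x"] m by simp
          then show ?case by (simp add: D)
        qed
        then show ?case by (rule tendsto_eventually)
      qed
      show "AE x in M. norm (D n x) \<le> 2 * K" for n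
      proof (rule AE_I2)
        fix x assume x: "x \<in> space M"
        have "- K \<le> ?P n (T x)" using max_birkhoff_ge[of \<phi> "T x" T n] \<phi>(2)[OF Tsp[OF x]] by (auto simp: abs_le_iff)
        then show "norm (D n x) \<le> 2 * K" using \<phi>(2)[OF x] by (auto simp: D abs_le_iff min_def)
      qed
    qed auto
    moreover have "0 \<le> (\<integral>x. D n x \<partial>M)" for n
    proof -
      have "(\<integral>x. ?P n (T x) \<partial>M) = (\<integral>x. ?P n x \<partial>distr M M T)"
        by (rule integral_distr[symmetric]) measurable
      also have "\<dots> = (\<integral>x. ?P n x \<partial>M)" by (simp only: T(2))
      finally have "(\<integral>x. ?P n (T x) \<partial>M) = (\<integral>x. ?P n x \<partial>M)" .
      moreover have I2: "integrable M (\<lambda>x. ?P n (T x))"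
        by (rule integrable_const_bound[of _ "(real n + 1) * K"]) (auto intro: Pbd Tsp)
      moreover have "(\<integral>x. ?P n x \<partial>M) \<le> (\<integral>x. ?P (Suc n) x \<partial>M)"
        by (rule integral_mono[OF Pint Pint max_birkhoff_mono])
      ultimately show ?thesis
        unfolding D_def Bochner_Integration.integral_diff[OF Pint I2] by linarith
    qed
    ultimately have "0 \<le> (\<integral>x. \<phi> x \<partial>M)" by (meson LIMSEQ_le_const)
    then show False using neg by simp
  qed
  ultimately have "AE x in M. x \<notin> B" using Bm by (intro AE_not_in) (auto simp: null_sets_def)
  then show ?thesis
    using AE_space
  proof eventually_elim
    case (elim x)
    then obtain k :: nat where k: "\<And>n. ?P n x \<le> real k" by (auto simp: B_def not_less)
    have "(\<Sum>j<n. \<phi> ((T ^^ j) x)) \<le> real k" for n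
    proof (cases n)
      case (Suc m)
      then show ?thesis using birkhoff_sum_le_max[of \<phi> T x m] k[of m] by simp
    qed simp
    then show ?case by blast
  qed
qed

text \<open>Lowering \<phi> by slightly more than its mean gives a negative integral. The slack runs
  through 1/(m + 1), so one null set serves every tolerance.\<close>

lemma (in prob_space) birkhoff_upper:
  fixes \<phi> :: "'a \<Rightarrow> real"
  assumes T: "T \<in> measurable M M" "distr M M T = M"
    and erg: "ergodic_under M {T}"
    and \<phi>: "\<phi> \<in> borel_measurable M" "\<And>x. x \<in> space M \<Longrightarrow> \<bar>\<phi> x\<bar> \<le> K"
  shows "AE x in M. \<forall>m::nat. \<exists>C. \<forall>n. (\<Sum>k<n. \<phi> ((T ^^ k) x)) - (\<integral>x. \<phi> x \<partial>M) * n \<le> n / (real m + 1) + C"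
  unfolding AE_all_countable
proof
  fix m :: nat
  define I where "I = (\<integral>x. \<phi> x \<partial>M)"
  define \<psi> where "\<psi> x = \<phi> x - (I + 1 / (real m + 1))" for x
  have \<psi>: "\<psi> \<in> borel_measurable M" unfolding \<psi>_def[abs_def] using \<phi>(1) by measurable
  have int: "integrable M \<phi>"
    by (rule integrable_const_bound[of _ K]) (use \<phi> in auto)
  have "(\<integral>x. \<psi> x \<partial>M) = I - (I + 1 / (real m + 1))"
    unfolding \<psi>_def I_def using int by (subst Bochner_Integration.integral_diff) (auto simp: prob_space)
  then have neg: "(\<integral>x. \<psi> x \<partial>M) < 0" by simp
  have "AE x in M. \<exists>C. \<forall>n. (\<Sum>k<n. \<psi> ((T ^^ k) x)) \<le> C"
  proof (rule birkhoff_bounded_above[OF T erg \<psi> _ neg])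
    show "\<bar>\<psi> x\<bar> \<le> K + \<bar>I + 1 / (real m + 1)\<bar>" if "x \<in> space M" for x
      using \<phi>(2)[OF that] unfolding \<psi>_def by linarith
  qed
  then show "AE x in M. \<exists>C. \<forall>n. (\<Sum>k<n. \<phi> ((T ^^ k) x)) - (\<integral>x. \<phi> x \<partial>M) * n \<le> n / (real m + 1) + C"
  proof eventually_elim
    case (elim x)
    then obtain C where "\<And>n. (\<Sum>k<n. \<psi> ((T ^^ k) x)) \<le> C" by blast
    then have "(\<Sum>k<n. \<phi> ((T ^^ k) x)) - I * n \<le> n / (real m + 1) + C" for n :: nat
      using \<open>\<And>n. (\<Sum>k<n. \<psi> ((T ^^ k) x)) \<le> C\<close>[of n]
      by (simp add: \<psi>_def sum_subtractf algebra_simps)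
    then show ?case unfolding I_def by blast
  qed
qed

theorem (in prob_space) birkhoff:
  fixes \<phi> :: "'a \<Rightarrow> real"
  assumes T: "T \<in> measurable M M" "distr M M T = M"
    and erg: "ergodic_under M {T}"
    and \<phi>: "\<phi> \<in> borel_measurable M" "\<And>x. x \<in> space M \<Longrightarrow> \<bar>\<phi> x\<bar> \<le> K"
  shows "AE x in M. (\<lambda>n. (\<Sum>k<n. \<phi> ((T ^^ k) x)) / real n) \<longlonglongrightarrow> (\<integral>x. \<phi> x \<partial>M)"
proof -
  have "AE x in M. \<forall>m::nat. \<exists>C. \<forall>n. (\<Sum>k<n. - \<phi> ((T ^^ k) x)) - (\<integral>x. - \<phi> x \<partial>M) * n \<le> n / (real m + 1) + C"
    by (rule birkhoff_upper[OF T erg, of "\<lambda>x. - \<phi> x" K]) (use \<phi> in auto)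
  moreover have "AE x in M. \<forall>m::nat. \<exists>C. \<forall>n. (\<Sum>k<n. \<phi> ((T ^^ k) x)) - (\<integral>x. \<phi> x \<partial>M) * n \<le> n / (real m + 1) + C"
    by (rule birkhoff_upper[OF T erg, of \<phi> K]) (use \<phi> in auto)
  ultimately show ?thesis
  proof eventually_elim
    case (elim x)
    define I where "I = (\<integral>x. \<phi> x \<partial>M)"
    define S where "S n = (\<Sum>k<n. \<phi> ((T ^^ k) x))" for n
    have up: "\<exists>C. \<forall>n::nat. S n - I * n \<le> n / (real m + 1) + C"
      and lo: "\<exists>C. \<forall>n::nat. - S n + I * n \<le> n / (real m + 1) + C" for m :: nat
      using elim unfolding S_def I_def by (auto simp: sum_negf)
    show ?case
      unfolding linear_growth_iff S_def[symmetric] I_def[symmetric]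
    proof (intro allI impI)
      fix \<epsilon> :: real assume "\<epsilon> > 0"
      then obtain m :: nat where m: "1 / (real m + 1) < \<epsilon>"
        using reals_Archimedean by (metis inverse_eq_divide of_nat_Suc add.commute)
      obtain C1 C2 where C: "\<And>n::nat. S n - I * n \<le> n / (real m + 1) + C1"
          "\<And>n::nat. - S n + I * n \<le> n / (real m + 1) + C2"
        using up[of m] lo[of m] by blast
      have "\<bar>S n - I * real n\<bar> \<le> \<epsilon> * real n + max C1 C2" for n
      proof -
        have "real n / (real m + 1) \<le> \<epsilon> * real n"
          using mult_right_mono[OF less_imp_le[OF m], of "real n"] by simp
        then show ?thesis using C(1)[of n] C(2)[of n] by (auto simp: abs_le_iff)
      qed
      then show "\<exists>B. \<forall>n. \<bar>S n - I * real n\<bar> \<le> \<epsilon> * real n + B" by blast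
    qed
  qed
qed

subsection \<open>Measurability of the tracking line\<close>

text \<open>The plane is covered by countably many open sets on which \<open>p\<close> is a
  homeomorphism onto a Borel set. Use the local inverse with the least index whose domain contains
  the point.\<close>

lemma (in hyp_surface) exists_measurable_section:
  "\<exists>\<sigma>. \<sigma> \<in> borel_measurable borel \<and> (\<forall>x\<in>S. \<sigma> x \<in> hplane \<and> p (\<sigma> x) = x)"
proof -
  define \<F> where "\<F> = {T. open T \<and> T \<subseteq> hplane \<and> (\<exists>u q. u \<in> sets borel \<and> homeomorphism T u p q)}"
  have "hplane \<subseteq> \<Union>\<F>"
  proof
    fix z assume z: "z \<in> hplane"
    obtain T u q where T: "z \<in> T" "openin (top_of_set hplane) T" "p z \<in> u"
        "openin (top_of_set S) u" "homeomorphism T u p q"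
      by (rule covering_space_local_homeomorphism[OF covering z])
    obtain W where "open W" "u = S \<inter> W" using T(4) unfolding openin_open by blast
    then have "u \<in> sets borel" using compact_S by (simp add: borel_compact borel_open sets.Int)
    then have "T \<in> \<F>" using T open_hplane openin_open_eq[of hplane T] unfolding \<F>_def by blast
    then show "z \<in> \<Union>\<F>" using T(1) by blast
  qed
  moreover obtain \<F>' where F': "\<F>' \<subseteq> \<F>" "countable \<F>'" "\<Union>\<F>' = \<Union>\<F>"
    using Lindelof[of \<F>] unfolding \<F>_def by (smt (verit) mem_Collect_eq)
  ultimately have cov: "hplane \<subseteq> \<Union>\<F>'" by simp
  then have ne: "\<F>' \<noteq> {}" using i_in_hplane by blast
  define T where "T n = from_nat_into \<F>' n" for n
  have T: "T n \<subseteq> hplane" "\<exists>u q. u \<in> sets borel \<and> homeomorphism (T n) u p q" for n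
    using from_nat_into[OF ne, of n] F'(1) unfolding T_def \<F>_def by blast+
  obtain u q where u: "\<And>n. u n \<in> sets borel" "\<And>n. homeomorphism (T n) (u n) p (q n)"
    using T(2) by metis
  \<comment> \<open>The value \<open>\<i>\<close> off \<open>u n\<close> only makes the function
    total; for points of S the least index avoids it.\<close>
  define h where "h n x = (if x \<in> u n then q n x else \<i>)" for n x
  define N where "N x = (LEAST n. x \<in> u n)" for x
  have hm: "h n \<in> borel_measurable borel" for n
    unfolding h_def[abs_def]
    by (rule borel_measurable_continuous_on_if[OF u(1)]) (use u(2) in \<open>auto simp: homeomorphism_def\<close>)
  have Nm: "N \<in> measurable borel (count_space UNIV)"
    unfolding N_def[abs_def] using u(1) by measurable
  have "(\<lambda>x. h (N x) x) \<in> borel_measurable borel"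
    by (rule measurable_compose_countable[OF hm Nm])
  moreover have "h (N x) x \<in> hplane \<and> p (h (N x) x) = x" if x: "x \<in> S" for x
  proof -
    obtain z where z: "z \<in> hplane" "p z = x" using exists_lift[OF x] by blast
    then obtain t where t: "t \<in> \<F>'" "z \<in> t" using cov by blast
    obtain n where n: "T n = t" using from_nat_into_surj[OF F'(2) t(1)] unfolding T_def by blast
    have "x \<in> u n" using u(2)[of n] z(2) t(2) n unfolding homeomorphism_def by blast
    then have xN: "x \<in> u (N x)" unfolding N_def by (rule LeastI)
    then have "q (N x) x \<in> T (N x)" "p (q (N x) x) = x"
      using u(2)[of "N x"] unfolding homeomorphism_def by blast+
    then show ?thesis using T(1) xN by (auto simp: h_def)
  qed
  ultimately show ?thesis by blast
qed

text \<open>Tolerances 1/(m + 1) leave only countable quantifiers.\<close>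

lemma sets_Collect_tendsto:
  fixes g :: "nat \<Rightarrow> 'b \<Rightarrow> real"
  assumes [measurable]: "\<And>n. g n \<in> borel_measurable M"
  shows "{x \<in> space M. (\<lambda>n. g n x) \<longlonglongrightarrow> v} \<in> sets M"
proof -
  have "(\<lambda>n. g n x) \<longlonglongrightarrow> v \<longleftrightarrow> (\<forall>m::nat. \<exists>N. \<forall>n. N \<le> n \<longrightarrow> \<bar>g n x - v\<bar> < 1 / (real m + 1))" for x
  proof
    assume "(\<lambda>n. g n x) \<longlonglongrightarrow> v"
    then show "\<forall>m::nat. \<exists>N. \<forall>n. N \<le> n \<longrightarrow> \<bar>g n x - v\<bar> < 1 / (real m + 1)"
      unfolding LIMSEQ_iff by (auto simp: add_pos_pos)
  next
    assume H: "\<forall>m::nat. \<exists>N. \<forall>n. N \<le> n \<longrightarrow> \<bar>g n x - v\<bar> < 1 / (real m + 1)"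
    show "(\<lambda>n. g n x) \<longlonglongrightarrow> v"
      unfolding LIMSEQ_iff
    proof (intro allI impI)
      fix e :: real assume "e > 0"
      then obtain m :: nat where "1 / (real m + 1) < e"
        using reals_Archimedean by (metis inverse_eq_divide of_nat_Suc add.commute)
      then show "\<exists>no. \<forall>n\<ge>no. norm (g n x - v) < e" using H by (metis less_trans real_norm_def)
    qed
  qed
  then have "{x \<in> space M. (\<lambda>n. g n x) \<longlonglongrightarrow> v} =
    {x \<in> space M. \<forall>m::nat. \<exists>N. \<forall>n. N \<le> n \<longrightarrow> \<bar>g n x - v\<bar> < 1 / (real m + 1)}" by simp
  then show ?thesis by simp
qed

locale ergodic_surface = surface_homeo S p f
  for S :: "'a::metric_space set" and p and f :: "'a \<Rightarrow> 'a" +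
  fixes \<mu> :: "'a measure" and v :: real
  assumes prob_space_mu: "prob_space \<mu>" and sets_mu: "sets \<mu> = sets (restrict_space borel S)"
    and inv: "invariant_under \<mu> {f}" and erg: "ergodic_under \<mu> {f}"
    and v: "v > 0" and speed: "AE x in \<mu>. has_rotation_speed S p f x v"
begin

sublocale prob_space \<mu> by (rule prob_space_mu)

lemma space_mu: "space \<mu> = S"
  using sets_eq_imp_space_eq[OF sets_mu] by (simp add: space_restrict_space)

abbreviation f_inv :: "'a \<Rightarrow> 'a" where "f_inv \<equiv> inv_into S f"

lemma f_measurable [measurable]: "f \<in> measurable \<mu> \<mu>" and distr_f: "distr \<mu> \<mu> f = \<mu>"
  using inv by (auto simp: invariant_under_def)

lemma f_inv_in: "x \<in> S \<Longrightarrow> f_inv x \<in> S" and f_f_inv: "x \<in> S \<Longrightarrow> f (f_inv x) = x"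
  and f_inv_f: "x \<in> S \<Longrightarrow> f_inv (f x) = x" and f_in: "x \<in> S \<Longrightarrow> f x \<in> S"
  using f_image f_inj by (auto simp: inv_into_into f_inv_into_f)

lemma f_inv_measurable [measurable]: "f_inv \<in> measurable \<mu> \<mu>"
proof -
  obtain h where h: "homeomorphism S S f h" using f_homeomorphism by blast
  have "h x = f_inv x" if "x \<in> S" for x
    using h that f_inv_in f_f_inv by (metis homeomorphism_apply1)
  moreover have "continuous_on S h" using h by (simp add: homeomorphism_def)
  ultimately have "continuous_on S f_inv" by (metis continuous_on_cong)
  then have "f_inv \<in> borel_measurable (restrict_space borel S)"
    by (rule borel_measurable_continuous_on_restrict)
  then have "f_inv \<in> measurable (restrict_space borel S) (restrict_space borel S)"
    using f_inv_in by (intro measurable_restrict_space2) (auto simp: space_restrict_space)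
  then show ?thesis using measurable_cong_sets[OF sets_mu sets_mu] by blast
qed

lemma distr_f_inv: "distr \<mu> \<mu> f_inv = \<mu>"
proof (rule measure_eqI)
  fix A assume "A \<in> sets (distr \<mu> \<mu> f_inv)"
  then have A[measurable]: "A \<in> sets \<mu>" by simp
  define B where "B = f_inv -` A \<inter> space \<mu>"
  have B: "B \<in> sets \<mu>" unfolding B_def by measurable
  have "f -` B \<inter> space \<mu> = A"
    using sets.sets_into_space[OF A] by (auto simp: B_def space_mu f_in f_inv_f)
  then have "emeasure \<mu> A = emeasure (distr \<mu> \<mu> f) B"
    using B by (simp add: emeasure_distr)
  also have "\<dots> = emeasure \<mu> B" by (simp only: distr_f)
  finally show "emeasure (distr \<mu> \<mu> f_inv) A = emeasure \<mu> A"
    by (simp add: emeasure_distr B_def)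
qed simp

lemma erg_inv: "ergodic_under \<mu> {f_inv}"
  unfolding ergodic_under_def
proof (intro ballI impI)
  fix A assume A: "A \<in> sets \<mu>" "\<forall>T\<in>{f_inv}. T -` A \<inter> space \<mu> = A"
  then have eq: "f_inv -` A \<inter> S = A" by (simp add: space_mu)
  have "f -` A \<inter> S = A"
  proof (intro set_eqI iffI)
    fix x assume x: "x \<in> f -` A \<inter> S"
    then have "f x \<in> f_inv -` A \<inter> S" using eq by simp
    then show "x \<in> A" using x f_inv_f by auto
  next
    fix x assume "x \<in> A"
    moreover from this have "x \<in> S" using eq by blast
    ultimately have "f x \<in> f_inv -` A \<inter> S" using f_in f_inv_f by auto
    then show "x \<in> f -` A \<inter> S" using eq \<open>x \<in> S\<close> by auto
  qed
  then show "emeasure \<mu> A = 0 \<or> emeasure \<mu> A = 1"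
    using erg A(1) by (auto simp: ergodic_under_def space_mu)
qed

definition \<sigma> :: "'a \<Rightarrow> complex" where
  "\<sigma> = (SOME \<sigma>. \<sigma> \<in> borel_measurable borel \<and> (\<forall>x\<in>S. \<sigma> x \<in> hplane \<and> p (\<sigma> x) = x))"

lemma \<sigma>_borel: "\<sigma> \<in> borel_measurable borel" and \<sigma>_in: "x \<in> S \<Longrightarrow> \<sigma> x \<in> hplane"
  and p_\<sigma>: "x \<in> S \<Longrightarrow> p (\<sigma> x) = x"
  using someI_ex[OF exists_measurable_section] unfolding \<sigma>_def by auto

lemma \<sigma>_measurable [measurable]: "\<sigma> \<in> borel_measurable \<mu>"
  using measurable_restrict_space1[OF \<sigma>_borel, of S] measurable_cong_sets[OF sets_mu refl] by blast

lemma measurable_lift: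
  fixes h :: "complex \<Rightarrow> 'c::topological_space"
  assumes "continuous_on hplane h"
  shows "(\<lambda>x. h (\<sigma> x)) \<in> borel_measurable \<mu>"
proof -
  have "\<sigma> \<in> measurable \<mu> (restrict_space borel hplane)"
    by (rule measurable_restrict_space2) (auto simp: space_mu \<sigma>_in)
  then show ?thesis
    using measurable_compose borel_measurable_continuous_on_restrict[OF assms] by blast
qed

lemma measurable_iter [measurable]:
  "(\<lambda>x. (F ^^ n) (\<sigma> x)) \<in> borel_measurable \<mu>" "(\<lambda>x. (G ^^ n) (\<sigma> x)) \<in> borel_measurable \<mu>"
  by (rule measurable_lift[OF continuous_on_iter_F], rule measurable_lift[OF continuous_on_iter_G])

lemma measurable_F_\<sigma> [measurable]: "(\<lambda>x. F (\<sigma> x)) \<in> borel_measurable \<mu>"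
  using measurable_lift[OF continuous_on_F] .

lemma measurable_hdist_iter:
  "(\<lambda>x. hdist ((G ^^ m) (\<sigma> x)) ((F ^^ n) (\<sigma> x))) \<in> borel_measurable \<mu>"
  "(\<lambda>x. hdist (\<sigma> x) ((F ^^ n) (\<sigma> x))) \<in> borel_measurable \<mu>"
  "(\<lambda>x. hdist (\<sigma> x) ((G ^^ n) (\<sigma> x))) \<in> borel_measurable \<mu>"
  by (rule measurable_lift, rule continuous_on_hdist;
      auto intro: continuous_on_iter_F continuous_on_iter_G iter_F_in iter_G_in continuous_on_id)+

lemma measurable_ends [measurable]:
  "(\<lambda>x. end_fwd (\<sigma> x)) \<in> borel_measurable \<mu>" "(\<lambda>x. end_bwd (\<sigma> x)) \<in> borel_measurable \<mu>"
proof -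
  have [measurable]: "cay \<in> borel_measurable borel" unfolding cay_def[abs_def] by measurable
  show "(\<lambda>x. end_fwd (\<sigma> x)) \<in> borel_measurable \<mu>" "(\<lambda>x. end_bwd (\<sigma> x)) \<in> borel_measurable \<mu>"
    unfolding end_fwd_def end_bwd_def by (rule borel_measurable_lim_metric, measurable)+
qed

lemma measurable_csqrt [measurable]:
  "(\<lambda>z. Re (csqrt z)) \<in> borel_measurable borel" "(\<lambda>z. Im (csqrt z)) \<in> borel_measurable borel"
  unfolding csqrt.simps by measurable

text \<open>The four functions \<open>ma\<close>, \<open>mb\<close>, \<open>mc\<close>,
  \<open>md\<close> are the coefficients of \<open>axis\<close> for the chosen lift: measurable in
  the point because square root and limits are.\<close>

definition ma :: "'a \<Rightarrow> real" where
  "ma x = Re (csqrt (end_fwd (\<sigma> x))) / axis_den (end_fwd (\<sigma> x)) (end_bwd (\<sigma> x))"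
definition mb :: "'a \<Rightarrow> real" where "mb x = Re (csqrt (end_bwd (\<sigma> x)))"
definition mc :: "'a \<Rightarrow> real" where
  "mc x = - Im (csqrt (end_fwd (\<sigma> x))) / axis_den (end_fwd (\<sigma> x)) (end_bwd (\<sigma> x))"
definition md :: "'a \<Rightarrow> real" where "md x = - Im (csqrt (end_bwd (\<sigma> x)))"

lemma measurable_coeffs [measurable]:
  "ma \<in> borel_measurable \<mu>" "mb \<in> borel_measurable \<mu>" "mc \<in> borel_measurable \<mu>" "md \<in> borel_measurable \<mu>"
  unfolding ma_def[abs_def] mb_def[abs_def] mc_def[abs_def] md_def[abs_def] axis_den_def by measurable

lemma axis_of_\<sigma>:
  assumes "good v (\<sigma> x)"
  shows "ma x * md x - mb x * mc x = 1" "axis_of (\<sigma> x) t = mob (ma x) (mb x) (mc x) (md x) (vert t)"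
proof -
  note g = goodD[OF assms]
  have "axis_den (end_fwd (\<sigma> x)) (end_bwd (\<sigma> x)) \<noteq> 0"
    using axis_den_nonzero endpoints(4,6)[OF g(1-3)] assms by (simp add: good_def)
  then show "ma x * md x - mb x * mc x = 1"
    unfolding ma_def mb_def mc_def md_def by (rule axis_det)
  show "axis_of (\<sigma> x) t = mob (ma x) (mb x) (mc x) (md x) (vert t)"
    by (simp add: axis_of_def axis_def ma_def mb_def mc_def md_def)
qed

text \<open>The formula of \<open>foot_mob\<close>, taken for all arguments: unlike the definite
  description \<open>foot\<close> it is visibly measurable, and the two agree on good
  points.\<close>

definition mfoot :: "'a \<Rightarrow> complex \<Rightarrow> real" where
  "mfoot x w = ln (cmod (mob (md x) (- mb x) (- mc x) (ma x) w))"

lemma mfoot_eq: "good v (\<sigma> x) \<Longrightarrow> w \<in> hplane \<Longrightarrow> foot (axis_of (\<sigma> x)) w = mfoot x w"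
  unfolding mfoot_def by (rule foot_mob) (use axis_of_\<sigma> in auto)

lemma measurable_mob [measurable (raw)]:
  assumes [measurable]: "a \<in> borel_measurable M" "b \<in> borel_measurable M" "c \<in> borel_measurable M"
    "d \<in> borel_measurable M" "z \<in> borel_measurable M"
  shows "(\<lambda>x. mob (a x) (b x) (c x) (d x) (z x)) \<in> borel_measurable M"
  unfolding mob_def by measurable

lemma measurable_mfoot:
  assumes [measurable]: "h \<in> borel_measurable \<mu>"
  shows "(\<lambda>x. mfoot x (h x)) \<in> borel_measurable \<mu>"
  unfolding mfoot_def by measurable

definition \<Omega> :: "'a set" where "\<Omega> = {x \<in> space \<mu>. good v (\<sigma> x)}"

lemma \<Omega>D: "x \<in> \<Omega> \<Longrightarrow> x \<in> S" "x \<in> \<Omega> \<Longrightarrow> good v (\<sigma> x)" "x \<in> \<Omega> \<Longrightarrow> p (\<sigma> x) = x"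
  by (auto simp: \<Omega>_def space_mu p_\<sigma>)

lemma speed_iff:
  assumes "x \<in> S"
  shows "has_rotation_speed S p f x v \<longleftrightarrow> (\<lambda>n. hdist (\<sigma> x) ((F ^^ n) (\<sigma> x)) / real n) \<longlonglongrightarrow> v \<and>
      (\<lambda>n. hdist (\<sigma> x) ((G ^^ n) (\<sigma> x)) / real n) \<longlonglongrightarrow> v"
  using has_rotation_speed_iff[OF \<sigma>_in[OF assms]] p_\<sigma>[OF assms] by simp

lemma speed_measurable: "{x \<in> space \<mu>. has_rotation_speed S p f x v} \<in> sets \<mu>"
proof -
  have "{x \<in> space \<mu>. (\<lambda>n. hdist (\<sigma> x) ((F ^^ n) (\<sigma> x)) / real n) \<longlonglongrightarrow> v} \<in> sets \<mu>"
    "{x \<in> space \<mu>. (\<lambda>n. hdist (\<sigma> x) ((G ^^ n) (\<sigma> x)) / real n) \<longlonglongrightarrow> v} \<in> sets \<mu>"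
    using measurable_hdist_iter(2,3) by (intro sets_Collect_tendsto borel_measurable_divide; simp)+
  then have "{x \<in> space \<mu>. (\<lambda>n. hdist (\<sigma> x) ((F ^^ n) (\<sigma> x)) / real n) \<longlonglongrightarrow> v} \<inter>
    {x \<in> space \<mu>. (\<lambda>n. hdist (\<sigma> x) ((G ^^ n) (\<sigma> x)) / real n) \<longlonglongrightarrow> v} \<in> sets \<mu>" by (rule sets.Int)
  also have "{x \<in> space \<mu>. (\<lambda>n. hdist (\<sigma> x) ((F ^^ n) (\<sigma> x)) / real n) \<longlonglongrightarrow> v} \<inter>
    {x \<in> space \<mu>. (\<lambda>n. hdist (\<sigma> x) ((G ^^ n) (\<sigma> x)) / real n) \<longlonglongrightarrow> v} =
    {x \<in> space \<mu>. has_rotation_speed S p f x v}" using speed_iff by (auto simp: space_mu)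
  finally show ?thesis .
qed

lemma \<Omega>_eq: "\<Omega> = {x \<in> space \<mu>. has_rotation_speed S p f x v} - {x \<in> space \<mu>. end_fwd (\<sigma> x) = end_bwd (\<sigma> x)}"
  using v \<sigma>_in p_\<sigma> by (auto simp: \<Omega>_def good_def space_mu)

lemma ends_eq_measurable: "{x \<in> space \<mu>. end_fwd (\<sigma> x) = end_bwd (\<sigma> x)} \<in> sets \<mu>"
  by measurable

lemma \<Omega>_measurable [measurable]: "\<Omega> \<in> sets \<mu>"
  unfolding \<Omega>_eq using speed_measurable ends_eq_measurable by (rule sets.Diff)

lemma distr_f_inv_iter: "(f_inv ^^ n) \<in> measurable \<mu> \<mu> \<and> distr \<mu> \<mu> (f_inv ^^ n) = \<mu>"
proof (induction n)
  case 0
  then show ?case using distr_id[of \<mu>] by (simp add: id_def)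
next
  case (Suc n)
  then have m[measurable]: "(f_inv ^^ n) \<in> measurable \<mu> \<mu>" by simp
  have "distr \<mu> \<mu> (f_inv \<circ> (f_inv ^^ n)) = distr (distr \<mu> \<mu> (f_inv ^^ n)) \<mu> f_inv"
    by (rule distr_distr[symmetric]) measurable
  then show ?case using Suc distr_f_inv by (auto simp del: o_apply)
qed

text \<open>If the two endpoints agreed, the distance from \<open>F\<^sup>-\<^sup>n z\<close> to \<open>F\<^sup>n z\<close> would be sublinear. By
  invariance of \<open>\<mu>\<close>, its mean is that of the distance from \<open>z\<close> to \<open>F\<^sup>2\<^sup>n z\<close>, which grows
  like \<open>2nv\<close>, the largest value that the triangle inequality permits.\<close>

lemma AE_\<Omega>: "AE x in \<mu>. x \<in> \<Omega>"
proof -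
  define Z where "Z = {x \<in> space \<mu>. has_rotation_speed S p f x v} \<inter> {x \<in> space \<mu>. end_fwd (\<sigma> x) = end_bwd (\<sigma> x)}"
  have Zm[measurable]: "Z \<in> sets \<mu>" unfolding Z_def using speed_measurable ends_eq_measurable by (rule sets.Int)
  obtain C where C: "\<And>z n. z \<in> hplane \<Longrightarrow> hdist ((F ^^ n) z) ((F ^^ Suc n) z) \<le> C"
      "\<And>z n. z \<in> hplane \<Longrightarrow> hdist ((G ^^ n) z) ((G ^^ Suc n) z) \<le> C"
    using hdist_iter_step by blast
  have bF: "hdist z ((F ^^ n) z) \<le> real n * C" if "z \<in> hplane" for z n
  proof (induction n)
    case (Suc n)
    show ?case
      using Suc C(1)[OF that, of n] hdist_triangle[OF that iter_F_in[OF that, of n] iter_F_in[OF that, of "Suc n"]]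
      by (simp add: algebra_simps)
  qed simp
  have bG: "hdist z ((G ^^ n) z) \<le> real n * C" if "z \<in> hplane" for z n
  proof (induction n)
    case (Suc n)
    show ?case
      using Suc C(2)[OF that, of n] hdist_triangle[OF that iter_G_in[OF that, of n] iter_G_in[OF that, of "Suc n"]]
      by (simp add: algebra_simps)
  qed simp
  have C0: "0 \<le> C" using C(1)[OF i_in_hplane, of 0] hdist_nonneg[OF i_in_hplane F_in[OF i_in_hplane]] by simp
  define a where "a n x = hdist ((G ^^ n) (\<sigma> x)) ((F ^^ n) (\<sigma> x)) / real n" for n x
  define b where "b n x = (hdist (\<sigma> x) ((F ^^ n) (\<sigma> x)) + hdist (\<sigma> x) ((G ^^ n) (\<sigma> x))) / real n" for n x
  define d where "d n x = hdist (\<sigma> x) ((F ^^ (2 * n)) (\<sigma> x)) / real n" for n x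
  have [measurable]: "a n \<in> borel_measurable \<mu>" "b n \<in> borel_measurable \<mu>" "d n \<in> borel_measurable \<mu>" for n
    unfolding a_def[abs_def] b_def[abs_def] d_def[abs_def]
    using measurable_hdist_iter by (intro borel_measurable_divide borel_measurable_add; simp)+
  have ba: "0 \<le> a n x" "a n x \<le> b n x" "b n x \<le> 2 * C" "0 \<le> d n x" "d n x \<le> 2 * C" if x: "x \<in> space \<mu>" for n x
  proof -
    have z: "\<sigma> x \<in> hplane" using x \<sigma>_in space_mu by simp
    note i = iter_F_in[OF z] iter_G_in[OF z]
    show "0 \<le> a n x" "0 \<le> d n x" using hdist_nonneg z i by (auto simp: a_def d_def)
    show "a n x \<le> b n x" unfolding a_def b_def
      using hdist_triangle[OF i(2) z i(1), of n n] by (intro divide_right_mono) (auto simp: hdist_commute)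
    show "b n x \<le> 2 * C" "d n x \<le> 2 * C"
    proof -
      have "b n x \<le> (2 * (real n * C)) / real n" unfolding b_def
        using bF[OF z, of n] bG[OF z, of n] by (intro divide_right_mono) auto
      also have "\<dots> \<le> 2 * C" using C0 by (cases "n = 0") auto
      finally show "b n x \<le> 2 * C" .
      have "d n x \<le> (real (2 * n) * C) / real n" unfolding d_def
        using bF[OF z, of "2 * n"] by (intro divide_right_mono) auto
      also have "\<dots> \<le> 2 * C" using C0 by (cases "n = 0") auto
      finally show "d n x \<le> 2 * C" .
    qed
  qed
  have int: "integrable \<mu> (a n)" "integrable \<mu> (b n)" "integrable \<mu> (d n)" for n
    by (rule integrable_const_bound[of _ "2 * C"]; use ba[of _ n] in \<open>force intro!: AE_I2\<close>)+
  have ad: "(\<integral>x. a n x \<partial>\<mu>) = (\<integral>x. d n x \<partial>\<mu>)" for n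
  proof -
    have "a n x = d n ((f_inv ^^ n) x)" if x: "x \<in> space \<mu>" for x
    proof -
      have xS: "x \<in> S" using x space_mu by simp
      have z: "\<sigma> x \<in> hplane" by (rule \<sigma>_in[OF xS])
      have pz: "p ((G ^^ n) (\<sigma> x)) = (f_inv ^^ n) x" using p_iter_G[OF z] p_\<sigma>[OF xS] by simp
      have y: "(f_inv ^^ n) x \<in> S" using pz p_in_S[OF iter_G_in[OF z, of n]] by simp
      have "(F ^^ (2 * n)) ((G ^^ n) (\<sigma> x)) = (F ^^ n) (\<sigma> x)"
        using iter_F_iter_G[OF z, of n] by (simp add: mult_2 funpow_add)
      moreover have "displacement p f (2 * n) ((f_inv ^^ n) x)
          = hdist ((G ^^ n) (\<sigma> x)) ((F ^^ (2 * n)) ((G ^^ n) (\<sigma> x)))"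
        using displacement_eq[OF iter_G_in[OF z]] pz by metis
      moreover have "displacement p f (2 * n) ((f_inv ^^ n) x)
          = hdist (\<sigma> ((f_inv ^^ n) x)) ((F ^^ (2 * n)) (\<sigma> ((f_inv ^^ n) x)))"
        using displacement_eq[OF \<sigma>_in[OF y]] p_\<sigma>[OF y] by metis
      ultimately show ?thesis unfolding a_def d_def by simp
    qed
    then have "(\<integral>x. a n x \<partial>\<mu>) = (\<integral>x. d n ((f_inv ^^ n) x) \<partial>\<mu>)"
      by (intro Bochner_Integration.integral_cong) auto
    also have "\<dots> = (\<integral>x. d n x \<partial>distr \<mu> \<mu> (f_inv ^^ n))"
      using distr_f_inv_iter by (intro integral_distr[symmetric]) auto
    finally show ?thesis using distr_f_inv_iter by simp
  qed
  have Ld: "(\<lambda>n. \<integral>x. d n x \<partial>\<mu>) \<longlonglongrightarrow> (\<integral>x. 2 * v \<partial>\<mu>)"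
  proof (rule integral_dominated_convergence[of _ _ _ "\<lambda>_. 2 * C"])
    show "AE x in \<mu>. (\<lambda>n. d n x) \<longlonglongrightarrow> 2 * v"
      using speed AE_space
    proof eventually_elim
      case (elim x)
      then have "(\<lambda>n. hdist (\<sigma> x) ((F ^^ n) (\<sigma> x)) / real n) \<longlonglongrightarrow> v" using speed_iff space_mu by blast
      moreover have "filterlim (\<lambda>n::nat. 2 * n) at_top sequentially"
        by (rule filterlim_subseq) (auto simp: strict_mono_def)
      ultimately have "(\<lambda>n. hdist (\<sigma> x) ((F ^^ (2 * n)) (\<sigma> x)) / real (2 * n)) \<longlonglongrightarrow> v"
        by (rule filterlim_compose)
      then have "(\<lambda>n. 2 * (hdist (\<sigma> x) ((F ^^ (2 * n)) (\<sigma> x)) / real (2 * n))) \<longlonglongrightarrow> 2 * v"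
        by (intro tendsto_intros)
      then show ?case by (simp add: d_def)
    qed
    show "AE x in \<mu>. norm (d n x) \<le> 2 * C" for n using ba[of _ n] by (intro AE_I2) auto
  qed auto
  have limb: "(\<lambda>n. b n x) \<longlonglongrightarrow> 2 * v" if "x \<in> S" "has_rotation_speed S p f x v" for x
  proof -
    have "(\<lambda>n. hdist (\<sigma> x) ((F ^^ n) (\<sigma> x)) / real n + hdist (\<sigma> x) ((G ^^ n) (\<sigma> x)) / real n) \<longlonglongrightarrow> v + v"
      using speed_iff that by (intro tendsto_add) auto
    then show ?thesis by (simp add: b_def add_divide_distrib)
  qed
  have Lb: "(\<lambda>n. \<integral>x. b n x \<partial>\<mu>) \<longlonglongrightarrow> (\<integral>x. 2 * v \<partial>\<mu>)"
  proof (rule integral_dominated_convergence[of _ _ _ "\<lambda>_. 2 * C"])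
    show "AE x in \<mu>. (\<lambda>n. b n x) \<longlonglongrightarrow> 2 * v"
      using speed AE_space by eventually_elim (use limb space_mu in auto)
    show "AE x in \<mu>. norm (b n x) \<le> 2 * C" for n
      using ba[of _ n] by (intro AE_I2) (smt (verit) real_norm_def)
  qed auto
  have L0: "(\<lambda>n. (\<integral>x. b n x \<partial>\<mu>) - (\<integral>x. a n x \<partial>\<mu>)) \<longlonglongrightarrow> 0"
    using tendsto_diff[OF Lb Ld] by (simp add: ad)
  \<comment> \<open>On \<open>Z\<close> the integrand tends to 2v. It is dominated by the
    nonnegative b - a, whose mean tends to 0, which forces \<open>Z\<close> to be null.\<close>
  have LZ: "(\<lambda>n. \<integral>x. indicat_real Z x * (b n x - a n x) \<partial>\<mu>) \<longlonglongrightarrow> (\<integral>x. indicat_real Z x * (2 * v) \<partial>\<mu>)"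
  proof (rule integral_dominated_convergence[of _ _ _ "\<lambda>_. 2 * C"])
    show "AE x in \<mu>. (\<lambda>n. indicat_real Z x * (b n x - a n x)) \<longlonglongrightarrow> indicat_real Z x * (2 * v)"
    proof (rule AE_I2)
      fix x assume x: "x \<in> space \<mu>"
      show "(\<lambda>n. indicat_real Z x * (b n x - a n x)) \<longlonglongrightarrow> indicat_real Z x * (2 * v)"
      proof (cases "x \<in> Z")
        case True
        then have s: "x \<in> S" "has_rotation_speed S p f x v" "end_fwd (\<sigma> x) = end_bwd (\<sigma> x)"
          by (auto simp: Z_def space_mu)
        have "has_rotation_speed S p f (p (\<sigma> x)) v" using s p_\<sigma> by simp
        note e = endpoints[OF \<sigma>_in[OF s(1)] v this]
        have "(\<lambda>n. a n x) \<longlonglongrightarrow> 0"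
          unfolding a_def using regular_same_limit[OF e(2,1) v e(5)] e(3) s(3) by simp
        then have "(\<lambda>n. b n x - a n x) \<longlonglongrightarrow> 2 * v - 0" using limb[OF s(1,2)] by (intro tendsto_diff)
        then show ?thesis using True by simp
      qed simp
    qed
    show "AE x in \<mu>. norm (indicat_real Z x * (b n x - a n x)) \<le> 2 * C" for n
      using ba[of _ n] C0 by (intro AE_I2) (force simp: indicator_def)
  qed auto
  have "(\<integral>x. indicat_real Z x * (b n x - a n x) \<partial>\<mu>) \<le> (\<integral>x. b n x \<partial>\<mu>) - (\<integral>x. a n x \<partial>\<mu>)" for n
  proof -
    have "(\<integral>x. indicat_real Z x * (b n x - a n x) \<partial>\<mu>) \<le> (\<integral>x. b n x - a n x \<partial>\<mu>)"
    proof (rule integral_mono_AE)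
      show "integrable \<mu> (\<lambda>x. indicat_real Z x * (b n x - a n x))"
        using int integrable_real_mult_indicator[of Z \<mu> "\<lambda>x. b n x - a n x"] by (simp add: mult.commute)
      show "AE x in \<mu>. indicat_real Z x * (b n x - a n x) \<le> b n x - a n x"
        using ba[of _ n] by (intro AE_I2) (auto simp: indicator_def)
    qed (use int in auto)
    then show ?thesis using int by simp
  qed
  then have "(\<integral>x. indicat_real Z x * (2 * v) \<partial>\<mu>) \<le> 0"
    using LIMSEQ_le[OF LZ L0] by blast
  then have "prob Z * (2 * v) \<le> 0" using Zm by simp
  then have "prob Z = 0" using v measure_nonneg[of \<mu> Z] by (simp add: mult_le_0_iff)
  then have "Z \<in> null_sets \<mu>" using Zm by (simp add: null_sets_def emeasure_eq_measure)
  then have "AE x in \<mu>. x \<notin> Z" by (rule AE_not_in)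
  then show ?thesis
    using speed AE_space by eventually_elim (auto simp: \<Omega>_eq Z_def)
qed

subsection \<open>The cocycle of tangent vectors\<close>

text \<open>The default (\<open>\<i>\<close>, \<open>\<i>\<close>) is a unit tangent vector at
  \<open>\<i>\<close>, so that membership in \<open>T1_hplane\<close> holds for every x.\<close>

definition tlift :: "'a \<Rightarrow> real \<Rightarrow> complex \<times> complex" where
  "tlift x t = (if x \<in> \<Omega> then tang (track (\<sigma> x)) t else (\<i>, \<i>))"

definition vel :: "'a \<Rightarrow> real \<Rightarrow> (complex \<times> complex) set" where
  "vel x t = T1_proj p (tlift x t)"

definition \<tau> :: "'a \<Rightarrow> real" where
  "\<tau> x = (if x \<in> \<Omega> then progress (\<sigma> x) else 0)"

definition T1_borel :: "(complex \<times> complex) set measure" where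
  "T1_borel = sigma (topspace (T1 p)) {U. openin (T1 p) U}"

lemma space_T1_borel: "space T1_borel = topspace (T1 p)"
  unfolding T1_borel_def by (rule space_measure_of) (auto dest: openin_subset)

lemma openin_sets_T1_borel [simp]: "openin (T1 p) U \<Longrightarrow> U \<in> sets T1_borel"
  unfolding T1_borel_def by (subst sets_measure_of) (auto dest: openin_subset)

lemma tlift_in: "tlift x t \<in> T1_hplane"
proof (cases "x \<in> \<Omega>")
  case True
  then show ?thesis by (simp add: tlift_def tang_in_T1_hplane[OF track_line(1)[OF \<Omega>D(2)]])
qed (simp add: tlift_def T1_hplane_def)

lemma T1_proj_measurable: "T1_proj p \<in> measurable (restrict_space borel T1_hplane) T1_borel"
  unfolding T1_borel_def
proof (rule measurable_measure_of)
  show "T1_proj p \<in> space (restrict_space borel T1_hplane) \<rightarrow> topspace (T1 p)"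
    by (auto simp: space_restrict_space topspace_T1)
  fix U assume "U \<in> {U. openin (T1 p) U}"
  then obtain W where W: "open W" "{\<xi> \<in> T1_hplane. T1_proj p \<xi> \<in> U} = T1_hplane \<inter> W"
    unfolding openin_T1 openin_open by blast
  have "T1_proj p -` U \<inter> space (restrict_space borel T1_hplane) = T1_hplane \<inter> W"
    using W(2) by (auto simp: space_restrict_space)
  then show "T1_proj p -` U \<inter> space (restrict_space borel T1_hplane) \<in> sets (restrict_space borel T1_hplane)"
    using W(1) by (auto simp: sets_restrict_space)
qed (auto dest: openin_subset)

text \<open>Joint measurability in point and time, as Fubini requires; on \<Omega> the tangent
  vector is an explicit expression in the coefficients and the foot.\<close>

lemma tlift_measurable: "(\<lambda>y. tlift (fst y) (snd y)) \<in> measurable (\<mu> \<Otimes>\<^sub>M lborel) borel"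
proof -
  define h where "h y = (let w = vert (snd y + mfoot (fst y) (\<sigma> (fst y))) in
     (mob (ma (fst y)) (mb (fst y)) (mc (fst y)) (md (fst y)) w,
      w / (of_real (mc (fst y)) * w + of_real (md (fst y)))\<^sup>2))" for y
  have [measurable]: "vert \<in> borel_measurable borel" unfolding vert_def[abs_def] by measurable
  have [measurable]: "(\<lambda>x. mfoot x (\<sigma> x)) \<in> borel_measurable \<mu>" by (rule measurable_mfoot) measurable
  have [measurable]: "h \<in> borel_measurable (\<mu> \<Otimes>\<^sub>M lborel)"
    unfolding h_def[abs_def] Let_def borel_prod[symmetric] by measurable
  have "tlift (fst y) (snd y) = (if fst y \<in> \<Omega> then h y else (\<i>, \<i>))" for y
  proof (cases "fst y \<in> \<Omega>")
    case True
    note g = \<Omega>D(2)[OF True]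
    have "track (\<sigma> (fst y)) = (\<lambda>t. axis_of (\<sigma> (fst y)) (t + foot (axis_of (\<sigma> (fst y))) (\<sigma> (fst y))))"
      by (auto simp: track_def)
    then have "tang (track (\<sigma> (fst y))) (snd y) = tang (axis_of (\<sigma> (fst y))) (snd y + mfoot (fst y) (\<sigma> (fst y)))"
      using tang_shift[OF goodD(8)[OF g]] mfoot_eq[OF g goodD(1)[OF g]] by simp
    also have "\<dots> = h y" using tang_mob[OF axis_of_\<sigma>[OF g]] by (simp add: h_def Let_def)
    finally show ?thesis using True by (simp add: tlift_def)
  qed (simp add: tlift_def)
  then show ?thesis by simp
qed

lemma vel_measurable: "(\<lambda>y. vel (fst y) (snd y)) \<in> measurable (\<mu> \<Otimes>\<^sub>M lborel) T1_borel"
proof -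
  have "(\<lambda>y. tlift (fst y) (snd y)) \<in> measurable (\<mu> \<Otimes>\<^sub>M lborel) (restrict_space borel T1_hplane)"
    by (rule measurable_restrict_space2[OF _ tlift_measurable]) (use tlift_in in auto)
  from measurable_compose[OF this T1_proj_measurable] show ?thesis by (simp add: vel_def)
qed

lemma vel_measurable_fixed:
  assumes "x \<in> S"
  shows "vel x \<in> measurable borel T1_borel"
proof -
  have "(\<lambda>t. (x, t)) \<in> measurable borel (\<mu> \<Otimes>\<^sub>M lborel)"
    using assms by (intro measurable_Pair) (auto simp: space_mu)
  from measurable_compose[OF this vel_measurable] show ?thesis by simp
qed

lemma \<tau>_measurable [measurable]: "\<tau> \<in> borel_measurable \<mu>"
proof -
  have [measurable]: "(\<lambda>x. mfoot x (\<sigma> x)) \<in> borel_measurable \<mu>" "(\<lambda>x. mfoot x (F (\<sigma> x))) \<in> borel_measurable \<mu>"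
    by (rule measurable_mfoot, measurable)+
  have "\<tau> x = (if x \<in> \<Omega> then mfoot x (F (\<sigma> x)) - mfoot x (\<sigma> x) else 0)" for x
  proof (cases "x \<in> \<Omega>")
    case True
    note g = \<Omega>D(2)[OF True]
    have "track (\<sigma> x) = (\<lambda>t. axis_of (\<sigma> x) (t + foot (axis_of (\<sigma> x)) (\<sigma> x)))"
      by (auto simp: track_def)
    then have "progress (\<sigma> x) = foot (axis_of (\<sigma> x)) (F (\<sigma> x)) - foot (axis_of (\<sigma> x)) (\<sigma> x)"
      using foot_shift[OF goodD(8)[OF g] F_in[OF goodD(1)[OF g]]] by (simp add: progress_def)
    then show ?thesis using True mfoot_eq[OF g] goodD(1)[OF g] F_in by (simp add: \<tau>_def)
  qed (simp add: \<tau>_def)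
  then have "\<tau> = (\<lambda>x. if x \<in> \<Omega> then mfoot x (F (\<sigma> x)) - mfoot x (\<sigma> x) else 0)" by auto
  then show ?thesis by simp
qed

lemma \<tau>_bounded: "\<exists>C. \<forall>x. \<bar>\<tau> x\<bar> \<le> C"
proof -
  obtain C where "\<And>z. good v z \<Longrightarrow> \<bar>progress z\<bar> \<le> C" using progress_bounded by blast
  then have "\<bar>\<tau> x\<bar> \<le> max C 0" for x using \<Omega>D(2)[of x] by (auto simp: \<tau>_def le_max_iff_disj)
  then show ?thesis by blast
qed

text \<open>\<open>vel\<close> and \<tau> may be computed from any lift. This is needed because F^n
  (\<sigma> x) is in general not the chosen lift of f^n x.\<close>

lemma transfer_lift:
  assumes "good v z"
  shows "p z \<in> \<Omega>" "vel (p z) t = T1_proj p (tang (track z) t)" "\<tau> (p z) = progress z"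
proof -
  have z: "z \<in> hplane" by (rule goodD(1)[OF assms])
  have S: "p z \<in> S" by (rule p_in_S[OF z])
  obtain g where g: "g \<in> deck p" "g z = \<sigma> (p z)" using deck_trans[OF z \<sigma>_in[OF S]] p_\<sigma>[OF S] by auto
  have gs: "good v (\<sigma> (p z))" "\<And>t. track (\<sigma> (p z)) t = g (track z t)"
    using good_deck[OF assms g(1)] g(2) by auto
  show \<Omega>: "p z \<in> \<Omega>" using gs S by (simp add: \<Omega>_def space_mu)
  have "track (\<sigma> (p z)) = (\<lambda>t. g (track z t))" using gs by auto
  then have "tang (track (\<sigma> (p z))) t = dact g (tang (track z) t)"
    using tang_deck[OF track_line(1)[OF assms] g(1)] by simp
  then have "\<exists>g\<in>deck p. dact g (tang (track z) t) = tang (track (\<sigma> (p z))) t"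
    using g(1) by (intro bexI[of _ g]) simp
  then have "T1_proj p (tang (track z) t) = T1_proj p (tang (track (\<sigma> (p z))) t)"
    using T1_proj_eq_iff[OF tang_in_T1_hplane[OF track_line(1)[OF assms]] tang_in_T1_hplane[OF track_line(1)[OF gs(1)]]]
    by simp
  then show "vel (p z) t = T1_proj p (tang (track z) t)" using \<Omega> by (simp add: vel_def tlift_def)
  show "\<tau> (p z) = progress z" using \<Omega> progress_deck[OF assms g(1)] g(2) by (simp add: \<tau>_def)
qed

definition pos_fwd :: "'a \<Rightarrow> nat \<Rightarrow> real" where "pos_fwd x n = foot (track (\<sigma> x)) ((F ^^ n) (\<sigma> x))"
definition pos_bwd :: "'a \<Rightarrow> nat \<Rightarrow> real" where "pos_bwd x n = foot (track (\<sigma> x)) ((G ^^ n) (\<sigma> x))"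

text \<open>Everything along the orbit is expressed on the single line of x: velocities at shifted
  times, \<tau> as an increment of position, positions growing like n v.\<close>

lemma orbit_fwd:
  assumes "x \<in> \<Omega>"
  shows "vel ((f ^^ n) x) t = vel x (t + pos_fwd x n)" "\<tau> ((f ^^ n) x) = pos_fwd x (Suc n) - pos_fwd x n" "pos_fwd x 0 = 0"
    "(\<lambda>n. pos_fwd x n / real n) \<longlonglongrightarrow> v"
proof -
  note g = \<Omega>D(2)[OF assms]
  have pn: "p ((F ^^ n) (\<sigma> x)) = (f ^^ n) x" using p_iter_F[OF goodD(1)[OF g]] \<Omega>D(3)[OF assms] by simp
  note t = transfer_lift[OF good_iter(1)[OF g, of n], unfolded pn]
  have "track ((F ^^ n) (\<sigma> x)) = (\<lambda>t. track (\<sigma> x) (t + pos_fwd x n))"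
    using track_iter_F(1)[OF g, of n] by (auto simp: pos_fwd_def)
  then show "vel ((f ^^ n) x) t = vel x (t + pos_fwd x n)"
    using t(2)[of t] assms tang_shift[OF track_line(1)[OF g]] by (simp add: vel_def[of x] tlift_def)
  show "\<tau> ((f ^^ n) x) = pos_fwd x (Suc n) - pos_fwd x n" using t(3) track_iter_F(2)[OF g] by (simp add: pos_fwd_def)
  show "pos_fwd x 0 = 0" using track_line(2)[OF g] by (simp add: pos_fwd_def)
  show "(\<lambda>n. pos_fwd x n / real n) \<longlonglongrightarrow> v" unfolding pos_fwd_def by (rule foot_orbit_growth(1)[OF g])
qed

lemma orbit_bwd:
  assumes "x \<in> \<Omega>"
  shows "vel ((f_inv ^^ n) x) t = vel x (t + pos_bwd x n)" "\<tau> ((f_inv ^^ Suc n) x) = pos_bwd x n - pos_bwd x (Suc n)" "pos_bwd x 0 = 0"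
    "(\<lambda>n. pos_bwd x n / real n) \<longlonglongrightarrow> - v"
proof -
  note g = \<Omega>D(2)[OF assms]
  have pn: "p ((G ^^ n) (\<sigma> x)) = (f_inv ^^ n) x" for n using p_iter_G[OF goodD(1)[OF g]] \<Omega>D(3)[OF assms] by simp
  note t = transfer_lift[OF good_iter(2)[OF g], unfolded pn]
  have "track ((G ^^ n) (\<sigma> x)) = (\<lambda>t. track (\<sigma> x) (t + pos_bwd x n))"
    using track_iter_G(1)[OF g, of n] by (auto simp: pos_bwd_def)
  then show "vel ((f_inv ^^ n) x) t = vel x (t + pos_bwd x n)"
    using t(2)[of n t] assms tang_shift[OF track_line(1)[OF g]] by (simp add: vel_def[of x] tlift_def)
  show "\<tau> ((f_inv ^^ Suc n) x) = pos_bwd x n - pos_bwd x (Suc n)"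
    using t(3)[of "Suc n"] track_iter_G(2)[OF g, of n] unfolding pos_bwd_def by simp
  show "pos_bwd x 0 = 0" using track_line(2)[OF g] by (simp add: pos_bwd_def)
  show "(\<lambda>n. pos_bwd x n / real n) \<longlonglongrightarrow> - v" unfolding pos_bwd_def by (rule foot_orbit_growth(2)[OF g])
qed

end

subsection \<open>Signed time integrals\<close>

text \<open>The signed indicator of the interval from \<open>0\<close> to \<open>T\<close>. With half-open intervals the
  cocycle identity in \<open>T\<close> holds at every point, not just almost everywhere.\<close>

definition signed_ind :: "real \<Rightarrow> real \<Rightarrow> real" where
  "signed_ind T t = indicator {0<..} t - indicator {T<..} t"

definition signed_int :: "(real \<Rightarrow> real) \<Rightarrow> real \<Rightarrow> real" where
  "signed_int g T = (LINT t|lborel. signed_ind T t * g t)"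

lemma signed_ind_measurable [measurable]: "signed_ind T \<in> borel_measurable borel"
  unfolding signed_ind_def[abs_def] by measurable

lemma abs_krn_le: "\<bar>T\<bar> \<le> C \<Longrightarrow> \<bar>signed_ind T t\<bar> \<le> indicator {-C..C} t"
  by (auto simp: signed_ind_def indicator_def)

lemma signed_ind_integrable:
  assumes [measurable]: "g \<in> borel_measurable borel" and "\<And>t. \<bar>g t\<bar> \<le> 1"
  shows "integrable lborel (\<lambda>t. signed_ind T t * g t)"
proof (rule Bochner_Integration.integrable_bound)
  show "integrable lborel (indicat_real {- \<bar>T\<bar>..\<bar>T\<bar>})" by simp
  show "AE t in lborel. norm (signed_ind T t * g t) \<le> norm (indicat_real {- \<bar>T\<bar>..\<bar>T\<bar>} t)"
  proof (rule AE_I2)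
    fix t
    have "\<bar>signed_ind T t * g t\<bar> \<le> indicat_real {- \<bar>T\<bar>..\<bar>T\<bar>} t * 1"
      unfolding abs_mult by (rule mult_mono) (use abs_krn_le[of T "\<bar>T\<bar>" t] assms in auto)
    then show "norm (signed_ind T t * g t) \<le> norm (indicat_real {- \<bar>T\<bar>..\<bar>T\<bar>} t)" by simp
  qed
qed measurable

lemma signed_int_add:
  assumes g[measurable]: "g \<in> borel_measurable borel" and b: "\<And>t. \<bar>g t\<bar> \<le> 1"
  shows "signed_int g (a + c) = signed_int g a + signed_int (\<lambda>t. g (t + a)) c"
proof -
  have m: "(\<lambda>t. g (t + a)) \<in> borel_measurable borel" by measurable
  have "signed_int (\<lambda>t. g (t + a)) c = (LINT t|lborel. signed_ind c (t - a) * g t)"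
    unfolding signed_int_def
    using lborel_integral_real_affine[of 1 "\<lambda>t. signed_ind c (t - a) * g t" a] by (simp add: add.commute)
  moreover have i2: "integrable lborel (\<lambda>t. signed_ind c (t - a) * g t)"
    using lborel_integrable_real_affine[OF signed_ind_integrable[OF m, of c], of 1 "- a"] b by (simp add: add.commute)
  moreover have "signed_ind (a + c) t = signed_ind a t + signed_ind c (t - a)" for t
    by (auto simp: signed_ind_def indicator_def)
  ultimately show ?thesis
    unfolding signed_int_def using signed_ind_integrable[OF g b, of a]
    by (simp add: distrib_right)
qed

lemma signed_int_0 [simp]: "signed_int g 0 = 0"
  by (simp add: signed_int_def signed_ind_def)

lemma signed_int_const_1: "signed_int (\<lambda>_. 1) T = T"
proof (cases "T \<ge> 0")
  case True
  then have "signed_ind T t = indicator {0<..T} t" for t by (auto simp: signed_ind_def indicator_def)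
  then show ?thesis using True by (simp add: signed_int_def)
next
  case False
  then have "signed_ind T t = - indicator {T<..0} t" for t by (auto simp: signed_ind_def indicator_def)
  then show ?thesis using False by (simp add: signed_int_def)
qed

lemma abs_prim_le:
  assumes g[measurable]: "g \<in> borel_measurable borel" and b: "\<And>t. \<bar>g t\<bar> \<le> 1"
  shows "\<bar>signed_int g T\<bar> \<le> \<bar>T\<bar>"
proof -
  have "\<bar>signed_int g T\<bar> \<le> (LINT t|lborel. \<bar>signed_ind T t * g t\<bar>)"
    unfolding signed_int_def by (rule integral_abs_bound)
  also have "\<dots> \<le> (LINT t|lborel. \<bar>signed_ind T t\<bar>)"
  proof (rule integral_mono)
    show "integrable lborel (\<lambda>t. \<bar>signed_ind T t\<bar>)" using signed_ind_integrable[of "\<lambda>_. 1" T] by simp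
    show "\<bar>signed_ind T t * g t\<bar> \<le> \<bar>signed_ind T t\<bar>" for t
      unfolding abs_mult using b[of t] by (metis abs_ge_zero mult_left_le)
  qed (use signed_ind_integrable[OF g b] in auto)
  also have "\<dots> = \<bar>T\<bar>"
  proof (cases "T \<ge> 0")
    case True
    then have "\<bar>signed_ind T t\<bar> = indicator {0<..T} t" for t by (auto simp: signed_ind_def indicator_def)
    then show ?thesis using True by simp
  next
    case False
    then have "\<bar>signed_ind T t\<bar> = indicator {T<..0} t" for t by (auto simp: signed_ind_def indicator_def)
    then show ?thesis using False by simp
  qed
  finally show ?thesis .
qed

lemma signed_int_lipschitz:
  assumes g[measurable]: "g \<in> borel_measurable borel" and b: "\<And>t. \<bar>g t\<bar> \<le> 1"
  shows "\<bar>signed_int g a - signed_int g c\<bar> \<le> \<bar>a - c\<bar>"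
proof -
  have "signed_int g a = signed_int g c + signed_int (\<lambda>t. g (t + c)) (a - c)"
    using signed_int_add[OF g b, of c "a - c"] by simp
  then show ?thesis using abs_prim_le[of "\<lambda>t. g (t + c)" "a - c"] b by simp
qed

text \<open>The times r n need not be monotone, so T is not placed between two of them. It is
  compared with r n for n = floor (T / v), and the Lipschitz property makes the error
  sublinear.\<close>

lemma lipschitz_average_limit:
  fixes P :: "real \<Rightarrow> real" and r :: "nat \<Rightarrow> real"
  assumes lip: "\<And>a b. \<bar>P a - P b\<bar> \<le> \<bar>a - b\<bar>" and "v > 0"
    and r: "(\<lambda>n. r n / real n) \<longlonglongrightarrow> v" and P: "(\<lambda>n. P (r n) / real n) \<longlonglongrightarrow> m"
  shows "((\<lambda>T. P T / T) \<longlongrightarrow> m / v) at_top"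
proof (rule tendstoI)
  fix e :: real assume "e > 0"
  \<comment> \<open>Two errors \<epsilon> n with n at most T / v then add up to at most e T /
    2.\<close>
  define \<epsilon> where "\<epsilon> = e * v / 4"
  have \<epsilon>: "\<epsilon> > 0" using \<open>e > 0\<close> \<open>v > 0\<close> by (simp add: \<epsilon>_def)
  obtain B1 where B1: "\<And>n. \<bar>r n - v * real n\<bar> \<le> \<epsilon> * real n + B1"
    using r \<epsilon> unfolding linear_growth_iff by blast
  obtain B2 where B2: "\<And>n. \<bar>P (r n) - m * real n\<bar> \<le> \<epsilon> * real n + B2"
    using P \<epsilon> unfolding linear_growth_iff by blast
  define B where "B = v + B1 + B2 + \<bar>m\<bar>"
  have bound: "\<bar>P T - m / v * T\<bar> \<le> e / 2 * T + B" if "T > 0" for T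
  proof -
    define n where "n = nat \<lfloor>T / v\<rfloor>"
    have "T / v \<ge> 0" using that \<open>v > 0\<close> by simp
    then have n: "real n \<le> T / v" "T / v < real n + 1"
      unfolding n_def by linarith+
    have n': "v * real n \<le> T" "T < v * real n + v"
      using n \<open>v > 0\<close> by (simp_all add: field_simps)
    have 1: "\<bar>T - v * real n\<bar> \<le> v" using n' by linarith
    have 2: "\<bar>P T - P (r n)\<bar> \<le> v + (\<epsilon> * real n + B1)"
      using lip[of T "r n"] 1 B1[of n] by linarith
    have "\<bar>m * real n - m / v * T\<bar> = \<bar>m\<bar> * \<bar>real n - T / v\<bar>"
      by (simp flip: abs_mult add: right_diff_distrib)
    also have "\<dots> \<le> \<bar>m\<bar> * 1" using n by (intro mult_left_mono) auto
    finally have 3: "\<bar>m * real n - m / v * T\<bar> \<le> \<bar>m\<bar>" by simp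
    have "2 * \<epsilon> * real n \<le> 2 * \<epsilon> * (T / v)" using n(1) \<epsilon> by (intro mult_left_mono) auto
    also have "\<dots> = e / 2 * T" using \<open>v > 0\<close> by (simp add: \<epsilon>_def)
    finally show ?thesis using 2 3 B2[of n] unfolding B_def by linarith
  qed
  have "eventually (\<lambda>T. T > max 0 (2 * B / e)) at_top" by (rule eventually_gt_at_top)
  then show "eventually (\<lambda>T. dist (P T / T) (m / v) < e) at_top"
  proof eventually_elim
    case (elim T)
    then have T: "T > 0" "2 * B / e < T" by auto
    then have "B < e / 2 * T" using \<open>e > 0\<close> by (simp add: field_simps)
    then have lt: "\<bar>P T - m / v * T\<bar> < e * T" using bound[OF T(1)] by simp
    have "P T / T - m / v = (P T - m / v * T) / T" using T(1) by (simp add: diff_divide_distrib)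
    then have "dist (P T / T) (m / v) = \<bar>P T - m / v * T\<bar> / T" using T(1) by (simp add: dist_real_def)
    also have "\<dots> < e" using lt T(1) by (simp add: pos_divide_less_eq)
    finally show ?case .
  qed
qed

context ergodic_surface
begin

subsection \<open>The limit measure\<close>

definition visit :: "(complex \<times> complex) set set \<Rightarrow> 'a \<Rightarrow> real \<Rightarrow> real" where
  "visit A x t = indicator A (vel x t)"

lemma visit_measurable: "A \<in> sets T1_borel \<Longrightarrow> x \<in> S \<Longrightarrow> visit A x \<in> borel_measurable borel"
  unfolding visit_def[abs_def] using measurable_compose[OF vel_measurable_fixed borel_measurable_indicator] .

lemma visit_bound: "\<bar>visit A x t\<bar> \<le> 1" "0 \<le> visit A x t"
  by (auto simp: visit_def indicator_def)

definition \<Phi> :: "(complex \<times> complex) set set \<Rightarrow> 'a \<Rightarrow> real" where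
  "\<Phi> A x = signed_int (visit A x) (\<tau> x)"

text \<open>Density, with respect to the product of \<mu> and Lebesgue measure, of a finite signed
  measure carried by the times between 0 and \<tau>.\<close>

definition weight :: "'a \<times> real \<Rightarrow> real" where
  "weight y = signed_ind (\<tau> (fst y)) (snd y)"

definition vel_vimage :: "(complex \<times> complex) set set \<Rightarrow> ('a \<times> real) set" where
  "vel_vimage A = {y \<in> space (\<mu> \<Otimes>\<^sub>M lborel). vel (fst y) (snd y) \<in> A}"

lemma vel_vimage_measurable: "A \<in> sets T1_borel \<Longrightarrow> vel_vimage A \<in> sets (\<mu> \<Otimes>\<^sub>M lborel)"
  unfolding vel_vimage_def using measurable_sets[OF vel_measurable, of A]
  by (simp add: vimage_def Int_def conj_commute)

lemma weight_measurable [measurable]: "weight \<in> borel_measurable (\<mu> \<Otimes>\<^sub>M lborel)"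
proof -
  have "weight = (\<lambda>y. (if 0 < snd y then 1 else 0) - (if \<tau> (fst y) < snd y then 1 else 0))"
    by (auto simp: weight_def signed_ind_def indicator_def)
  then show ?thesis by simp
qed

lemma weight_integrable: "integrable (\<mu> \<Otimes>\<^sub>M lborel) weight"
proof -
  obtain C where C: "\<And>x. \<bar>\<tau> x\<bar> \<le> C" using \<tau>_bounded by blast
  have e: "emeasure (\<mu> \<Otimes>\<^sub>M lborel) (space \<mu> \<times> {-C..C}) < \<infinity>"
    by (subst lborel.emeasure_pair_measure_Times) (auto simp: emeasure_space_1 emeasure_lborel_Icc_eq)
  show ?thesis
  proof (rule integrableI_bounded_set[where A = "space \<mu> \<times> {-C..C}" and B = 1])
    show "AE y in \<mu> \<Otimes>\<^sub>M (lborel :: real measure). y \<in> space \<mu> \<times> {- C..C} \<longrightarrow> norm (weight y) \<le> 1"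
      by (rule AE_I2) (auto simp: weight_def signed_ind_def indicator_def)
    show "AE y in \<mu> \<Otimes>\<^sub>M (lborel :: real measure). y \<notin> space \<mu> \<times> {- C..C} \<longrightarrow> weight y = 0"
    proof (rule AE_I2)
      fix y assume "y \<in> space (\<mu> \<Otimes>\<^sub>M (lborel :: real measure))"
      then show "y \<notin> space \<mu> \<times> {- C..C} \<longrightarrow> weight y = 0"
        using abs_krn_le[OF C[of "fst y"], of "snd y"]
        by (auto simp: weight_def space_pair_measure mem_Times_iff indicator_def split: if_splits)
    qed
  qed (use e in auto)
qed

text \<open>The image under \<open>vel\<close> of the signed measure with density
  \<open>weight\<close>. In this form it is countably additive; by Fubini (\<open>mass_eq\<close>)
  it is a mean over \<mu>, to which Birkhoff's theorem applies.\<close>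

definition mass :: "(complex \<times> complex) set set \<Rightarrow> real" where
  "mass A = (LINT y:vel_vimage A|(\<mu> \<Otimes>\<^sub>M lborel). weight y)"

lemma pair_sigma_finite_mu: "pair_sigma_finite \<mu> (lborel :: real measure)"
  by (intro pair_sigma_finite.intro sigma_finite_lborel) (simp add: sigma_finite_measure_axioms)

lemma weight_restrict_integrable:
  "A \<in> sets T1_borel \<Longrightarrow> integrable (\<mu> \<Otimes>\<^sub>M lborel) (\<lambda>y. indicat_real (vel_vimage A) y *\<^sub>R weight y)"
  using integrable_mult_indicator[OF vel_vimage_measurable weight_integrable] .

lemma \<Phi>_eq: "x \<in> space \<mu> \<Longrightarrow> \<Phi> A x = (LINT t|lborel. indicat_real (vel_vimage A) (x, t) *\<^sub>R weight (x, t))"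
  unfolding \<Phi>_def signed_int_def
  by (rule Bochner_Integration.integral_cong)
     (auto simp: visit_def weight_def vel_vimage_def indicator_def space_pair_measure)

lemma mass_eq: "A \<in> sets T1_borel \<Longrightarrow> mass A = (\<integral>x. \<Phi> A x \<partial>\<mu>)"
  using pair_sigma_finite.integral_fst'[OF pair_sigma_finite_mu weight_restrict_integrable, of A]
  unfolding mass_def set_lebesgue_integral_def
  by (simp add: \<Phi>_eq cong: Bochner_Integration.integral_cong)

lemma \<Phi>_measurable:
  assumes "A \<in> sets T1_borel"
  shows "\<Phi> A \<in> borel_measurable \<mu>"
proof -
  have m: "(\<lambda>y. indicat_real (vel_vimage A) y *\<^sub>R weight y) \<in> borel_measurable (\<mu> \<Otimes>\<^sub>M lborel)"
    by (rule borel_measurable_integrable[OF weight_restrict_integrable[OF assms]])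
  have "(\<lambda>x. LINT t|lborel. indicat_real (vel_vimage A) (x, t) *\<^sub>R weight (x, t)) \<in> borel_measurable \<mu>"
    by (rule lborel.borel_measurable_lebesgue_integral) (use m in \<open>simp add: case_prod_beta'\<close>)
  then show ?thesis by (rule measurable_cong[THEN iffD1, rotated]) (simp add: \<Phi>_eq)
qed

lemma \<Phi>_bounded: "\<exists>C. \<forall>A\<in>sets T1_borel. \<forall>x\<in>S. \<bar>\<Phi> A x\<bar> \<le> C"
proof -
  obtain C where C: "\<And>x. \<bar>\<tau> x\<bar> \<le> C" using \<tau>_bounded by blast
  have "\<bar>\<Phi> A x\<bar> \<le> C" if "A \<in> sets T1_borel" "x \<in> S" for A x
    unfolding \<Phi>_def using abs_prim_le[OF visit_measurable[OF that] visit_bound(1)] C[of x] order_trans by blast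
  then show ?thesis by blast
qed

text \<open>By the cocycle identity \<open>signed_int_add\<close>, each summand is an increment of
  one primitive on the line of x.\<close>

lemma \<Phi>_sum_fwd:
  assumes "A \<in> sets T1_borel" "x \<in> \<Omega>"
  shows "(\<Sum>k<n. \<Phi> A ((f ^^ k) x)) = signed_int (visit A x) (pos_fwd x n)"
proof (induction n)
  case 0
  then show ?case by (simp add: orbit_fwd(3)[OF assms(2)])
next
  case (Suc n)
  have "visit A ((f ^^ n) x) = (\<lambda>t. visit A x (t + pos_fwd x n))"
    by (simp add: visit_def[abs_def] orbit_fwd(1)[OF assms(2)])
  then have "\<Phi> A ((f ^^ n) x) = signed_int (\<lambda>t. visit A x (t + pos_fwd x n)) (pos_fwd x (Suc n) - pos_fwd x n)"
    by (simp add: \<Phi>_def orbit_fwd(2)[OF assms(2)])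
  also have "\<dots> = signed_int (visit A x) (pos_fwd x (Suc n)) - signed_int (visit A x) (pos_fwd x n)"
    using signed_int_add[OF visit_measurable[OF assms(1) \<Omega>D(1)[OF assms(2)]] visit_bound(1), of "pos_fwd x n" "pos_fwd x (Suc n) - pos_fwd x n"]
    by simp
  finally show ?case using Suc by simp
qed

text \<open>The sum starts at the first preimage, because \<tau> there spans the stretch of the line
  from \<open>pos_bwd x 1\<close> to \<open>pos_bwd x 0\<close>.\<close>

lemma \<Phi>_sum_bwd:
  assumes "A \<in> sets T1_borel" "x \<in> \<Omega>"
  shows "(\<Sum>k<n. \<Phi> A ((f_inv ^^ Suc k) x)) = - signed_int (visit A x) (pos_bwd x n)"
proof (induction n)
  case 0
  then show ?case by (simp add: orbit_bwd(3)[OF assms(2)])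
next
  case (Suc n)
  have "visit A ((f_inv ^^ Suc n) x) = (\<lambda>t. visit A x (t + pos_bwd x (Suc n)))"
    unfolding visit_def[abs_def] orbit_bwd(1)[OF assms(2)] ..
  then have "\<Phi> A ((f_inv ^^ Suc n) x) = signed_int (\<lambda>t. visit A x (t + pos_bwd x (Suc n))) (pos_bwd x n - pos_bwd x (Suc n))"
    unfolding \<Phi>_def orbit_bwd(2)[OF assms(2)] by simp
  also have "\<dots> = signed_int (visit A x) (pos_bwd x n) - signed_int (visit A x) (pos_bwd x (Suc n))"
    using signed_int_add[OF visit_measurable[OF assms(1) \<Omega>D(1)[OF assms(2)]] visit_bound(1), of "pos_bwd x (Suc n)" "pos_bwd x n - pos_bwd x (Suc n)"]
    by simp
  finally show ?case using Suc by simp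
qed

text \<open>Birkhoff's theorem for f and for its inverse gives averages at the positions of the
  orbit points; \<open>lipschitz_average_limit\<close> passes to all real times.\<close>

lemma AE_frequency:
  assumes A: "A \<in> sets T1_borel"
  shows "AE x in \<mu>. x \<in> \<Omega> \<and> ((\<lambda>T. signed_int (visit A x) T / T) \<longlongrightarrow> mass A / v) at_top \<and>
    ((\<lambda>T. - signed_int (visit A x) (- T) / T) \<longlongrightarrow> mass A / v) at_top"
proof -
  obtain C where C: "\<And>x. x \<in> S \<Longrightarrow> \<bar>\<Phi> A x\<bar> \<le> C" using \<Phi>_bounded A by blast
  have C': "\<And>x. x \<in> space \<mu> \<Longrightarrow> \<bar>\<Phi> A x\<bar> \<le> C" using C space_mu by simp
  have "AE x in \<mu>. (\<lambda>n. (\<Sum>k<n. \<Phi> A ((f ^^ k) x)) / real n) \<longlonglongrightarrow> mass A"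
    unfolding mass_eq[OF A] by (rule birkhoff[OF f_measurable distr_f erg \<Phi>_measurable[OF A]]) (rule C')
  moreover have "AE x in \<mu>. (\<lambda>n. (\<Sum>k<n. \<Phi> A ((f_inv ^^ k) x)) / real n) \<longlonglongrightarrow> mass A"
    unfolding mass_eq[OF A] by (rule birkhoff[OF f_inv_measurable distr_f_inv erg_inv \<Phi>_measurable[OF A]]) (rule C')
  ultimately show ?thesis
    using AE_\<Omega>
  proof eventually_elim
    case (elim x)
    have xS: "x \<in> S" by (rule \<Omega>D(1)[OF elim(3)])
    note lip = signed_int_lipschitz[OF visit_measurable[OF A xS] visit_bound(1)]
    have "((\<lambda>T. signed_int (visit A x) T / T) \<longlongrightarrow> mass A / v) at_top"
    proof (rule lipschitz_average_limit[OF lip v orbit_fwd(4)[OF elim(3)]])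
      show "(\<lambda>n. signed_int (visit A x) (pos_fwd x n) / real n) \<longlonglongrightarrow> mass A"
        using elim(1) by (simp add: \<Phi>_sum_fwd[OF A elim(3)])
    qed
    moreover have "((\<lambda>T. - signed_int (visit A x) (- T) / T) \<longlongrightarrow> mass A / v) at_top"
    proof (rule lipschitz_average_limit[where r = "\<lambda>n. - pos_bwd x n" and P = "\<lambda>T. - signed_int (visit A x) (- T)"])
      show "\<bar>- signed_int (visit A x) (- a) - - signed_int (visit A x) (- b)\<bar> \<le> \<bar>a - b\<bar>" for a b
        using lip[of "- a" "- b"] by linarith
      show "(\<lambda>n. - pos_bwd x n / real n) \<longlonglongrightarrow> v"
        using tendsto_minus[OF orbit_bwd(4)[OF elim(3)]] by simp
      have "(f_inv ^^ k) x \<in> S" for k by (induction k) (auto simp: f_inv_in xS)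
      then have b: "\<bar>\<Phi> A ((f_inv ^^ k) x)\<bar> \<le> C" for k using C by blast
      \<comment> \<open>Birkhoff sums start at x itself; the index shift changes them by two bounded
        terms.\<close>
      have "(\<lambda>n. (\<Sum>k<n. \<Phi> A ((f_inv ^^ Suc k) x)) / real n) \<longlonglongrightarrow> mass A"
      proof (rule bounded_perturbation_speed[OF elim(2)])
        show "\<bar>(\<Sum>k<n. \<Phi> A ((f_inv ^^ Suc k) x)) - (\<Sum>k<n. \<Phi> A ((f_inv ^^ k) x))\<bar> \<le> 2 * C" for n
        proof -
          have "(\<Sum>k<n. \<Phi> A ((f_inv ^^ Suc k) x)) - (\<Sum>k<n. \<Phi> A ((f_inv ^^ k) x))
              = \<Phi> A ((f_inv ^^ n) x) - \<Phi> A ((f_inv ^^ 0) x)"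
            unfolding sum_subtractf[symmetric] by (rule sum_lessThan_telescope)
          then show ?thesis using b[of n] b[of 0] by linarith
        qed
      qed
      then show "(\<lambda>n. - signed_int (visit A x) (- (- pos_bwd x n)) / real n) \<longlonglongrightarrow> mass A"
        by (simp only: \<Phi>_sum_bwd[OF A elim(3)] minus_minus)
    qed (rule v)
    ultimately show ?case using elim(3) by blast
  qed
qed

text \<open>A claim about \<open>mass\<close> does not mention x, so one typical point suffices to
  prove it.\<close>

lemma exists_frequency:
  assumes "A \<in> sets T1_borel" "AE x in \<mu>. P x"
  shows "\<exists>x. x \<in> \<Omega> \<and> P x \<and> ((\<lambda>T. signed_int (visit A x) T / T) \<longlongrightarrow> mass A / v) at_top"
proof -
  have *: "AE x in \<mu>. x \<in> \<Omega> \<and> P x \<and> ((\<lambda>T. signed_int (visit A x) T / T) \<longlongrightarrow> mass A / v) at_top"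
    using AE_frequency[OF assms(1)] assms(2) by eventually_elim auto
  show ?thesis
  proof (rule ccontr)
    assume "\<not> ?thesis"
    with * have "AE x in \<mu>. False" by (elim eventually_mono) blast
    then show False by simp
  qed
qed

text \<open>The integrand \<open>weight\<close> is negative where \<tau> < 0, so the sign is taken
  from the frequencies, which for T > 0 are averages of an indicator.\<close>

lemma mass_nonneg:
  assumes "A \<in> sets T1_borel"
  shows "0 \<le> mass A"
proof -
  obtain x where x: "((\<lambda>T. signed_int (visit A x) T / T) \<longlongrightarrow> mass A / v) at_top"
    using exists_frequency[OF assms, of "\<lambda>_. True"] by auto
  have h: "0 \<le> signed_int (visit A x) T / T" if "0 < T" for T
  proof -
    have "0 \<le> signed_int (visit A x) T"
      unfolding signed_int_def using that visit_bound(2)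
      by (intro Bochner_Integration.integral_nonneg mult_nonneg_nonneg) (auto simp: signed_ind_def indicator_def)
    then show ?thesis using that by simp
  qed
  have "eventually (\<lambda>T. 0 \<le> signed_int (visit A x) T / T) at_top"
    by (rule eventually_mono[OF eventually_gt_at_top[of 0] h])
  from tendsto_lowerbound[OF x this] have "0 \<le> mass A / v" by simp
  then show ?thesis using v by (simp add: zero_le_divide_iff)
qed

lemma mass_sums:
  fixes A :: "nat \<Rightarrow> _"
  assumes A: "\<And>i. A i \<in> sets T1_borel" and "disjoint_family A"
  shows "mass (\<Union>i. A i) = (\<Sum>i. mass (A i))" "summable (\<lambda>i. mass (A i))"
proof -
  have disj: "vel_vimage (A i) \<inter> vel_vimage (A j) = {}" if "i \<noteq> j" for i j
    using assms(2) that by (auto simp: vel_vimage_def disjoint_family_on_def)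
  have U: "vel_vimage (\<Union>i\<in>I. A i) = (\<Union>i\<in>I. vel_vimage (A i))" for I by (auto simp: vel_vimage_def)
  have int: "set_integrable (\<mu> \<Otimes>\<^sub>M lborel) X weight" if "X \<in> sets (\<mu> \<Otimes>\<^sub>M lborel)" for X
    unfolding set_integrable_def using integrable_mult_indicator[OF that weight_integrable] .
  show "mass (\<Union>i. A i) = (\<Sum>i. mass (A i))"
    unfolding mass_def U
    by (rule lebesgue_integral_countable_add[OF vel_vimage_measurable[OF A] disj int])
       (use vel_vimage_measurable[OF A] in auto)
  have fin: "(\<Sum>i<n. mass (A i)) = mass (\<Union>i<n. A i)" for n
    unfolding mass_def U
    by (rule set_integral_finite_Union[symmetric])
       (use vel_vimage_measurable[OF A] disj int in \<open>auto simp: disjoint_family_on_def\<close>)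
  \<comment> \<open>The L1 norm of \<open>weight\<close> bounds all partial sums, and nonnegativity
    then gives summability.\<close>
  have "(\<Sum>i<n. mass (A i)) \<le> (LINT y|(\<mu> \<Otimes>\<^sub>M lborel). \<bar>weight y\<bar>)" for n
  proof -
    have "mass (\<Union>i<n. A i) \<le> (LINT y|(\<mu> \<Otimes>\<^sub>M lborel). \<bar>weight y\<bar>)"
      unfolding mass_def set_lebesgue_integral_def
      by (rule integral_mono[OF weight_restrict_integrable integrable_abs[OF weight_integrable]])
         (use A in \<open>auto simp: indicator_def\<close>)
    then show ?thesis by (simp add: fin)
  qed
  then show "summable (\<lambda>i. mass (A i))"
    by (intro summableI_nonneg_bounded mass_nonneg A) auto
qed

definition \<nu> :: "(complex \<times> complex) set measure" where
  "\<nu> = measure_of (space T1_borel) (sets T1_borel) (\<lambda>A. ennreal (mass A / v))"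

lemma sets_\<nu> [simp]: "sets \<nu> = sets T1_borel"
  unfolding \<nu>_def by (rule sets.sets_measure_of_eq)

lemma space_\<nu>: "space \<nu> = topspace (T1 p)"
  unfolding \<nu>_def sets.space_measure_of_eq by (rule space_T1_borel)

lemma emeasure_\<nu>:
  assumes "A \<in> sets T1_borel"
  shows "emeasure \<nu> A = ennreal (mass A / v)"
  unfolding \<nu>_def
proof (rule emeasure_measure_of_sigma[OF sets.sigma_algebra_axioms _ _ assms])
  show "positive (sets T1_borel) (\<lambda>A. ennreal (mass A / v))"
    by (simp add: positive_def mass_def vel_vimage_def set_lebesgue_integral_def)
  show "countably_additive (sets T1_borel) (\<lambda>A. ennreal (mass A / v))"
    unfolding countably_additive_def
  proof (intro allI impI)
    fix A :: "nat \<Rightarrow> _" assume A: "range A \<subseteq> sets T1_borel" "disjoint_family A" "\<Union> (range A) \<in> sets T1_borel"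
    then have A': "\<And>i. A i \<in> sets T1_borel" by blast
    note m = mass_sums[OF A' A(2)]
    have "(\<Sum>i. ennreal (mass (A i) / v)) = ennreal (\<Sum>i. mass (A i) / v)"
      by (rule suminf_ennreal2) (use mass_nonneg[OF A'] v m(2) in \<open>auto intro: summable_divide\<close>)
    also have "(\<Sum>i. mass (A i) / v) = mass (\<Union>i. A i) / v"
      using suminf_divide[OF m(2), of v] m(1) by simp
    finally show "(\<Sum>i. ennreal (mass (A i) / v)) = ennreal (mass (\<Union> (range A)) / v)" by simp
  qed
qed

lemma measure_\<nu>: "A \<in> sets T1_borel \<Longrightarrow> measure \<nu> A = mass A / v"
  using mass_nonneg[of A] v by (simp add: measure_def emeasure_\<nu>)

lemma vel_in: "vel x t \<in> topspace (T1 p)"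
  using tlift_in by (auto simp: vel_def topspace_T1)

lemma prob_space_\<nu>: "prob_space \<nu>"
proof
  have top: "topspace (T1 p) \<in> sets T1_borel" by simp
  obtain x where x: "((\<lambda>T. signed_int (visit (topspace (T1 p)) x) T / T) \<longlongrightarrow> mass (topspace (T1 p)) / v) at_top"
    using exists_frequency[OF top, of "\<lambda>_. True"] by auto
  have "visit (topspace (T1 p)) x = (\<lambda>_. 1)" using vel_in by (auto simp: visit_def)
  then have h: "signed_int (visit (topspace (T1 p)) x) T / T = 1" if "0 < T" for T
    using that by (simp add: signed_int_const_1)
  have "eventually (\<lambda>T. signed_int (visit (topspace (T1 p)) x) T / T = 1) at_top"
    by (rule eventually_mono[OF eventually_gt_at_top[of 0] h])
  then have "((\<lambda>T. signed_int (visit (topspace (T1 p)) x) T / T) \<longlongrightarrow> 1) at_top" by (rule tendsto_eventually)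
  then have "mass (topspace (T1 p)) / v = 1" using tendsto_unique[OF _ x] by simp
  then show "emeasure \<nu> (space \<nu>) = 1" by (simp add: space_\<nu> emeasure_\<nu>)
qed

lemma borel_prob_\<nu>: "borel_prob_on (T1 p) \<nu>"
  using prob_space_\<nu> by (simp add: borel_prob_on_def T1_borel_def)

subsection \<open>Invariance, ergodicity and support\<close>

abbreviation gf :: "real \<Rightarrow> (complex \<times> complex) set \<Rightarrow> (complex \<times> complex) set" where
  "gf \<equiv> geodesic_flow S p"

lemma gf_in: "\<xi> \<in> topspace (T1 p) \<Longrightarrow> gf t \<xi> \<in> topspace (T1 p)"
  using geodesic_flow_proj hflow_in_T1_hplane by (auto simp: topspace_T1)

lemma gf_V:
  assumes "x \<in> \<Omega>"
  shows "gf t (vel x r) = vel x (r + t)"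
  using geodesic_flow_proj[OF tlift_in[of x r], of t] hflow_tang[OF track_line(1)[OF \<Omega>D(2)[OF assms]], of t r] assms
  by (simp add: vel_def tlift_def add.commute)

lemma openin_gf_vimage:
  assumes "openin (T1 p) U"
  shows "openin (T1 p) (gf t -` U \<inter> topspace (T1 p))"
proof -
  define W where "W = {\<xi> \<in> T1_hplane. T1_proj p \<xi> \<in> U}"
  have W: "openin (top_of_set T1_hplane) W" using assms openin_T1 unfolding W_def by blast
  have "{\<xi> \<in> T1_hplane. T1_proj p \<xi> \<in> gf t -` U \<inter> topspace (T1 p)} = T1_hplane \<inter> hflow t -` W"
    using geodesic_flow_proj hflow_in_T1_hplane by (auto simp: topspace_T1 W_def)
  moreover have "openin (top_of_set T1_hplane) (T1_hplane \<inter> hflow t -` W)"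
    using continuous_openin_preimage[OF continuous_on_hflow _ W] hflow_in_T1_hplane by blast
  ultimately show ?thesis using openin_T1[of p "gf t -` U \<inter> topspace (T1 p)"] by (auto simp: topspace_T1)
qed

lemma gf_measurable: "gf t \<in> measurable T1_borel T1_borel"
proof -
  have "gf t \<in> measurable T1_borel (sigma (topspace (T1 p)) {U. openin (T1 p) U})"
  proof (rule measurable_measure_of)
    show "gf t \<in> space T1_borel \<rightarrow> topspace (T1 p)" using gf_in by (auto simp: space_T1_borel)
    show "gf t -` U \<inter> space T1_borel \<in> sets T1_borel" if "U \<in> {U. openin (T1 p) U}" for U
      using openin_gf_vimage that by (simp add: space_T1_borel)
  qed (auto dest: openin_subset)
  then show ?thesis by (simp add: T1_borel_def[symmetric])
qed

text \<open>Along a line, visits to the preimage are visits to \<open>A\<close> shifted by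
  \<open>t\<close>. The two visit times differ by at most 2|t|, so the frequencies at a common
  typical point agree.\<close>

lemma mass_gf_vimage:
  assumes A: "A \<in> sets T1_borel"
  shows "mass (gf t -` A \<inter> topspace (T1 p)) = mass A"
proof -
  define B where "B = gf t -` A \<inter> topspace (T1 p)"
  have B: "B \<in> sets T1_borel" unfolding B_def using measurable_sets[OF gf_measurable A] by (simp add: space_T1_borel)
  obtain x where x: "x \<in> \<Omega>" "((\<lambda>T. signed_int (visit A x) T / T) \<longlongrightarrow> mass A / v) at_top"
      "((\<lambda>T. signed_int (visit B x) T / T) \<longlongrightarrow> mass B / v) at_top"
    using exists_frequency[OF B AE_frequency[OF A]] by blast
  note m = visit_measurable[OF A \<Omega>D(1)[OF x(1)]]
  have "visit B x = (\<lambda>r. visit A x (r + t))"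
    using gf_V[OF x(1)] vel_in by (auto simp: visit_def B_def indicator_def)
  then have "signed_int (visit B x) T = signed_int (visit A x) (t + T) - signed_int (visit A x) t" for T
    using signed_int_add[OF m visit_bound(1), of t T] by simp
  then have b: "\<bar>signed_int (visit B x) T - signed_int (visit A x) T\<bar> \<le> 2 * \<bar>t\<bar>" for T
    using signed_int_lipschitz[OF m visit_bound(1), of "t + T" T] abs_prim_le[OF m visit_bound(1), of t] by (simp add: abs_le_iff)
  have "((\<lambda>T. signed_int (visit B x) T / T - signed_int (visit A x) T / T) \<longlongrightarrow> 0) at_top"
  proof (rule Lim_null_comparison)
    show "eventually (\<lambda>T. norm (signed_int (visit B x) T / T - signed_int (visit A x) T / T) \<le> 2 * \<bar>t\<bar> / T) at_top"
      using eventually_gt_at_top[of 0]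
    proof eventually_elim
      case (elim T)
      then show ?case using divide_right_mono[OF b[of T], of T] by (simp add: diff_divide_distrib[symmetric])
    qed
    show "((\<lambda>T. 2 * \<bar>t\<bar> / T) \<longlongrightarrow> 0) at_top" by real_asymp
  qed
  moreover have "((\<lambda>T. signed_int (visit B x) T / T - signed_int (visit A x) T / T) \<longlongrightarrow> mass B / v - mass A / v) at_top"
    by (intro tendsto_diff x)
  ultimately have "mass B / v - mass A / v = 0" by (rule tendsto_unique[OF trivial_limit_at_top_linorder, rotated])
  then show ?thesis using v by (simp add: B_def)
qed

lemma invariant_\<nu>: "invariant_under \<nu> (range gf)"
  unfolding invariant_under_def
proof
  fix T assume "T \<in> range gf"
  then obtain t where T: "T = gf t" by blast
  have m: "gf t \<in> measurable \<nu> \<nu>" using gf_measurable measurable_cong_sets[OF sets_\<nu> sets_\<nu>] by blast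
  moreover have "distr \<nu> \<nu> (gf t) = \<nu>"
  proof (rule measure_eqI)
    fix A assume "A \<in> sets (distr \<nu> \<nu> (gf t))"
    then have A: "A \<in> sets \<nu>" by simp
    have "gf t -` A \<inter> topspace (T1 p) \<in> sets T1_borel" using measurable_sets[OF m A] by (simp add: space_\<nu>)
    then show "emeasure (distr \<nu> \<nu> (gf t)) A = emeasure \<nu> A"
      using A by (simp add: emeasure_distr[OF m A] space_\<nu> emeasure_\<nu> mass_gf_vimage)
  qed simp
  ultimately show "T \<in> measurable \<nu> \<nu> \<and> distr \<nu> \<nu> T = \<nu>" using T by blast
qed

text \<open>A line is an orbit of the flow, so it stays in an invariant set forever or never meets
  it, and its frequency is 1 or 0.\<close>

lemma AE_invariant_set:
  assumes A: "A \<in> sets T1_borel" and inv: "\<And>t. gf t -` A \<inter> topspace (T1 p) = A"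
  shows "AE x in \<mu>. x \<in> \<Omega> \<and> ((\<forall>t. vel x t \<in> A) \<and> mass A / v = 1 \<or> (\<forall>t. vel x t \<notin> A) \<and> mass A / v = 0)"
  using AE_frequency[OF A]
proof eventually_elim
  case (elim x)
  then have x: "x \<in> \<Omega>" "((\<lambda>T. signed_int (visit A x) T / T) \<longlongrightarrow> mass A / v) at_top" by auto
  have c: "vel x t \<in> A \<longleftrightarrow> vel x 0 \<in> A" for t
  proof -
    have "vel x 0 \<in> gf t -` A \<inter> topspace (T1 p) \<longleftrightarrow> vel x 0 \<in> A" by (simp only: inv)
    then show ?thesis using gf_V[OF x(1), of t 0] vel_in[of x 0] by simp
  qed
  show ?case
  proof (cases "vel x 0 \<in> A")
    case True
    then have "visit A x = (\<lambda>_. 1)" using c by (auto simp: visit_def)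
    then have h: "signed_int (visit A x) T / T = 1" if "0 < T" for T using that by (simp add: signed_int_const_1)
    have "eventually (\<lambda>T. signed_int (visit A x) T / T = 1) at_top"
      by (rule eventually_mono[OF eventually_gt_at_top[of 0] h])
    then have "mass A / v = 1"
      by (rule tendsto_unique[OF trivial_limit_at_top_linorder x(2) tendsto_eventually])
    then show ?thesis using c True x by auto
  next
    case False
    then have "visit A x = (\<lambda>_. 0)" using c by (auto simp: visit_def)
    then have z: "(\<lambda>T. signed_int (visit A x) T / T) = (\<lambda>_. 0)" by (simp add: signed_int_def)
    have "mass A / v = 0"
      by (rule tendsto_unique[OF trivial_limit_at_top_linorder x(2)[unfolded z] tendsto_const])
    then show ?thesis using c False x by auto
  qed
qed

lemma ergodic_\<nu>: "ergodic_under \<nu> (range gf)"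
  unfolding ergodic_under_def
proof (intro ballI impI)
  fix A assume A: "A \<in> sets \<nu>" "\<forall>T\<in>range gf. T -` A \<inter> space \<nu> = A"
  then have inv: "gf t -` A \<inter> topspace (T1 p) = A" for t by (simp add: space_\<nu>)
  have A': "A \<in> sets T1_borel" using A by simp
  obtain x where "mass A / v = 1 \<or> mass A / v = 0"
    using exists_frequency[OF A' AE_invariant_set[OF A' inv]] by blast
  then show "emeasure \<nu> A = 0 \<or> emeasure \<nu> A = 1" using A' by (auto simp: emeasure_\<nu>)
qed

text \<open>Zero frequency alone would not exclude rare visits. So \<open>U\<close> is enlarged to
  the union \<open>W\<close> of its flow translates, which is invariant and still null; by
  \<open>AE_invariant_set\<close> almost every line avoids it.\<close>

lemma AE_avoids_null_open:
  assumes U: "openin (T1 p) U" and null: "emeasure \<nu> U = 0"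
  shows "AE x in \<mu>. \<forall>t. vel x t \<notin> U"
proof -
  define W where "W = (\<Union>t. gf t -` U \<inter> topspace (T1 p))"
  have Wo: "openin (T1 p) W" unfolding W_def using openin_gf_vimage[OF U] by (intro openin_Union) blast
  have gf_add: "gf a (gf b \<xi>) = gf (a + b) \<xi>" if \<xi>: "\<xi> \<in> topspace (T1 p)" for a b \<xi>
  proof -
    obtain \<eta> where \<eta>: "\<eta> \<in> T1_hplane" "\<xi> = T1_proj p \<eta>" using \<xi> unfolding topspace_T1 by blast
    obtain c where c: "is_line c" "tang c 0 = \<eta>" using exists_line_tang[OF \<eta>(1)] by blast
    have "hflow a (hflow b \<eta>) = hflow (a + b) \<eta>"
      using hflow_tang[OF c(1), of a b] hflow_tang_0(1)[OF c(1)] c(2) by metis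
    then show ?thesis using \<eta> geodesic_flow_proj hflow_in_T1_hplane by simp
  qed
  have inv: "gf r -` W \<inter> topspace (T1 p) = W" for r
  proof (intro set_eqI iffI)
    fix \<xi> assume "\<xi> \<in> gf r -` W \<inter> topspace (T1 p)"
    then obtain t where "\<xi> \<in> topspace (T1 p)" "gf t (gf r \<xi>) \<in> U" by (auto simp: W_def)
    then show "\<xi> \<in> W" using gf_add by (auto simp: W_def)
  next
    fix \<xi> assume "\<xi> \<in> W"
    then obtain t where t: "\<xi> \<in> topspace (T1 p)" "gf t \<xi> \<in> U" by (auto simp: W_def)
    then have "gf (t - r) (gf r \<xi>) \<in> U" using gf_add by simp
    then show "\<xi> \<in> gf r -` W \<inter> topspace (T1 p)" using t gf_in by (auto simp: W_def)
  qed
  \<comment> \<open>\<open>U\<close> is open and flow lines are continuous, so rational times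
    suffice and \<open>W\<close> is a countable union of null sets.\<close>
  have Wq: "W = (\<Union>q\<in>\<rat>. gf q -` U \<inter> topspace (T1 p))"
  proof
    show "W \<subseteq> (\<Union>q\<in>\<rat>. gf q -` U \<inter> topspace (T1 p))"
    proof
      fix \<xi> assume "\<xi> \<in> W"
      then obtain t where t: "\<xi> \<in> topspace (T1 p)" "gf t \<xi> \<in> U" by (auto simp: W_def)
      obtain \<eta> where \<eta>: "\<eta> \<in> T1_hplane" "\<xi> = T1_proj p \<eta>" using t(1) unfolding topspace_T1 by blast
      obtain c where c: "is_line c" "tang c 0 = \<eta>" using exists_line_tang[OF \<eta>(1)] by blast
      have g: "gf r \<xi> = T1_proj p (tang c r)" for r
        using geodesic_flow_proj[OF \<eta>(1)] hflow_tang_0(1)[OF c(1)] \<eta> c by simp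
      have "openin (top_of_set T1_hplane) {\<xi> \<in> T1_hplane. T1_proj p \<xi> \<in> U}" using U openin_T1 by blast
      then have "openin (top_of_set UNIV) (UNIV \<inter> tang c -` {\<xi> \<in> T1_hplane. T1_proj p \<xi> \<in> U})"
        by (intro continuous_openin_preimage[OF continuous_on_tang[OF c(1)]]) (auto simp: tang_in_T1_hplane[OF c(1)])
      then have "open {r. gf r \<xi> \<in> U}" using tang_in_T1_hplane[OF c(1)] by (simp add: g vimage_def)
      moreover have "t \<in> {r. gf r \<xi> \<in> U}" using t by simp
      ultimately obtain e where e: "e > 0" "ball t e \<subseteq> {r. gf r \<xi> \<in> U}" using openE by blast
      obtain q where "q \<in> \<rat>" "t < q" "q < t + e" using Rats_dense_in_real[of t "t + e"] e(1) by auto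
      then have "gf q \<xi> \<in> U" using e(2) by (auto simp: dist_real_def subset_iff)
      then show "\<xi> \<in> (\<Union>q\<in>\<rat>. gf q -` U \<inter> topspace (T1 p))" using \<open>q \<in> \<rat>\<close> t by blast
    qed
  qed (auto simp: W_def)
  have Um: "U \<in> sets T1_borel" and Wm: "W \<in> sets T1_borel" using U Wo by auto
  have "(\<Union>q\<in>\<rat>. gf q -` U \<inter> topspace (T1 p)) \<in> null_sets \<nu>"
  proof (rule null_sets_UN')
    show "countable \<rat>" by (rule countable_rat)
    show "gf q -` U \<inter> topspace (T1 p) \<in> null_sets \<nu>" for q
      using null mass_gf_vimage[OF Um, of q] openin_gf_vimage[OF U, of q] Um by (auto simp: null_sets_def emeasure_\<nu>)
  qed
  then have "emeasure \<nu> W = 0" using Wq by (simp add: null_sets_def)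
  then have "mass W / v \<noteq> 1" using Wm by (auto simp: emeasure_\<nu>)
  have "U \<subseteq> W"
  proof
    fix \<xi> assume "\<xi> \<in> U"
    then have \<xi>: "\<xi> \<in> topspace (T1 p)" using openin_subset[OF U] by blast
    then obtain \<eta> where \<eta>: "\<eta> \<in> T1_hplane" "\<xi> = T1_proj p \<eta>" unfolding topspace_T1 by blast
    obtain c where c: "is_line c" "tang c 0 = \<eta>" using exists_line_tang[OF \<eta>(1)] by blast
    have "gf 0 \<xi> = \<xi>" using geodesic_flow_proj[OF \<eta>(1), of 0] hflow_tang_0(1)[OF c(1), of 0] c(2) \<eta>(2) by simp
    then show "\<xi> \<in> W" using \<open>\<xi> \<in> U\<close> \<xi> by (auto simp: W_def intro!: exI[of _ 0])
  qed
  show ?thesis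
    using AE_invariant_set[OF Wm inv]
    by eventually_elim (use \<open>mass W / v \<noteq> 1\<close> \<open>U \<subseteq> W\<close> in blast)
qed

text \<open>Base sets of measure zero are avoided by the line; base sets of positive measure are
  visited, since their frequency is positive. There are countably many, so one null set of x is
  discarded.\<close>

lemma AE_support: "AE x in \<mu>. x \<in> \<Omega> \<and> msupport (T1 p) \<nu> = T1 p closure_of range (vel x)"
proof -
  obtain U :: "nat \<Rightarrow> _" where U: "\<And>n. openin (T1 p) (U n)"
      "\<And>W \<xi>. openin (T1 p) W \<Longrightarrow> \<xi> \<in> W \<Longrightarrow> \<exists>n. \<xi> \<in> U n \<and> U n \<subseteq> W"
    using T1_countable_base by metis
  have Um: "U n \<in> sets T1_borel" for n using U(1) by simp
  have "AE x in \<mu>. \<forall>n. emeasure \<nu> (U n) = 0 \<longrightarrow> (\<forall>t. vel x t \<notin> U n)"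
    unfolding AE_all_countable
  proof
    fix n
    show "AE x in \<mu>. emeasure \<nu> (U n) = 0 \<longrightarrow> (\<forall>t. vel x t \<notin> U n)"
      using AE_avoids_null_open[OF U(1)[of n]] by (cases "emeasure \<nu> (U n) = 0") auto
  qed
  moreover have "AE x in \<mu>. \<forall>n. x \<in> \<Omega> \<and> ((\<lambda>T. signed_int (visit (U n) x) T / T) \<longlongrightarrow> mass (U n) / v) at_top"
    unfolding AE_all_countable using AE_frequency[OF Um] by (auto elim: eventually_mono)
  ultimately show ?thesis
  proof eventually_elim
    case (elim x)
    have "msupport (T1 p) \<nu> \<subseteq> T1 p closure_of range (vel x)"
    proof
      fix \<xi> assume "\<xi> \<in> msupport (T1 p) \<nu>"
      then have \<xi>: "\<xi> \<in> topspace (T1 p)" "\<And>W. openin (T1 p) W \<Longrightarrow> \<xi> \<in> W \<Longrightarrow> emeasure \<nu> W > 0"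
        by (auto simp: msupport_def)
      show "\<xi> \<in> T1 p closure_of range (vel x)"
        unfolding in_closure_of
      proof (intro conjI allI impI \<xi>(1))
        fix W assume "\<xi> \<in> W \<and> openin (T1 p) W"
        then obtain n where n: "\<xi> \<in> U n" "U n \<subseteq> W" using U(2) by blast
        have "\<exists>t. vel x t \<in> U n"
        proof (rule ccontr)
          assume "\<nexists>t. vel x t \<in> U n"
          then have "visit (U n) x = (\<lambda>_. 0)" by (auto simp: visit_def)
          then have z: "(\<lambda>T. signed_int (visit (U n) x) T / T) = (\<lambda>_. 0)" by (simp add: signed_int_def)
          have "((\<lambda>T. signed_int (visit (U n) x) T / T) \<longlongrightarrow> mass (U n) / v) at_top" using elim(2) by blast
          then have "mass (U n) / v = 0"
            unfolding z by (rule tendsto_unique[OF trivial_limit_at_top_linorder _ tendsto_const])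
          then show False using \<xi>(2)[OF U(1) n(1)] Um by (auto simp: emeasure_\<nu>)
        qed
        then show "\<exists>y. y \<in> range (vel x) \<and> y \<in> W" using n(2) by blast
      qed
    qed
    moreover have "T1 p closure_of range (vel x) \<subseteq> msupport (T1 p) \<nu>"
    proof
      fix \<xi> assume "\<xi> \<in> T1 p closure_of range (vel x)"
      then have \<xi>: "\<xi> \<in> topspace (T1 p)" "\<And>W. \<xi> \<in> W \<Longrightarrow> openin (T1 p) W \<Longrightarrow> \<exists>y. y \<in> range (vel x) \<and> y \<in> W"
        unfolding in_closure_of by blast+
      show "\<xi> \<in> msupport (T1 p) \<nu>"
        unfolding msupport_def
      proof (intro CollectI conjI allI impI \<xi>(1))
        fix W assume W: "openin (T1 p) W \<and> \<xi> \<in> W"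
        then obtain n where n: "\<xi> \<in> U n" "U n \<subseteq> W" using U(2) by blast
        have "emeasure \<nu> (U n) \<noteq> 0" using \<xi>(2)[OF n(1) U(1)] elim(1) by blast
        moreover have "emeasure \<nu> (U n) \<le> emeasure \<nu> W" using n W by (intro emeasure_mono) auto
        ultimately show "emeasure \<nu> W > 0" by (metis not_gr_zero le_zero_eq)
      qed
    qed
    ultimately show ?case using elim by blast
  qed
qed

end

subsection \<open>Equidistribution\<close>

lemma card_less_real_bounds:
  fixes r :: real
  assumes "0 \<le> r" "r \<le> real k"
  shows "real (card {j\<in>{1..k}. real j < r}) \<le> r" "r \<le> real (card {j\<in>{1..k}. real j < r}) + 1"
proof -
  \<comment> \<open>For r > 0 the largest integer strictly below r, as the count uses a strict
    inequality; for r = 0 the conversion to nat gives 0.\<close>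
  define m where "m = nat (\<lceil>r\<rceil> - 1)"
  have mk: "m \<le> k" using assms unfolding m_def by linarith
  have "real j < r \<longleftrightarrow> j \<le> m" if "1 \<le> j" for j
    using that unfolding m_def by linarith
  then have "{j\<in>{1..k}. real j < r} = {1..m}" using mk by auto
  then have c: "card {j\<in>{1..k}. real j < r} = m" by simp
  show "real (card {j\<in>{1..k}. real j < r}) \<le> r" unfolding c m_def using assms by linarith
  show "r \<le> real (card {j\<in>{1..k}. real j < r}) + 1" unfolding c m_def by linarith
qed

text \<open>The indicators of the superlevel sets add up, at x, to the number of j in {1..k} with j
  < k \<phi>(x), which is k \<phi>(x) up to an error of 1.\<close>

lemma (in prob_space) layer_bounds:
  fixes \<phi> :: "'a \<Rightarrow> real"
  assumes [measurable]: "\<phi> \<in> borel_measurable M" and b: "\<And>x. x \<in> space M \<Longrightarrow> 0 \<le> \<phi> x \<and> \<phi> x \<le> 1" and "k > 0"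
  shows "(\<Sum>j=1..k. prob {x \<in> space M. real j < real k * \<phi> x}) / k \<le> (\<integral>x. \<phi> x \<partial>M)"
    "(\<integral>x. \<phi> x \<partial>M) \<le> (\<Sum>j=1..k. prob {x \<in> space M. real j < real k * \<phi> x}) / k + 1 / k"
proof -
  define h where "h x = (\<Sum>j=1..k. indicat_real {x \<in> space M. real j < real k * \<phi> x} x)" for x
  have hc: "h x = real (card {j\<in>{1..k}. real j < real k * \<phi> x})" if "x \<in> space M" for x
  proof -
    have "h x = (\<Sum>j=1..k. if real j < real k * \<phi> x then 1 else 0)"
      unfolding h_def using that by (intro sum.cong) (auto simp: indicator_def)
    then show ?thesis by (simp add: sum.If_cases Int_def)
  qed
  have r: "0 \<le> real k * \<phi> x" "real k * \<phi> x \<le> real k" if "x \<in> space M" for x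
    using b[OF that] \<open>k > 0\<close> by (auto intro: mult_left_le)
  have hb: "h x \<le> real k * \<phi> x" "real k * \<phi> x \<le> h x + 1" if "x \<in> space M" for x
    using card_less_real_bounds[OF r[OF that]] hc[OF that] by auto
  have ih: "integrable M h" unfolding h_def by (intro Bochner_Integration.integrable_sum integrable_real_indicator) (auto simp: emeasure_eq_measure)
  have ip: "integrable M \<phi>" by (rule integrable_const_bound[of _ 1]) (use b in auto)
  have Ih: "(\<integral>x. h x \<partial>M) = (\<Sum>j=1..k. prob {x \<in> space M. real j < real k * \<phi> x})"
    unfolding h_def by (subst Bochner_Integration.integral_sum) (auto simp: emeasure_eq_measure Int_absorb1 subset_eq)
  have "(\<integral>x. h x \<partial>M) \<le> (\<integral>x. real k * \<phi> x \<partial>M)"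
    by (rule integral_mono) (use ih ip hb in auto)
  then show "(\<Sum>j=1..k. prob {x \<in> space M. real j < real k * \<phi> x}) / k \<le> (\<integral>x. \<phi> x \<partial>M)"
    using \<open>k > 0\<close> by (simp add: Ih pos_divide_le_eq mult.commute)
  have "(\<integral>x. real k * \<phi> x \<partial>M) \<le> (\<integral>x. h x + 1 \<partial>M)"
    by (rule integral_mono) (use ih ip hb in auto)
  then have "real k * (\<integral>x. \<phi> x \<partial>M) \<le> (\<Sum>j=1..k. prob {x \<in> space M. real j < real k * \<phi> x}) + 1"
    using ih by (simp add: Ih prob_space)
  then show "(\<integral>x. \<phi> x \<partial>M) \<le> (\<Sum>j=1..k. prob {x \<in> space M. real j < real k * \<phi> x}) / k + 1 / k"
    using \<open>k > 0\<close> by (simp add: add_divide_distrib[symmetric] pos_le_divide_eq mult.commute)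
qed

text \<open>The portmanteau argument: slice \<open>\<phi>\<close> into its superlevel sets.\<close>

lemma portmanteau_lower:
  fixes P :: "'i \<Rightarrow> 'b measure" and \<phi> :: "'b \<Rightarrow> real"
  assumes \<nu>: "prob_space \<nu>" and P: "eventually (\<lambda>i. prob_space (P i) \<and> sets (P i) = sets \<nu>) F"
    and \<phi>: "\<phi> \<in> borel_measurable \<nu>" "\<And>x. x \<in> space \<nu> \<Longrightarrow> 0 \<le> \<phi> x \<and> \<phi> x \<le> 1"
    and low: "\<And>y e. 0 < e \<Longrightarrow> eventually (\<lambda>i. measure \<nu> {x \<in> space \<nu>. y < \<phi> x} - e < measure (P i) {x \<in> space \<nu>. y < \<phi> x}) F"
    and "e > 0"
  shows "eventually (\<lambda>i. (\<integral>x. \<phi> x \<partial>\<nu>) - e < (\<integral>x. \<phi> x \<partial>P i)) F"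
proof -
  obtain k :: nat where k: "k > 0" "1 / real k < e / 2"
    using \<open>e > 0\<close> by (metis half_gt_zero nat_approx_posE of_nat_Suc zero_less_Suc)
  have s: "real j < real k * y \<longleftrightarrow> real j / real k < y" for j y
    using k(1) by (simp add: pos_divide_less_eq mult.commute)
  have "eventually (\<lambda>i. \<forall>j\<in>{1..k}. measure \<nu> {x \<in> space \<nu>. real j / real k < \<phi> x} - e / 2 <
      measure (P i) {x \<in> space \<nu>. real j / real k < \<phi> x}) F"
    using low \<open>e > 0\<close> by (intro eventually_ball_finite) auto
  with P show ?thesis
  proof eventually_elim
    case (elim i)
    have sp: "space (P i) = space \<nu>" using elim sets_eq_imp_space_eq by blast
    have m: "\<phi> \<in> borel_measurable (P i)" using \<phi>(1) elim measurable_cong_sets by blast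
    have "(\<Sum>j=1..k. measure \<nu> {x \<in> space \<nu>. real j / real k < \<phi> x}) - k * (e / 2)
        = (\<Sum>j=1..k. measure \<nu> {x \<in> space \<nu>. real j / real k < \<phi> x} - e / 2)"
      by (simp add: sum_subtractf)
    also have "\<dots> \<le> (\<Sum>j=1..k. measure (P i) {x \<in> space \<nu>. real j / real k < \<phi> x})"
      using elim by (intro sum_mono) (auto intro: less_imp_le)
    finally have le: "(\<Sum>j=1..k. measure \<nu> {x \<in> space \<nu>. real j / real k < \<phi> x}) - k * (e / 2)
        \<le> (\<Sum>j=1..k. measure (P i) {x \<in> space \<nu>. real j / real k < \<phi> x})" .
    have "(\<Sum>j=1..k. measure \<nu> {x \<in> space \<nu>. real j / real k < \<phi> x}) / k - e / 2
        \<le> (\<Sum>j=1..k. measure (P i) {x \<in> space \<nu>. real j / real k < \<phi> x}) / k"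
      using divide_right_mono[OF le, of "real k"] k(1) unfolding diff_divide_distrib by simp
    also have "\<dots> \<le> (\<integral>x. \<phi> x \<partial>P i)"
      using prob_space.layer_bounds(1)[of "P i" \<phi> k] elim m \<phi>(2) k(1) sp by (simp add: s)
    finally have "(\<Sum>j=1..k. measure \<nu> {x \<in> space \<nu>. real j / real k < \<phi> x}) / k - e / 2 \<le> (\<integral>x. \<phi> x \<partial>P i)" .
    moreover have "(\<integral>x. \<phi> x \<partial>\<nu>) \<le> (\<Sum>j=1..k. measure \<nu> {x \<in> space \<nu>. real j / real k < \<phi> x}) / k + 1 / k"
      using prob_space.layer_bounds(2)[OF \<nu> \<phi> k(1)] by (simp add: s)
    ultimately show ?case using k(2) by linarith
  qed
qed

context ergodic_surface
begin

lemma continuous_T1_measurable: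
  assumes "continuous_map (T1 p) euclideanreal \<phi>"
  shows "\<phi> \<in> borel_measurable T1_borel"
proof (rule borel_measurableI)
  fix U :: "real set" assume "open U"
  then have "openin (T1 p) {x \<in> topspace (T1 p). \<phi> x \<in> U}" using assms by (auto simp: continuous_map_def)
  moreover have "\<phi> -` U \<inter> space T1_borel = {x \<in> topspace (T1 p). \<phi> x \<in> U}" by (auto simp: space_T1_borel)
  ultimately show "\<phi> -` U \<inter> space T1_borel \<in> sets T1_borel" by simp
qed

text \<open>An open set is an increasing union of finite unions of base sets, so convergence on the
  latter bounds its measure asymptotically from below. Apply \<open>portmanteau_lower\<close> to
  \<phi> and to its negative.\<close>

lemma weak_limit:
  fixes P :: "real \<Rightarrow> (complex \<times> complex) set measure" and U :: "nat \<Rightarrow> _"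
  assumes U: "\<And>n. openin (T1 p) (U n)" "\<And>W \<xi>. openin (T1 p) W \<Longrightarrow> \<xi> \<in> W \<Longrightarrow> \<exists>n. \<xi> \<in> U n \<and> U n \<subseteq> W"
    and P: "eventually (\<lambda>T. prob_space (P T) \<and> sets (P T) = sets T1_borel) at_top"
    and lim: "\<And>I. finite I \<Longrightarrow> ((\<lambda>T. measure (P T) (\<Union>i\<in>I. U i)) \<longlongrightarrow> measure \<nu> (\<Union>i\<in>I. U i)) at_top"
    and \<phi>: "continuous_map (T1 p) euclideanreal \<phi>"
  shows "((\<lambda>T. \<integral>\<xi>. \<phi> \<xi> \<partial>P T) \<longlongrightarrow> (\<integral>\<xi>. \<phi> \<xi> \<partial>\<nu>)) at_top"
proof -
  interpret \<nu>: prob_space \<nu> by (rule prob_space_\<nu>)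
  have P': "eventually (\<lambda>T. prob_space (P T) \<and> sets (P T) = sets \<nu>) at_top" using P by simp
  have opens: "eventually (\<lambda>T. measure \<nu> W - e < measure (P T) W) at_top" if W: "openin (T1 p) W" and e: "e > 0" for W e
  proof -
    define I where "I k = {n. n < k \<and> U n \<subseteq> W}" for k
    define A where "A k = (\<Union>n\<in>I k. U n)" for k
    have Am: "A k \<in> sets \<nu>" for k unfolding A_def I_def using U(1) by (intro sets.finite_UN) auto
    have "incseq A" unfolding incseq_def A_def I_def by force
    then have "(\<lambda>k. measure \<nu> (A k)) \<longlonglongrightarrow> measure \<nu> (\<Union>k. A k)"
      using Am by (intro \<nu>.finite_Lim_measure_incseq) auto
    moreover have "(\<Union>k. A k) = W"
    proof
      show "W \<subseteq> (\<Union>k. A k)"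
      proof
        fix \<xi> assume "\<xi> \<in> W"
        then obtain n where "\<xi> \<in> U n" "U n \<subseteq> W" using U(2) W by blast
        then have "\<xi> \<in> A (Suc n)" by (auto simp: A_def I_def)
        then show "\<xi> \<in> (\<Union>k. A k)" by blast
      qed
    qed (auto simp: A_def I_def)
    ultimately have "eventually (\<lambda>k. measure \<nu> W - e / 2 < measure \<nu> (A k)) sequentially"
      using e by (intro order_tendstoD(1)[of _ "measure \<nu> W"]) auto
    then obtain k where k: "measure \<nu> W - e / 2 < measure \<nu> (A k)" by (auto simp: eventually_sequentially)
    have "((\<lambda>T. measure (P T) (A k)) \<longlongrightarrow> measure \<nu> (A k)) at_top"
      unfolding A_def by (rule lim) (simp add: I_def)
    then have "eventually (\<lambda>T. measure \<nu> (A k) - e / 2 < measure (P T) (A k)) at_top"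
      using e by (intro order_tendstoD(1)[of _ "measure \<nu> (A k)"]) auto
    with P show ?thesis
    proof eventually_elim
      case (elim T)
      then interpret PT: prob_space "P T" by simp
      have "measure (P T) (A k) \<le> measure (P T) W"
        using elim W by (intro PT.finite_measure_mono) (auto simp: A_def I_def)
      then show ?case using k elim by linarith
    qed
  qed
  have lower: "eventually (\<lambda>T. (\<integral>\<xi>. \<phi> \<xi> \<partial>\<nu>) - e < (\<integral>\<xi>. \<phi> \<xi> \<partial>P T)) at_top"
    if \<phi>: "continuous_map (T1 p) euclideanreal \<phi>" and e: "e > 0" for \<phi> e
  proof -
    obtain B where B: "B > 0" "\<And>\<xi>. \<xi> \<in> topspace (T1 p) \<Longrightarrow> \<bar>\<phi> \<xi>\<bar> \<le> B"
      using T1_bounded[OF \<phi>] unfolding topspace_T1 by blast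
    \<comment> \<open>The affine change that carries [-B, B] onto [0, 1], where
      \<open>portmanteau_lower\<close> applies.\<close>
    define \<psi> where "\<psi> \<xi> = \<phi> \<xi> / (2 * B) + 1 / 2" for \<xi>
    have m: "\<phi> \<in> borel_measurable \<nu>"
      using continuous_T1_measurable[OF \<phi>] measurable_cong_sets[OF sets_\<nu> refl] by blast
    have \<psi>m: "\<psi> \<in> borel_measurable \<nu>" unfolding \<psi>_def[abs_def] using m by measurable
    have int: "(\<integral>\<xi>. \<psi> \<xi> \<partial>Q) = (\<integral>\<xi>. \<phi> \<xi> \<partial>Q) / (2 * B) + 1 / 2" if Q: "prob_space Q" "sets Q = sets \<nu>" for Q
    proof -
      interpret Q: prob_space Q by fact
      have "\<phi> \<in> borel_measurable Q" using m measurable_cong_sets[OF Q(2) refl] by blast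
      moreover have "space Q = topspace (T1 p)" using sets_eq_imp_space_eq[OF Q(2)] by (simp add: space_\<nu>)
      ultimately have "integrable Q \<phi>" using B(2) by (intro Q.integrable_const_bound[of _ B]) auto
      then show ?thesis unfolding \<psi>_def by (simp add: Q.prob_space)
    qed
    have "eventually (\<lambda>T. (\<integral>\<xi>. \<psi> \<xi> \<partial>\<nu>) - e / (2 * B) < (\<integral>\<xi>. \<psi> \<xi> \<partial>P T)) at_top"
    proof (rule portmanteau_lower[OF prob_space_\<nu> P' \<psi>m])
      show "0 \<le> \<psi> \<xi> \<and> \<psi> \<xi> \<le> 1" if "\<xi> \<in> space \<nu>" for \<xi>
        using B(1) B(2)[of \<xi>] that by (auto simp: \<psi>_def space_\<nu> abs_le_iff field_simps)
      show "0 < e / (2 * B)" using e B by simp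
      fix y e' :: real assume e': "0 < e'"
      have "{\<xi> \<in> space \<nu>. y < \<psi> \<xi>} = {\<xi> \<in> topspace (T1 p). \<phi> \<xi> \<in> {(y - 1 / 2) * (2 * B)<..}}"
        using B(1) by (auto simp: \<psi>_def space_\<nu> field_simps)
      moreover have "openin (T1 p) {\<xi> \<in> topspace (T1 p). \<phi> \<xi> \<in> {(y - 1 / 2) * (2 * B)<..}}"
        using \<phi> unfolding continuous_map_def by (auto simp del: greaterThan_iff)
      ultimately have "openin (T1 p) {\<xi> \<in> space \<nu>. y < \<psi> \<xi>}" by simp
      then show "eventually (\<lambda>i. measure \<nu> {x \<in> space \<nu>. y < \<psi> x} - e' < measure (P i) {x \<in> space \<nu>. y < \<psi> x}) at_top"
        using opens e' by blast
    qed
    with P' show ?thesis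
    proof eventually_elim
      case (elim T)
      then have "(\<integral>\<xi>. \<phi> \<xi> \<partial>\<nu>) / (2 * B) - e / (2 * B) < (\<integral>\<xi>. \<phi> \<xi> \<partial>P T) / (2 * B)"
        using int[of "P T"] int[OF prob_space_\<nu> refl] by simp
      then have "((\<integral>\<xi>. \<phi> \<xi> \<partial>\<nu>) - e) / (2 * B) < (\<integral>\<xi>. \<phi> \<xi> \<partial>P T) / (2 * B)" by (simp add: diff_divide_distrib)
      then show ?case using B(1) by (simp add: divide_less_cancel)
    qed
  qed
  show ?thesis
  proof (rule tendstoI)
    fix e :: real assume e: "e > 0"
    have "continuous_map (T1 p) euclideanreal (\<lambda>\<xi>. - \<phi> \<xi>)" using \<phi> by (rule continuous_map_minus)
    from lower[OF this e] lower[OF \<phi> e]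
    show "eventually (\<lambda>T. dist (\<integral>\<xi>. \<phi> \<xi> \<partial>P T) (\<integral>\<xi>. \<phi> \<xi> \<partial>\<nu>) < e) at_top"
      by eventually_elim (simp add: dist_real_def abs_less_iff)
  qed
qed

section \<open>Time averages along a curve as probability measures\<close>

definition time_measure :: "(real \<Rightarrow> (complex \<times> complex) set) \<Rightarrow> real \<Rightarrow> (complex \<times> complex) set measure" where
  "time_measure c T = distr (uniform_measure lborel {0<..T}) T1_borel c"

lemma time_measure_facts:
  assumes c: "c \<in> measurable borel T1_borel" and "T > 0"
  shows "prob_space (time_measure c T)" "sets (time_measure c T) = sets T1_borel"
    "\<And>A. A \<in> sets T1_borel \<Longrightarrow> measure (time_measure c T) A = (LINT t|lborel. indicat_real {0<..T} t * indicat_real A (c t)) / T"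
proof -
  have c': "c \<in> measurable (uniform_measure lborel {0<..T}) T1_borel"
    using c by (simp cong: measurable_cong_sets)
  have "prob_space (uniform_measure lborel {0<..T})"
    using \<open>T > 0\<close> by (intro prob_space_uniform_measure) auto
  then show "prob_space (time_measure c T)" unfolding time_measure_def by (rule prob_space.prob_space_distr[OF _ c'])
  show "sets (time_measure c T) = sets T1_borel" by (simp add: time_measure_def)
  fix A assume A: "A \<in> sets T1_borel"
  have m: "c -` A \<in> sets borel" using measurable_sets[OF c A] by simp
  have "measure (time_measure c T) A = measure (uniform_measure lborel {0<..T}) (c -` A)"
    unfolding time_measure_def by (simp add: measure_distr[OF c' A])
  also have "\<dots> = measure lborel ({0<..T} \<inter> c -` A) / T"
    using m \<open>T > 0\<close> by (subst measure_uniform_measure) auto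
  also have "measure lborel ({0<..T} \<inter> c -` A) = (LINT t|lborel. indicat_real ({0<..T} \<inter> c -` A) t)" by simp
  also have "\<dots> = (LINT t|lborel. indicat_real {0<..T} t * indicat_real A (c t))"
    by (rule Bochner_Integration.integral_cong) (auto simp: indicator_def)
  finally show "measure (time_measure c T) A = (LINT t|lborel. indicat_real {0<..T} t * indicat_real A (c t)) / T" .
qed

lemma integral_time_measure:
  assumes c: "c \<in> measurable borel T1_borel" and "T > 0" and \<phi>: "\<phi> \<in> borel_measurable T1_borel"
    and cont: "continuous_on UNIV (\<lambda>t. \<phi> (c t))"
  shows "(\<integral>\<xi>. \<phi> \<xi> \<partial>time_measure c T) = 1 / T * integral {0..T} (\<lambda>t. \<phi> (c t))"
proof -
  have c': "c \<in> measurable (uniform_measure lborel {0<..T}) T1_borel"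
    using c by (simp cong: measurable_cong_sets)
  have m[measurable]: "(\<lambda>t. \<phi> (c t)) \<in> borel_measurable borel" using measurable_compose[OF c \<phi>] .
  have "(\<integral>\<xi>. \<phi> \<xi> \<partial>time_measure c T) = (\<integral>t. \<phi> (c t) \<partial>uniform_measure lborel {0<..T})"
    unfolding time_measure_def by (rule integral_distr[OF c' \<phi>])
  also have "\<dots> = (\<integral>t. \<phi> (c t) \<partial>density lborel (\<lambda>t. ennreal (indicat_real {0<..T} t / T)))"
    unfolding uniform_measure_def
    by (intro arg_cong2[where f = lebesgue_integral] density_cong refl)
       (use \<open>T > 0\<close> in \<open>auto simp: indicator_def divide_ennreal[symmetric] simp flip: ennreal_1\<close>)
  also have "\<dots> = (LINT t|lborel. (indicat_real {0<..T} t / T) *\<^sub>R \<phi> (c t))"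
    by (rule integral_density) (use \<open>T > 0\<close> in auto)
  also have "\<dots> = 1 / T * (LINT t|lborel. indicat_real {0<..T} t * \<phi> (c t))"
    by (simp flip: integral_mult_right_zero add: divide_inverse mult_ac)
  \<comment> \<open>The half-open interval of the uniform measure and the closed one of the integral
    differ in the point 0 only.\<close>
  also have "(LINT t|lborel. indicat_real {0<..T} t * \<phi> (c t)) = (LINT t:{0..T}|lborel. \<phi> (c t))"
    unfolding set_lebesgue_integral_def
    by (rule integral_cong_AE, measurable, use AE_lborel_singleton[of 0] in eventually_elim)
       (auto simp: indicator_def)
  also have "\<dots> = integral {0..T} (\<lambda>t. \<phi> (c t))"
    by (rule set_borel_integral_eq_integral(2))
       (rule borel_integrable_atLeastAtMost', use cont continuous_on_subset in blast)
  finally show ?thesis .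
qed

lemma signed_int_eq_fwd: "T > 0 \<Longrightarrow> signed_int g T = (LINT t|lborel. indicat_real {0<..T} t * g t)"
  unfolding signed_int_def by (rule Bochner_Integration.integral_cong) (auto simp: signed_ind_def indicator_def)

lemma signed_int_eq_bwd:
  assumes [measurable]: "g \<in> borel_measurable borel" and "T > 0"
  shows "- signed_int g (- T) = (LINT t|lborel. indicat_real {0<..T} t * g (- t))"
proof -
  have "- signed_int g (- T) = (LINT t|lborel. - (signed_ind (- T) t * g t))" by (simp add: signed_int_def)
  also have "\<dots> = (LINT t|lborel. - (signed_ind (- T) (- t) * g (- t)))"
    using lborel_integral_real_affine[of "-1" "\<lambda>t. - (signed_ind (- T) t * g t)" 0] by simp
  also have "\<dots> = (LINT t|lborel. indicat_real {0<..T} t * g (- t))"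
  proof (rule integral_cong_AE)
    show "AE t in lborel. - (signed_ind (- T) (- t) * g (- t)) = indicat_real {0<..T} t * g (- t)"
      \<comment> \<open>Reflection turns the half-open interval around: [0, T) instead of (0, T], so
        the integrands may differ at 0 and T.\<close>
      using AE_lborel_singleton[of 0] AE_lborel_singleton[of T]
      by eventually_elim (use \<open>T > 0\<close> in \<open>auto simp: signed_ind_def indicator_def\<close>)
  qed measurable
  finally show ?thesis .
qed

lemma vel_velocity: "x \<in> \<Omega> \<Longrightarrow> velocity p (tracking_geodesic S p f x) t = vel x t"
  using velocity_tracking[OF \<Omega>D(2), of x t] \<Omega>D(3)[of x] by (simp add: vel_def tlift_def)

lemma vel_continuous:
  assumes x: "x \<in> \<Omega>" and \<phi>: "continuous_map (T1 p) euclideanreal \<phi>"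
  shows "continuous_on UNIV (\<lambda>t. \<phi> (vel x t))"
proof -
  note l = track_line(1)[OF \<Omega>D(2)[OF x]]
  have "continuous_on UNIV (tang (track (\<sigma> x)))" by (rule continuous_on_tang[OF l])
  from continuous_on_compose2[OF T1_proj_continuous[OF \<phi>] this]
  have "continuous_on UNIV (\<lambda>t. \<phi> (T1_proj p (tang (track (\<sigma> x)) t)))"
    using tang_in_T1_hplane[OF l] by auto
  then show ?thesis using x by (simp add: vel_def tlift_def)
qed

text \<open>Only countably many finite unions of base sets exist, so \<open>AE_frequency\<close>
  holds for all of them outside one null set; there \<open>weak_limit\<close> treats every
  continuous function, for the forward line and for the reversed one.\<close>

lemma AE_equidistributes:
  "AE x in \<mu>. x \<in> \<Omega> \<and> equidistributes_to p (tracking_geodesic S p f x) \<nu>"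
proof -
  obtain U :: "nat \<Rightarrow> _" where U: "\<And>n. openin (T1 p) (U n)"
      "\<And>W \<xi>. openin (T1 p) W \<Longrightarrow> \<xi> \<in> W \<Longrightarrow> \<exists>n. \<xi> \<in> U n \<and> U n \<subseteq> W"
    using T1_countable_base by metis
  define W where "W I = (\<Union>i\<in>I. U i)" for I
  have Wm: "W I \<in> sets T1_borel" for I
    unfolding W_def using U(1) by (intro openin_sets_T1_borel openin_Union) auto
  have "AE x in \<mu>. \<forall>I\<in>{I. finite I}. x \<in> \<Omega> \<and> ((\<lambda>T. signed_int (visit (W I) x) T / T) \<longlongrightarrow> mass (W I) / v) at_top \<and>
    ((\<lambda>T. - signed_int (visit (W I) x) (- T) / T) \<longlongrightarrow> mass (W I) / v) at_top"
    using AE_frequency[OF Wm] by (subst AE_ball_countable[OF countable_Collect_finite]) blast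
  then show ?thesis
  proof eventually_elim
    case (elim x)
    then have x: "x \<in> \<Omega>" by (auto dest: bspec[of _ _ "{}"])
    note c = vel_measurable_fixed[OF \<Omega>D(1)[OF x]]
    have c': "(\<lambda>t. vel x (- t)) \<in> measurable borel T1_borel"
      by (rule measurable_compose[OF _ c]) measurable
    have pos: "eventually (\<lambda>T::real. T > 0) at_top" by (rule eventually_gt_at_top)
    have ev: "eventually (\<lambda>T. prob_space (time_measure c T) \<and> sets (time_measure c T) = sets T1_borel) at_top"
      if "c \<in> measurable borel T1_borel" for c
      using pos by eventually_elim (use time_measure_facts(1,2)[OF that] in auto)
    have fwd: "((\<lambda>T. \<integral>\<xi>. \<phi> \<xi> \<partial>time_measure (vel x) T) \<longlongrightarrow> (\<integral>\<xi>. \<phi> \<xi> \<partial>\<nu>)) at_top"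
      if \<phi>: "continuous_map (T1 p) euclideanreal \<phi>" for \<phi>
    proof (rule weak_limit[OF U ev[OF c] _ \<phi>])
      fix I :: "nat set" assume "finite I"
      then have "((\<lambda>T. signed_int (visit (W I) x) T / T) \<longlongrightarrow> measure \<nu> (W I)) at_top" using elim by (simp add: measure_\<nu>[OF Wm])
      then show "((\<lambda>T. measure (time_measure (vel x) T) (\<Union>i\<in>I. U i)) \<longlongrightarrow> measure \<nu> (\<Union>i\<in>I. U i)) at_top"
        unfolding W_def[symmetric]
      proof (rule Lim_transform_eventually)
        show "eventually (\<lambda>T. signed_int (visit (W I) x) T / T = measure (time_measure (vel x) T) (W I)) at_top"
          using pos by eventually_elim (simp add: time_measure_facts(3)[OF c _ Wm] signed_int_eq_fwd visit_def)
      qed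
    qed
    have bwd: "((\<lambda>T. \<integral>\<xi>. \<phi> \<xi> \<partial>time_measure (\<lambda>t. vel x (- t)) T) \<longlongrightarrow> (\<integral>\<xi>. \<phi> \<xi> \<partial>\<nu>)) at_top"
      if \<phi>: "continuous_map (T1 p) euclideanreal \<phi>" for \<phi>
    proof (rule weak_limit[OF U ev[OF c'] _ \<phi>])
      fix I :: "nat set" assume "finite I"
      then have "((\<lambda>T. - signed_int (visit (W I) x) (- T) / T) \<longlongrightarrow> measure \<nu> (W I)) at_top" using elim by (simp add: measure_\<nu>[OF Wm])
      then show "((\<lambda>T. measure (time_measure (\<lambda>t. vel x (- t)) T) (\<Union>i\<in>I. U i)) \<longlongrightarrow> measure \<nu> (\<Union>i\<in>I. U i)) at_top"
        unfolding W_def[symmetric]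
      proof (rule Lim_transform_eventually)
        show "eventually (\<lambda>T. - signed_int (visit (W I) x) (- T) / T = measure (time_measure (\<lambda>t. vel x (- t)) T) (W I)) at_top"
          using pos
        proof eventually_elim
          case (elim T)
          show ?case
            unfolding signed_int_eq_bwd[OF visit_measurable[OF Wm \<Omega>D(1)[OF x]] elim] time_measure_facts(3)[OF c' elim Wm]
            by (simp add: visit_def)
        qed
      qed
    qed
    have "equidistributes_to p (tracking_geodesic S p f x) \<nu>"
      unfolding equidistributes_to_def vel_velocity[OF x]
    proof (intro allI impI conjI)
      fix \<phi> assume \<phi>: "continuous_map (T1 p) euclideanreal \<phi>"
      note m = continuous_T1_measurable[OF \<phi>]
      note ct = vel_continuous[OF x \<phi>]
      have ct': "continuous_on UNIV (\<lambda>t. \<phi> (vel x (- t)))"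
        by (rule continuous_on_compose2[OF ct]) (auto intro!: continuous_intros)
      show "((\<lambda>T. 1 / T * integral {0..T} (\<lambda>t. \<phi> (vel x t))) \<longlongrightarrow> (\<integral>\<xi>. \<phi> \<xi> \<partial>\<nu>)) at_top"
      proof (rule Lim_transform_eventually[OF fwd[OF \<phi>]])
        show "eventually (\<lambda>T. (\<integral>\<xi>. \<phi> \<xi> \<partial>time_measure (vel x) T) = 1 / T * integral {0..T} (\<lambda>t. \<phi> (vel x t))) at_top"
          using pos by eventually_elim (rule integral_time_measure[OF c _ m ct])
      qed
      show "((\<lambda>T. 1 / T * integral {-T..0} (\<lambda>t. \<phi> (vel x t))) \<longlongrightarrow> (\<integral>\<xi>. \<phi> \<xi> \<partial>\<nu>)) at_top"
      proof (rule Lim_transform_eventually[OF bwd[OF \<phi>]])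
        show "eventually (\<lambda>T. (\<integral>\<xi>. \<phi> \<xi> \<partial>time_measure (\<lambda>t. vel x (- t)) T) = 1 / T * integral {-T..0} (\<lambda>t. \<phi> (vel x t))) at_top"
          using pos
        proof eventually_elim
          case (elim T)
          have "integral {-T..0} (\<lambda>t. \<phi> (vel x t)) = integral {0..T} (\<lambda>t. \<phi> (vel x (- t)))"
            using Henstock_Kurzweil_Integration.integral_reflect_real[of T 0 "\<lambda>t. \<phi> (vel x (- t))"] by simp
          then show ?case using integral_time_measure[OF c' elim m ct'] by simp
        qed
      qed
    qed
    then show ?case using x by blast
  qed
qed

end

theorem theorem3:
  fixes S :: "'a::metric_space set" and p :: "complex \<Rightarrow> 'a"
    and f :: "'a \<Rightarrow> 'a" and \<mu> :: "'a measure"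
  assumes "closed_hyperbolic_surface S p"
    and "f \<in> Homeo0 S"
    and "\<mu> \<in> erg_pos_speed S p f"
  shows "\<exists>\<nu>. borel_prob_on (T1 p) \<nu> \<and>
           (AE x in \<mu>. is_tracking_geodesic S p f x (tracking_geodesic S p f x) \<and>
                       equidistributes_to p (tracking_geodesic S p f x) \<nu>) \<and>
           invariant_under \<nu> (range (geodesic_flow S p)) \<and>
           ergodic_under \<nu> (range (geodesic_flow S p)) \<and>
           (AE x in \<mu>. msupport (T1 p) \<nu> =
                       T1 p closure_of range (velocity p (tracking_geodesic S p f x)))"
proof -
  from assms(3) have \<mu>: "prob_space \<mu>" "sets \<mu> = sets (restrict_space borel S)"
      "invariant_under \<mu> {f}" "ergodic_under \<mu> {f}"
      "\<exists>v>0. AE x in \<mu>. has_rotation_speed S p f x v"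
    unfolding erg_pos_speed_def by blast+
  from \<mu>(5) obtain v where v: "v > 0" "AE x in \<mu>. has_rotation_speed S p f x v" by blast
  interpret ergodic_surface S p f \<mu> v
    by (intro ergodic_surface.intro surface_homeo.intro hyp_surface.intro
        surface_homeo_axioms.intro ergodic_surface_axioms.intro) (fact assms \<mu> v)+
  show ?thesis
  proof (intro exI[of _ \<nu>] conjI borel_prob_\<nu> invariant_\<nu> ergodic_\<nu>)
    show "AE x in \<mu>. is_tracking_geodesic S p f x (tracking_geodesic S p f x) \<and>
        equidistributes_to p (tracking_geodesic S p f x) \<nu>"
      using AE_equidistributes
    proof eventually_elim
      case (elim x)
      then have g: "good v (\<sigma> x)" "p (\<sigma> x) = x" using \<Omega>D by blast+
      then show ?case using tracking_geodesic_track[OF g(1)] elim by simp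
    qed
    show "AE x in \<mu>. msupport (T1 p) \<nu> = T1 p closure_of range (velocity p (tracking_geodesic S p f x))"
      using AE_support
    proof eventually_elim
      case (elim x)
      then have "velocity p (tracking_geodesic S p f x) = vel x" using vel_velocity by blast
      then show ?case using elim by simp
    qed
  qed
qed

end
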